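(* Let $\chi\subset\mathbb{R}^n$ be open and let $h:\mathbb{R}^n\to\mathbb{R}$ satisfy (Z1), (Z2), (Z3) of the context. Put $B(x):=1/h(x)$ for $x\in\chi$. Suppose that $h$ is an almost sure zeroing control barrier function (AS-ZCBF) for the system $$dX_t=\{f(X_t)+g(X_t)(u_o(X_t)+u(t))\}\,dt+\sigma(X_t)\,dW_t,\qquad X_0=x_0\in\chi,$$ i.e. there exist a continuous mapping $\phi:\chi\to\mathbb{R}^m$ and a constant $\gamma>0$ such that $$\mathcal{L}_{f,g,\sigma}(\phi(x),u_o(x),h(x))\ge-\gamma h(x)+L^I_\sigma(h(x))+(h(x))^2L^I_\sigma(B(x))\qquad\text{for all }x\in\chi.$$ Then the system with $u=\phi(X_t)$ is forward invariant in probability (FIiP) in $\chi$.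
   Context: System data: $f:\mathbb{R}^n\to\mathbb{R}^n$, $g:\mathbb{R}^n\to\mathbb{R}^{n\times m}$, $\sigma:\mathbb{R}^n\to\mathbb{R}^{n\times d}$ are locally Lipschitz, $u_o:\mathbb{R}^n\to\mathbb{R}^m$ is continuous, $W_t$ is a $d$-dimensional standard Wiener process on a filtered probability space, and the stochastic differential is in the Itô sense. For a feedback $u=\phi(x)$, $(X_t)_{t<T}$ denotes the maximal solution of the closed-loop system, $T$ being a stopping time. $\mathbb{P}_{x_0}$ is probability conditioned on $X_0=x_0$. Operators: for a $C^2$ function $y$, let $(L_Fy)(x)=\left(\frac{\partial y}{\partial x}F_1(x),\ldots,\frac{\partial y}{\partial x}F_q(x)\right)$ for $F=(F_1,\ldots,F_q)$, and $$L^D_{f,g}(u,u_o(x),y(x))=(L_fy)(x)+(L_gy)(x)(u+u_o(x)),$$ $$L^I_\sigma(y(x))=\tfrac12\mathrm{tr}\left[\sigma(x)\sigma(x)^T\,\nabla^2y(x)\right],$$ $$\mathcal{L}_{f,g,\sigma}(u,u_o(x),y(x))=L^D_{f,g}(u,u_o(x),y(x))+L^I_\sigma(y(x)).$$ Conditions on $h$ and $\chi$: (Z1) $h$ is $C^2$ on $\chi$. (Z2) $h$ is proper in $\chi$: for every $L\in(0,\infty)$ the set $\{x\in\chi\mid h(x)\ge L\}$ is compact. (Z3) $\chi=\{x\in\mathbb{R}^n\mid h(x)>0\}$ and $\partial\chi=\{x\in\mathbb{R}^n\mid h(x)=0\}$. FIiP: let $M\subset\mathbb{R}^n$ be open and $\phi:M\to\mathbb{R}^m$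 continuous. The system with $u=\phi(x)$ is forward invariant in probability (FIiP) in $M$ if there is a $C^2$ mapping $Y:M\to[0,\infty)$ that is proper (for every $L\in[0,\infty)$ the set $\{x\in M\mid Y(x)\le L\}$ is compact) and, for every $x_0\in M$, a continuous mapping $\psi:[0,\infty)\times(0,1)\to[0,\infty)$ such that $$\mathbb{P}_{x_0}\left(\forall t\in[0,l],\ Y(X_t)\le\psi(l,\epsilon)\right)\ge1-\epsilon$$ for all $l\in[0,\infty)$ and $\epsilon\in(0,1)$. The event includes the requirement that $X_t$ is defined and lies in $M$ for all $t\in[0,l]$. *)

theory Defs
  imports "HOL-Probability.Probability"
begin

section \<open>Regularity\<close>

definition locally_Lipschitz :: "('a::metric_space \<Rightarrow> 'b::metric_space) \<Rightarrow> bool" where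
  "locally_Lipschitz f \<longleftrightarrow> (\<forall>x. \<exists>r>0. \<exists>L. L-lipschitz_on (cball x r) f)"

text \<open>Meant for open sets \<open>S\<close>: first and second derivatives are taken at \<open>x\<close>, not within \<open>S\<close>.\<close>

definition C2_on :: "(real ^ 'n) set \<Rightarrow> (real ^ 'n \<Rightarrow> real) \<Rightarrow> bool" where
  "C2_on S y \<longleftrightarrow>
     (\<forall>x\<in>S. y differentiable (at x)) \<and>
     (\<forall>v. \<forall>x\<in>S. (\<lambda>z. frechet_derivative y (at z) v) differentiable (at x)) \<and>
     (\<forall>v w. continuous_on S
        (\<lambda>x. frechet_derivative (\<lambda>z. frechet_derivative y (at z) v) (at x) w))"

definition hessian :: "(real ^ 'n \<Rightarrow> real) \<Rightarrow> real ^ 'n \<Rightarrow> real ^ 'n ^ 'n" where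
  "hessian y x =
     (\<chi> i j. frechet_derivative (\<lambda>z. frechet_derivative y (at z) (axis j 1)) (at x) (axis i 1))"

section \<open>Differential operators\<close>

definition lie_vec :: "(real ^ 'n \<Rightarrow> real ^ 'n) \<Rightarrow> (real ^ 'n \<Rightarrow> real) \<Rightarrow> real ^ 'n \<Rightarrow> real" where
  "lie_vec f y x = frechet_derivative y (at x) (f x)"

definition lie_mat :: "(real ^ 'n \<Rightarrow> real ^ 'm ^ 'n) \<Rightarrow> (real ^ 'n \<Rightarrow> real) \<Rightarrow> real ^ 'n \<Rightarrow> real ^ 'm" where
  "lie_mat g y x = (\<chi> j. frechet_derivative y (at x) (column j (g x)))"

definition gen_drift ::
  "(real ^ 'n \<Rightarrow> real ^ 'n) \<Rightarrow> (real ^ 'n \<Rightarrow> real ^ 'm ^ 'n) \<Rightarrow> real ^ 'm \<Rightarrow> (real ^ 'n \<Rightarrow> real ^ 'm)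
    \<Rightarrow> (real ^ 'n \<Rightarrow> real) \<Rightarrow> real ^ 'n \<Rightarrow> real" where
  "gen_drift f g u uo y x = lie_vec f y x + lie_mat g y x \<bullet> (u + uo x)"

definition gen_diff ::
  "(real ^ 'n \<Rightarrow> real ^ 'd ^ 'n) \<Rightarrow> (real ^ 'n \<Rightarrow> real) \<Rightarrow> real ^ 'n \<Rightarrow> real" where
  "gen_diff \<sigma> y x = 1/2 * trace (\<sigma> x ** transpose (\<sigma> x) ** hessian y x)"

definition gen ::
  "(real ^ 'n \<Rightarrow> real ^ 'n) \<Rightarrow> (real ^ 'n \<Rightarrow> real ^ 'm ^ 'n) \<Rightarrow> (real ^ 'n \<Rightarrow> real ^ 'd ^ 'n)
    \<Rightarrow> real ^ 'm \<Rightarrow> (real ^ 'n \<Rightarrow> real ^ 'm) \<Rightarrow> (real ^ 'n \<Rightarrow> real) \<Rightarrow> real ^ 'n \<Rightarrow> real" where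
  "gen f g \<sigma> u uo y x = gen_drift f g u uo y x + gen_diff \<sigma> y x"

section \<open>Filtered probability spaces and Wiener processes\<close>

text \<open>
  Filtrations are indexed by \<open>[0,\<infinity>]\<close>, so that the library's stopping times may take the value
  \<open>\<infinity>\<close>. The sigma-algebra \<open>F \<infinity>\<close> may be any one between the union of the others and that of
  \<open>P\<close>, so this does not restrict the filtrations on \<open>[0,\<infinity>)\<close>. Processes are indexed by \<open>real\<close>
  and only their values at nonnegative times matter.
\<close>

locale filtered_prob_space = prob_space P + filtration "space P" F
  for P :: "'w measure" and F :: "ennreal \<Rightarrow> 'w measure" +
  assumes subalgebra_F: "subalgebra P (F t)"

definition wiener_process ::
  "'w measure \<Rightarrow> (ennreal \<Rightarrow> 'w measure) \<Rightarrow> (real \<Rightarrow> 'w \<Rightarrow> real ^ 'd) \<Rightarrow> bool" where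
  "wiener_process P F W \<longleftrightarrow>
     (\<forall>t\<ge>0. W t \<in> borel_measurable (F (ennreal t))) \<and>
     (AE \<omega> in P. W 0 \<omega> = 0) \<and>
     (AE \<omega> in P. continuous_on {0..} (\<lambda>t. W t \<omega>)) \<and>
     (\<forall>s t. 0 \<le> s \<and> s < t \<longrightarrow>
        prob_space.indep_set P (sets (F (ennreal s)))
          {(\<lambda>\<omega>. W t \<omega> - W s \<omega>) -` A \<inter> space P | A. A \<in> sets borel} \<and>
        distributed P lborel (\<lambda>\<omega>. W t \<omega> - W s \<omega>)
          (\<lambda>z. ennreal (\<Prod>i\<in>UNIV. normal_density 0 (sqrt (t - s)) (z $ i))))"

section \<open>The Ito integral\<close>

text \<open>
  \<open>step_data P F N p \<xi>\<close>: the integrand with value \<open>\<xi> i\<close> on \<open>(p i, p (i + 1)]\<close> for \<open>i < N\<close>, and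
  zero elsewhere, is a bounded simple nonanticipative process.
\<close>

definition step_data ::
  "'w measure \<Rightarrow> (ennreal \<Rightarrow> 'w measure) \<Rightarrow> nat \<Rightarrow> (nat \<Rightarrow> real) \<Rightarrow> (nat \<Rightarrow> 'w \<Rightarrow> real ^ 'd ^ 'n) \<Rightarrow> bool"
where
  "step_data P F N p \<xi> \<longleftrightarrow>
     0 \<le> p 0 \<and> (\<forall>i<N. p i < p (Suc i)) \<and>
     (\<forall>i<N. \<xi> i \<in> borel_measurable (F (ennreal (p i)))) \<and>
     (\<exists>C. \<forall>i<N. \<forall>\<omega>\<in>space P. norm (\<xi> i \<omega>) \<le> C)"

definition step_process ::
  "nat \<Rightarrow> (nat \<Rightarrow> real) \<Rightarrow> (nat \<Rightarrow> 'w \<Rightarrow> real ^ 'd ^ 'n) \<Rightarrow> real \<Rightarrow> 'w \<Rightarrow> real ^ 'd ^ 'n" where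
  "step_process N p \<xi> s \<omega> = (\<Sum>i<N. indicator {p i<..p (Suc i)} s *\<^sub>R \<xi> i \<omega>)"

definition step_integral ::
  "(real \<Rightarrow> 'w \<Rightarrow> real ^ 'd) \<Rightarrow> nat \<Rightarrow> (nat \<Rightarrow> real) \<Rightarrow> (nat \<Rightarrow> 'w \<Rightarrow> real ^ 'd ^ 'n)
    \<Rightarrow> real \<Rightarrow> 'w \<Rightarrow> real ^ 'n" where
  "step_integral W N p \<xi> t \<omega> =
     (\<Sum>i<N. \<xi> i \<omega> *v (W (min t (p (Suc i))) \<omega> - W (min t (p i)) \<omega>))"

text \<open>
  \<open>ito_integral P F W H I\<close>: \<open>I\<close> is a version, with almost surely continuous paths, of the Ito
  integral process of \<open>H\<close> with respect to \<open>W\<close>. This is the usual extension from simple integrands to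
  measurable adapted integrands with almost surely locally square integrable paths: if simple
  integrands tend to \<open>H\<close> in \<open>L\<^sup>2[0,t]\<close> in probability, then their integrals converge in probability,
  and the limit is independent of the approximating sequence. The norm on matrices is the
  Frobenius norm, and the \<open>[0,\<infinity>]\<close>-valued integral ensures that a divergent integral is not read as
  \<open>0\<close>.
\<close>

definition ito_integral ::
  "'w measure \<Rightarrow> (ennreal \<Rightarrow> 'w measure) \<Rightarrow> (real \<Rightarrow> 'w \<Rightarrow> real ^ 'd)
    \<Rightarrow> (real \<Rightarrow> 'w \<Rightarrow> real ^ 'd ^ 'n) \<Rightarrow> (real \<Rightarrow> 'w \<Rightarrow> real ^ 'n) \<Rightarrow> bool" where
  "ito_integral P F W H I \<longleftrightarrow>
     (\<lambda>(s, \<omega>). H s \<omega>) \<in> borel_measurable (restrict_space borel {0..} \<Otimes>\<^sub>M P) \<and>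
     (\<forall>t\<ge>0. H t \<in> borel_measurable (F (ennreal t))) \<and>
     (\<forall>t\<ge>0. AE \<omega> in P. (\<integral>\<^sup>+ s\<in>{0..t}. ennreal ((norm (H s \<omega>))\<^sup>2) \<partial>lborel) < \<infinity>) \<and>
     (\<forall>t\<ge>0. I t \<in> borel_measurable P) \<and>
     (AE \<omega> in P. continuous_on {0..} (\<lambda>t. I t \<omega>)) \<and>
     (\<exists>N p \<xi>. (\<forall>k. step_data P F (N k) (p k) (\<xi> k)) \<and>
        (\<forall>t\<ge>0. \<forall>\<epsilon>>0.
           (\<lambda>k. measure P {\<omega>\<in>space P.
              ennreal \<epsilon> <
                (\<integral>\<^sup>+ s\<in>{0..t}.
                   ennreal ((norm (step_process (N k) (p k) (\<xi> k) s \<omega> - H s \<omega>))\<^sup>2) \<partial>lborel)})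
             \<longlonglongrightarrow> 0 \<and>
           (\<lambda>k. measure P {\<omega>\<in>space P.
              \<epsilon> < norm (step_integral W (N k) (p k) (\<xi> k) t \<omega> - I t \<omega>)})
             \<longlonglongrightarrow> 0))"

section \<open>Solutions of stochastic differential equations\<close>

text \<open>
  \<open>sde_solution P F W M b \<sigma> x0 X T\<close>: \<open>(X t)\<close>, for \<open>t < T\<close>, is an \<open>M\<close>-valued solution of
  \<open>dX = b(X) dt + \<sigma>(X) dW\<close> started at \<open>x0\<close>. The equation is imposed up to each \<open>\<tau> k\<close> of a
  nondecreasing sequence of stopping times that announces \<open>T\<close> (\<open>\<tau> k < T\<close>, \<open>\<tau> k \<longlonglongrightarrow> T\<close>); in
  particular \<open>T > 0\<close> almost surely. Values of \<open>X\<close> from time \<open>T\<close> on are irrelevant.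
\<close>

definition sde_solution ::
  "'w measure \<Rightarrow> (ennreal \<Rightarrow> 'w measure) \<Rightarrow> (real \<Rightarrow> 'w \<Rightarrow> real ^ 'd) \<Rightarrow> (real ^ 'n) set
    \<Rightarrow> (real ^ 'n \<Rightarrow> real ^ 'n) \<Rightarrow> (real ^ 'n \<Rightarrow> real ^ 'd ^ 'n) \<Rightarrow> real ^ 'n
    \<Rightarrow> (real \<Rightarrow> 'w \<Rightarrow> real ^ 'n) \<Rightarrow> ('w \<Rightarrow> ennreal) \<Rightarrow> bool" where
  "sde_solution P F W M b \<sigma> x0 X T \<longleftrightarrow>
     stopping_time F T \<and>
     (\<forall>t\<ge>0. X t \<in> borel_measurable (restrict_space (F (ennreal t)) {\<omega>\<in>space P. ennreal t < T \<omega>})) \<and>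
     (\<forall>\<omega>\<in>space P. continuous_on {t. 0 \<le> t \<and> ennreal t < T \<omega>} (\<lambda>t. X t \<omega>)) \<and>
     (\<forall>\<omega>\<in>space P. \<forall>t\<ge>0. ennreal t < T \<omega> \<longrightarrow> X t \<omega> \<in> M) \<and>
     (AE \<omega> in P. X 0 \<omega> = x0) \<and>
     (\<exists>\<tau> :: nat \<Rightarrow> 'w \<Rightarrow> ennreal.
        (\<forall>k. stopping_time F (\<tau> k)) \<and>
        (AE \<omega> in P. incseq (\<lambda>k. \<tau> k \<omega>) \<and> (\<forall>k. \<tau> k \<omega> < T \<omega>) \<and> (\<lambda>k. \<tau> k \<omega>) \<longlonglongrightarrow> T \<omega>) \<and>
        (\<forall>k. \<exists>I. ito_integral P F W (\<lambda>s \<omega>. if ennreal s < \<tau> k \<omega> then \<sigma> (X s \<omega>) else 0) I \<and>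
           (AE \<omega> in P. \<forall>t\<ge>0.
              let r = enn2real (min (ennreal t) (\<tau> k \<omega>)) in
              X r \<omega> = x0 + (LINT s:{0..r}|lborel. b (X s \<omega>)) + I t \<omega>)))"

text \<open>
  Maximality is the explosion criterion relative to the state space \<open>M\<close>: on \<open>T < \<infinity>\<close> the path does
  not remain in any compact subset of \<open>M\<close> as \<open>t\<close> approaches \<open>T\<close>. For \<open>M = UNIV\<close> this says that
  \<open>limsup |X t| = \<infinity>\<close>.
\<close>

definition maximal_sde_solution ::
  "'w measure \<Rightarrow> (ennreal \<Rightarrow> 'w measure) \<Rightarrow> (real \<Rightarrow> 'w \<Rightarrow> real ^ 'd) \<Rightarrow> (real ^ 'n) set
    \<Rightarrow> (real ^ 'n \<Rightarrow> real ^ 'n) \<Rightarrow> (real ^ 'n \<Rightarrow> real ^ 'd ^ 'n) \<Rightarrow> real ^ 'n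
    \<Rightarrow> (real \<Rightarrow> 'w \<Rightarrow> real ^ 'n) \<Rightarrow> ('w \<Rightarrow> ennreal) \<Rightarrow> bool" where
  "maximal_sde_solution P F W M b \<sigma> x0 X T \<longleftrightarrow>
     sde_solution P F W M b \<sigma> x0 X T \<and>
     (AE \<omega> in P. T \<omega> < \<infinity> \<longrightarrow>
        (\<forall>K. compact K \<and> K \<subseteq> M \<longrightarrow>
           (\<forall>s\<ge>0. ennreal s < T \<omega> \<longrightarrow> (\<exists>t\<ge>s. ennreal t < T \<omega> \<and> X t \<omega> \<notin> K))))"

definition closed_loop_drift ::
  "(real ^ 'n \<Rightarrow> real ^ 'n) \<Rightarrow> (real ^ 'n \<Rightarrow> real ^ 'm ^ 'n) \<Rightarrow> (real ^ 'n \<Rightarrow> real ^ 'm)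
    \<Rightarrow> (real ^ 'n \<Rightarrow> real ^ 'm) \<Rightarrow> real ^ 'n \<Rightarrow> real ^ 'n" where
  "closed_loop_drift f g uo \<phi> x = f x + g x *v (uo x + \<phi> x)"

section \<open>Forward invariance in probability\<close>

text \<open>
  Used for open \<open>M\<close> and \<open>\<phi>\<close> continuous on \<open>M\<close>.
  The bound \<open>\<psi>\<close> may depend on \<open>x0\<close> but not on the choice of the maximal solution: since \<open>\<phi>\<close> is
  only continuous, solutions need not be unique.
\<close>

definition FIiP ::
  "'w measure \<Rightarrow> (ennreal \<Rightarrow> 'w measure) \<Rightarrow> (real \<Rightarrow> 'w \<Rightarrow> real ^ 'd)
    \<Rightarrow> (real ^ 'n \<Rightarrow> real ^ 'n) \<Rightarrow> (real ^ 'n \<Rightarrow> real ^ 'm ^ 'n) \<Rightarrow> (real ^ 'n \<Rightarrow> real ^ 'd ^ 'n)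
    \<Rightarrow> (real ^ 'n \<Rightarrow> real ^ 'm) \<Rightarrow> (real ^ 'n \<Rightarrow> real ^ 'm) \<Rightarrow> (real ^ 'n) set \<Rightarrow> bool" where
  "FIiP P F W f g \<sigma> uo \<phi> M \<longleftrightarrow>
     (\<exists>Y :: real ^ 'n \<Rightarrow> real.
        C2_on M Y \<and> (\<forall>x\<in>M. 0 \<le> Y x) \<and> (\<forall>L\<ge>0. compact {x\<in>M. Y x \<le> L}) \<and>
        (\<forall>x0\<in>M. \<exists>\<psi> :: real \<Rightarrow> real \<Rightarrow> real.
           continuous_on ({0..} \<times> {0<..<1}) (\<lambda>(l, \<epsilon>). \<psi> l \<epsilon>) \<and>
           (\<forall>l\<ge>0. \<forall>\<epsilon>\<in>{0<..<1}. 0 \<le> \<psi> l \<epsilon>) \<and>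
           (\<forall>X T. maximal_sde_solution P F W M (closed_loop_drift f g uo \<phi>) \<sigma> x0 X T \<longrightarrow>
              (\<forall>l\<ge>0. \<forall>\<epsilon>\<in>{0<..<1}.
                 measure P {\<omega>\<in>space P. \<forall>t\<in>{0..l}.
                   ennreal t < T \<omega> \<and> X t \<omega> \<in> M \<and> Y (X t \<omega>) \<le> \<psi> l \<epsilon>} \<ge> 1 - \<epsilon>))))"

section \<open>Almost sure zeroing control barrier functions\<close>

text \<open>\<open>AS_ZCBF f g \<sigma> uo S h \<phi> \<gamma>\<close>: \<open>h\<close> is an AS-ZCBF, witnessed by the feedback \<open>\<phi>\<close> and the rate \<open>\<gamma>\<close>.\<close>

definition AS_ZCBF ::
  "(real ^ 'n \<Rightarrow> real ^ 'n) \<Rightarrow> (real ^ 'n \<Rightarrow> real ^ 'm ^ 'n) \<Rightarrow> (real ^ 'n \<Rightarrow> real ^ 'd ^ 'n)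
    \<Rightarrow> (real ^ 'n \<Rightarrow> real ^ 'm) \<Rightarrow> (real ^ 'n) set \<Rightarrow> (real ^ 'n \<Rightarrow> real)
    \<Rightarrow> (real ^ 'n \<Rightarrow> real ^ 'm) \<Rightarrow> real \<Rightarrow> bool" where
  "AS_ZCBF f g \<sigma> uo S h \<phi> \<gamma> \<longleftrightarrow>
     continuous_on S \<phi> \<and> 0 < \<gamma> \<and>
     (\<forall>x\<in>S. gen f g \<sigma> (\<phi> x) uo h x \<ge>
        - \<gamma> * h x + gen_diff \<sigma> h x + (h x)\<^sup>2 * gen_diff \<sigma> (\<lambda>z. 1 / h z) x)"

end

theory Submission
  imports Defs
begin

text \<open>
  Let \<open>V = 1 / h\<close>; the barrier condition says \<open>L V \<le> \<gamma> V\<close>. For a level \<open>c\<close> compose \<open>V\<close> with the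
  concave function \<open>v \<mapsto> c\<^sup>3 - (c - v)\<^sub>+\<^sup>3\<close>. The result \<open>G\<close>, extended by \<open>c\<^sup>3\<close> outside of \<open>S\<close>, is \<open>C\<^sup>2\<close> on
  the whole space, its derivatives have compact support, and still \<open>L G \<le> \<gamma> G\<close>. Instead of an Ito
  formula for the solution \<open>X\<close> we use Euler sums on the grid \<open>i l / n\<close> with the coefficients taken along
  \<open>X\<close> and frozen once \<open>V (X) > c\<close>: a second order Taylor expansion with Gaussian increments shows that
  \<open>E G\<close> grows per step of length \<open>\<Delta>\<close> at most by the factor \<open>1 + \<gamma> \<Delta>\<close>, up to \<open>o(\<Delta>)\<close>, and a maximal
  inequality of Kolmogorov type shows that the Euler sums converge to \<open>X\<close> in probability, uniformly
  over the grid. In the limit, the probability that \<open>V (X)\<close> exceeds \<open>c\<close> before time \<open>l\<close> is at most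
  \<open>e\<^bsup>\<gamma>l\<^esup> G(x0) / c\<^sup>3 \<le> 3 e\<^bsup>\<gamma>l\<^esup> V(x0) / c\<close>, which is \<open>\<epsilon>\<close> for \<open>c = 3 e\<^bsup>\<gamma>l\<^esup> V(x0) / \<epsilon>\<close>. While \<open>V (X) \<le> c\<close> the
  path stays in a compact subset of \<open>S\<close>, so by maximality the solution cannot end before \<open>l\<close>.
\<close>

section \<open>Moments of Wiener increments\<close>

text \<open>The feedback is merely continuous, so no Lipschitz estimate would control a genuine
  Euler recursion by a Gronwall argument. With coefficients sampled along \<open>X\<close>, the
  distance to \<open>X\<close> is just a Riemann-sum error in the drift plus the error of
  approximating one fixed Ito integrand by steps. \<open>ito_integral\<close> gives control in
  probability at single times only; the maximal inequality lifts it to all grid points at once, for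
  integrands that may be unbounded. Gaussian increments can throw an Euler sum out of
  \<open>S\<close> and out of every compact set; hence a test function on the whole space with
  bounded and uniformly continuous derivatives. The third power is the smallest integer power for
  which the cut-off at \<open>c\<close> is \<open>C\<^sup>2\<close>. The inequality
  \<open>L V \<le> \<gamma> V\<close> arises because the term \<open>L\<^sup>I h\<close> cancels in
  the barrier condition, and division by \<open>h\<^sup>2\<close> turns the drift derivative of
  \<open>h\<close> into minus that of \<open>1 / h\<close>. The constant 3 comes from concavity: the
  truncation lies below its tangent at 0, whose slope is \<open>3 c\<^sup>2\<close>.\<close>

lemma euclidean_sum_vec_nth:
  fixes f :: "real ^ 'd \<Rightarrow> real"
  shows "(\<Sum>b\<in>Basis. f b *\<^sub>R b) $ i = f (axis i 1)"
proof -
  have "(\<Sum>b\<in>Basis. f b *\<^sub>R b) $ i = (\<Sum>b\<in>Basis. f b *\<^sub>R b) \<bullet> axis i 1"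
    by (simp add: inner_axis)
  also have "\<dots> = f (axis i 1)"
    by (rule inner_sum_left_Basis) simp
  finally show ?thesis .
qed

lemma prod_axis_Basis:
  "(\<Prod>i\<in>UNIV. g (axis i 1 :: real ^ 'd)) = (\<Prod>b\<in>Basis. g b)"
proof -
  have "(Basis :: (real ^ 'd) set) = range (\<lambda>i. axis i 1)"
    by (auto simp: Basis_vec_def)
  moreover have "inj (\<lambda>i. axis i 1 :: real ^ 'd)"
    by (simp add: inj_on_def axis_eq_axis)
  ultimately show ?thesis
    using prod.reindex[of "\<lambda>i. axis i 1 :: real ^ 'd" UNIV g] by (simp add: comp_def)
qed

lemma prod_power_delta:
  fixes x :: "'i::finite \<Rightarrow> real"
  shows "(\<Prod>i\<in>UNIV. x i ^ (if i = j then e else 0)) = x j ^ e"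
proof -
  have "(\<Prod>i\<in>UNIV. x i ^ (if i = j then e else 0)) = (\<Prod>i\<in>UNIV. if i = j then x j ^ e else 1)"
    by (intro prod.cong) auto
  then show ?thesis by simp
qed

text \<open>\<open>lborel\<close> on \<open>real ^ 'd\<close> is the image of a product measure
  indexed by \<open>Basis\<close>, whereas the density of a Wiener increment is a product over
  component indices. Matching the two index sets through \<open>axis i 1\<close> reduces the claim
  to Fubini for products.\<close>

lemma
  fixes g :: "'d::finite \<Rightarrow> real \<Rightarrow> real"
  assumes g: "\<And>i. integrable lborel (g i)"
  shows integrable_prod_vec: "integrable lborel (\<lambda>x :: real ^ 'd. \<Prod>i\<in>UNIV. g i (x $ i))"
    and integral_prod_vec:
      "integral\<^sup>L lborel (\<lambda>x :: real ^ 'd. \<Prod>i\<in>UNIV. g i (x $ i)) = (\<Prod>i\<in>UNIV. integral\<^sup>L lborel (g i))"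
proof -
  interpret product_sigma_finite "\<lambda>_ :: real ^ 'd. lborel :: real measure" by standard
  \<comment> \<open>\<open>THE\<close> inverts the map from indices to basis vectors, so that the
    factors become indexed by \<open>Basis\<close>.\<close>
  define h where "h b = g (THE i. b = axis i 1)" for b :: "real ^ 'd"
  have h: "h (axis i 1) = g i" for i
    unfolding h_def by (simp add: axis_eq_axis)
  have [measurable]: "g i \<in> borel_measurable borel" for i
    using borel_measurable_integrable[OF g[of i]] by simp
  have h_int: "integrable lborel (h b)" if "b \<in> Basis" for b
    using that g h by (auto simp: Basis_vec_def)
  have eq: "(\<Prod>i\<in>UNIV. g i ((\<Sum>b\<in>Basis. f b *\<^sub>R b) $ i)) = (\<Prod>b\<in>Basis. h b (f b))"
    for f :: "real ^ 'd \<Rightarrow> real"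
    using prod_axis_Basis[of "\<lambda>b. h b (f b)"] by (simp only: euclidean_sum_vec_nth h)
  have meas: "(\<lambda>f. \<Sum>b\<in>Basis. f b *\<^sub>R b) \<in> (\<Pi>\<^sub>M b\<in>Basis. lborel) \<rightarrow>\<^sub>M (borel :: (real ^ 'd) measure)"
    by measurable
  note L = lborel_eq[where 'a = "real ^ 'd"]
  have gm: "(\<lambda>x :: real ^ 'd. \<Prod>i\<in>UNIV. g i (x $ i)) \<in> borel_measurable borel"
    by measurable
  show "integrable lborel (\<lambda>x :: real ^ 'd. \<Prod>i\<in>UNIV. g i (x $ i))"
    by (subst L, unfold integrable_distr_eq[OF meas gm] eq, intro product_integrable_prod h_int) auto
  have "integral\<^sup>L lborel (\<lambda>x :: real ^ 'd. \<Prod>i\<in>UNIV. g i (x $ i)) = (\<Prod>b\<in>(Basis :: (real ^ 'd) set). integral\<^sup>L lborel (h b))"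
    by (subst L, unfold integral_distr[OF meas gm] eq, intro product_integral_prod h_int) auto
  also have "\<dots> = (\<Prod>i\<in>UNIV. integral\<^sup>L lborel (g i))"
    by (simp add: prod_axis_Basis[symmetric] h)
  finally show "integral\<^sup>L lborel (\<lambda>x :: real ^ 'd. \<Prod>i\<in>UNIV. g i (x $ i)) = (\<Prod>i\<in>UNIV. integral\<^sup>L lborel (g i))" .
qed

definition normal_moment :: "real \<Rightarrow> nat \<Rightarrow> real" where
  "normal_moment s k = (LINT x|lborel. normal_density 0 s x * x ^ k)"

lemma integrable_normal_moment: "0 < s \<Longrightarrow> integrable lborel (\<lambda>x. normal_density 0 s x * x ^ k)"
proof (cases "even k")
  case True
  assume "0 < s"
  then show ?thesis using True integrable_normal_moment[of s 0 k] by auto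
next
  case False
  assume "0 < s"
  then show ?thesis using integrable_normal_moment[of s 0 k] by auto
qed

text \<open>Orders 0 to 2 determine mean and covariance of a Wiener increment; order 4 controls the
  Taylor remainder in \<open>one_step\<close>.\<close>

lemma normal_moment_values:
  assumes s: "0 < s"
  shows "normal_moment s 0 = 1" "normal_moment s 1 = 0" "normal_moment s 2 = s\<^sup>2" "normal_moment s 4 = 3 * s ^ 4"
proof -
  show "normal_moment s 0 = 1"
    using integral_normal_moment_even[OF s, of 0 0] by (simp add: normal_moment_def)
  show "normal_moment s 1 = 0"
    using integral_normal_moment_odd[OF s, of 0 0] by (simp add: normal_moment_def)
  have "normal_moment s 2 = fact 2 / (2 / s\<^sup>2)"
    using integral_normal_moment_even[OF s, of 0 1] by (simp add: normal_moment_def numeral_2_eq_2)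
  then show "normal_moment s 2 = s\<^sup>2"
    by (simp add: fact_numeral)
  have "normal_moment s 4 = fact 4 / ((2 / s\<^sup>2) ^ 2 * fact 2)"
    using integral_normal_moment_even[OF s, of 0 2] by (simp add: normal_moment_def)
  then show "normal_moment s 4 = 3 * s ^ 4"
    by (simp add: fact_numeral power_divide)
qed

locale wiener_space = filtered_prob_space P F
  for P :: "'w measure" and F :: "ennreal \<Rightarrow> 'w measure" +
  fixes W :: "real \<Rightarrow> 'w \<Rightarrow> real ^ 'd"
  assumes wiener: "wiener_process P F W"
begin

lemma F_measurable: "X \<in> F t \<rightarrow>\<^sub>M N \<Longrightarrow> X \<in> P \<rightarrow>\<^sub>M N"
  by (rule measurable_from_subalg[OF subalgebra_F])

lemma F_mono: "X \<in> F s \<rightarrow>\<^sub>M N \<Longrightarrow> s \<le> t \<Longrightarrow> X \<in> F t \<rightarrow>\<^sub>M N"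
  by (rule measurable_from_subalg[of _ "F s"]) (simp add: subalgebra_def space_F sets_F_mono)

lemma W_measurable_F: "0 \<le> s \<Longrightarrow> s \<le> t \<Longrightarrow> W s \<in> borel_measurable (F (ennreal t))"
  using wiener F_mono[of "W s" "ennreal s" borel "ennreal t"]
  by (auto simp: wiener_process_def ennreal_leI)

lemma W_measurable: "0 \<le> s \<Longrightarrow> W s \<in> borel_measurable P"
  by (rule F_measurable[OF W_measurable_F[of s s]]) auto

context
  fixes s t :: real
  assumes st: "0 \<le> s" "s < t"
begin

lemma increment_distributed:
  "distributed P lborel (\<lambda>\<omega>. W t \<omega> - W s \<omega>)
     (\<lambda>z. ennreal (\<Prod>i\<in>UNIV. normal_density 0 (sqrt (t - s)) (z $ i)))"
  using wiener st by (auto simp: wiener_process_def)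

text \<open>\<open>wiener_process\<close> states independence of \<open>F s\<close> from the
  preimages of Borel sets under the increment. Preimages under \<open>A\<close> lie in the first
  system, those under \<open>g\<close> of the increment in the second, and independence passes to
  smaller systems. This takes the place of conditioning on the past: \<open>A\<close> may be
  anything known at time \<open>s\<close>.\<close>

lemma increment_indep_var:
  assumes A: "A \<in> F (ennreal s) \<rightarrow>\<^sub>M M" and g: "g \<in> borel \<rightarrow>\<^sub>M N"
  shows "indep_var M A N (\<lambda>\<omega>. g (W t \<omega> - W s \<omega>))"
proof -
  let ?w = "\<lambda>\<omega>. W t \<omega> - W s \<omega>"
  have w: "?w \<in> borel_measurable P"
    using W_measurable[of s] W_measurable[of t] st by simp
  have ind: "indep_set (sets (F (ennreal s))) {?w -` A \<inter> space P | A. A \<in> sets borel}"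
    using wiener st by (auto simp: wiener_process_def)
  have sub1: "sigma_sets (space P) {A -` B \<inter> space P | B. B \<in> sets M} \<subseteq> sets (F (ennreal s))"
    using measurable_sets[OF A] space_F sets.sigma_sets_subset[of "{A -` B \<inter> space P | B. B \<in> sets M}" "F (ennreal s)"]
    by auto
  have "sigma_sets (space P) {(\<lambda>\<omega>. g (?w \<omega>)) -` B \<inter> space P | B. B \<in> sets N}
      \<subseteq> sets (vimage_algebra (space P) ?w borel)"
  proof -
    have "(\<lambda>\<omega>. g (?w \<omega>)) \<in> vimage_algebra (space P) ?w borel \<rightarrow>\<^sub>M N"
      by (rule measurable_compose[OF measurable_vimage_algebra1 g]) simp
    from measurable_sets[OF this] show ?thesis
      using sets.sigma_sets_subset[of "{(\<lambda>\<omega>. g (?w \<omega>)) -` B \<inter> space P | B. B \<in> sets N}" "vimage_algebra (space P) ?w borel"]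
      by auto
  qed
  also have "sets (vimage_algebra (space P) ?w borel) = {?w -` A \<inter> space P | A. A \<in> sets borel}"
    by (rule sets_vimage_algebra2) simp
  finally have sub2: "sigma_sets (space P) {(\<lambda>\<omega>. g (?w \<omega>)) -` B \<inter> space P | B. B \<in> sets N}
      \<subseteq> {?w -` A \<inter> space P | A. A \<in> sets borel}" .
  have "indep_set (sigma_sets (space P) {A -` B \<inter> space P | B. B \<in> sets M})
     (sigma_sets (space P) {(\<lambda>\<omega>. g (?w \<omega>)) -` B \<inter> space P | B. B \<in> sets N})"
    unfolding indep_set_def
  proof (rule indep_sets_mono_sets[OF ind[unfolded indep_set_def]])
    fix b :: bool
    show "(case b of True \<Rightarrow> sigma_sets (space P) {A -` B \<inter> space P |B. B \<in> sets M}
          | False \<Rightarrow> sigma_sets (space P) {(\<lambda>\<omega>. g (?w \<omega>)) -` B \<inter> space P |B. B \<in> sets N})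
        \<subseteq> (case b of True \<Rightarrow> sets (F (ennreal s)) | False \<Rightarrow> {?w -` A \<inter> space P | A. A \<in> sets borel})"
      using sub1 sub2 by (cases b) (simp_all only: bool.case)
  qed
  then show ?thesis
    unfolding indep_var_eq by (intro conjI F_measurable[OF A] measurable_compose[OF w g])
qed

lemma
  shows integrable_increment_monomial: "integrable P (\<lambda>\<omega>. \<Prod>i\<in>UNIV. ((W t \<omega> - W s \<omega>) $ i) ^ e i)"
    and expectation_increment_monomial:
      "expectation (\<lambda>\<omega>. \<Prod>i\<in>UNIV. ((W t \<omega> - W s \<omega>) $ i) ^ e i) = (\<Prod>i\<in>UNIV. normal_moment (sqrt (t - s)) (e i))"
proof -
  let ?s = "sqrt (t - s)"
  have s: "0 < ?s" using st by simp
  have m: "(\<lambda>x :: real ^ 'd. \<Prod>i\<in>UNIV. (x $ i) ^ e i) \<in> borel_measurable lborel"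
    by measurable
  have nn: "0 \<le> (\<Prod>i\<in>UNIV. normal_density 0 ?s (x $ i))" for x :: "real ^ 'd"
    by (intro prod_nonneg) auto
  show "integrable P (\<lambda>\<omega>. \<Prod>i\<in>UNIV. ((W t \<omega> - W s \<omega>) $ i) ^ e i)"
    using distributed_integrable[OF increment_distributed m nn]
      integrable_prod_vec[of "\<lambda>i x. normal_density 0 ?s x * x ^ e i", OF integrable_normal_moment[OF s]]
    by (simp add: prod.distrib)
  show "expectation (\<lambda>\<omega>. \<Prod>i\<in>UNIV. ((W t \<omega> - W s \<omega>) $ i) ^ e i) = (\<Prod>i\<in>UNIV. normal_moment (sqrt (t - s)) (e i))"
    using distributed_integral[OF increment_distributed m nn]
      integral_prod_vec[of "\<lambda>i x. normal_density 0 ?s x * x ^ e i", OF integrable_normal_moment[OF s]]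
    by (simp add: prod.distrib normal_moment_def)
qed

lemma
  fixes A :: "'w \<Rightarrow> real"
  assumes A: "A \<in> borel_measurable (F (ennreal s))" and int: "integrable P A"
  shows integrable_mult_increment_monomial:
      "integrable P (\<lambda>\<omega>. A \<omega> * (\<Prod>i\<in>UNIV. ((W t \<omega> - W s \<omega>) $ i) ^ e i))"
    and expectation_mult_increment_monomial:
      "expectation (\<lambda>\<omega>. A \<omega> * (\<Prod>i\<in>UNIV. ((W t \<omega> - W s \<omega>) $ i) ^ e i)) =
         expectation A * (\<Prod>i\<in>UNIV. normal_moment (sqrt (t - s)) (e i))"
proof -
  have ind: "indep_var borel A borel (\<lambda>\<omega>. \<Prod>i\<in>UNIV. ((W t \<omega> - W s \<omega>) $ i) ^ e i)"
    by (rule increment_indep_var[OF A, of "\<lambda>x. \<Prod>i\<in>UNIV. (x $ i) ^ e i"]) measurable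
  show "integrable P (\<lambda>\<omega>. A \<omega> * (\<Prod>i\<in>UNIV. ((W t \<omega> - W s \<omega>) $ i) ^ e i))"
    by (rule indep_var_integrable[OF ind int integrable_increment_monomial])
  show "expectation (\<lambda>\<omega>. A \<omega> * (\<Prod>i\<in>UNIV. ((W t \<omega> - W s \<omega>) $ i) ^ e i)) =
         expectation A * (\<Prod>i\<in>UNIV. normal_moment (sqrt (t - s)) (e i))"
    unfolding indep_var_lebesgue_integral[OF ind int integrable_increment_monomial]
      expectation_increment_monomial ..
qed

lemma
  fixes A :: "'w \<Rightarrow> real"
  assumes A: "A \<in> borel_measurable (F (ennreal s))" and int: "integrable P A"
  shows integrable_mult_increment: "integrable P (\<lambda>\<omega>. A \<omega> * (W t \<omega> - W s \<omega>) $ j)"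
    and expectation_mult_increment: "expectation (\<lambda>\<omega>. A \<omega> * (W t \<omega> - W s \<omega>) $ j) = 0"
    and integrable_mult_increment2: "integrable P (\<lambda>\<omega>. A \<omega> * ((W t \<omega> - W s \<omega>) $ j * (W t \<omega> - W s \<omega>) $ k))"
    and expectation_mult_increment2:
      "expectation (\<lambda>\<omega>. A \<omega> * ((W t \<omega> - W s \<omega>) $ j * (W t \<omega> - W s \<omega>) $ k)) =
        (if j = k then (t - s) * expectation A else 0)"
proof -
  have s: "0 < sqrt (t - s)" using st by simp
  have 1: "(\<Prod>i\<in>UNIV. (x $ i) ^ (if i = j then 1 else 0)) = x $ j" for x :: "real ^ 'd" and j
    by (simp add: prod_power_delta)
  have sq: "(\<Prod>i\<in>UNIV. (x $ i) ^ (if i = j then 2 else 0)) = x $ j * x $ j" for x :: "real ^ 'd" and j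
    by (simp add: prod_power_delta power2_eq_square)
  \<comment> \<open>Adding the two exponent functions covers \<open>j = k\<close> and
    \<open>j \<noteq> k\<close> alike, so integrability follows without a case distinction.\<close>
  have 2: "(\<Prod>i\<in>UNIV. (x $ i) ^ ((if i = j then 1 else 0) + (if i = k then 1 else 0))) = x $ j * x $ k"
    for x :: "real ^ 'd"
    by (simp only: power_add prod.distrib 1)
  show "integrable P (\<lambda>\<omega>. A \<omega> * (W t \<omega> - W s \<omega>) $ j)"
    using integrable_mult_increment_monomial[OF assms, of "\<lambda>i. if i = j then 1 else 0"] unfolding 1 .
  have "(\<Prod>i\<in>UNIV. normal_moment (sqrt (t - s)) (if i = j then 1 else 0)) = 0"
    using normal_moment_values[OF s] by (auto intro!: prod_zero)
  then show "expectation (\<lambda>\<omega>. A \<omega> * (W t \<omega> - W s \<omega>) $ j) = 0"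
    using expectation_mult_increment_monomial[OF assms, of "\<lambda>i. if i = j then 1 else 0"] unfolding 1 by (simp only: mult_zero_right)
  show "integrable P (\<lambda>\<omega>. A \<omega> * ((W t \<omega> - W s \<omega>) $ j * (W t \<omega> - W s \<omega>) $ k))"
    using integrable_mult_increment_monomial[OF assms, of "\<lambda>i. (if i = j then 1 else 0) + (if i = k then 1 else 0)"]
    unfolding 2 .
  show "expectation (\<lambda>\<omega>. A \<omega> * ((W t \<omega> - W s \<omega>) $ j * (W t \<omega> - W s \<omega>) $ k)) =
        (if j = k then (t - s) * expectation A else 0)"
  proof (cases "j = k")
    case True
    have "(\<Prod>i\<in>UNIV. normal_moment (sqrt (t - s)) (if i = j then 2 else 0)) = 
      (\<Prod>i\<in>UNIV. if i = j then t - s else 1)"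
    proof (intro prod.cong refl)
      fix i
      show "normal_moment (sqrt (t - s)) (if i = j then 2 else 0) = (if i = j then t - s else 1)"
        using normal_moment_values(1,3)[OF s] st by (cases "i = j") simp_all
    qed
    also have "\<dots> = t - s" by simp
    finally have moment: "(\<Prod>i\<in>UNIV. normal_moment (sqrt (t - s)) (if i = j then 2 else 0)) = t - s" .
    have "expectation (\<lambda>\<omega>. A \<omega> * ((W t \<omega> - W s \<omega>) $ j * (W t \<omega> - W s \<omega>) $ j)) = (t - s) * expectation A"
      using expectation_mult_increment_monomial[OF assms, of "\<lambda>i. if i = j then 2 else 0"]
      unfolding sq moment by (rule trans[OF _ mult.commute])
    then show ?thesis
      unfolding True[symmetric] if_P[OF refl] .
  next
    case False
    have "(\<Prod>i\<in>UNIV. normal_moment (sqrt (t - s)) ((if i = j then 1 else 0) + (if i = k then 1 else 0))) = 0"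
      using normal_moment_values(2)[OF s] False by (intro prod_zero bexI[of _ j]) simp_all
    then show ?thesis
      using False expectation_mult_increment_monomial[OF assms, of "\<lambda>i. (if i = j then 1 else 0) + (if i = k then 1 else 0)"] unfolding 2
      by (simp only: mult_zero_right if_False)
  qed
qed

lemma
  shows integrable_increment_norm2: "integrable P (\<lambda>\<omega>. (norm (W t \<omega> - W s \<omega>))\<^sup>2)"
    and expectation_increment_norm2: "expectation (\<lambda>\<omega>. (norm (W t \<omega> - W s \<omega>))\<^sup>2) = CARD('d) * (t - s)"
proof -
  have one: "(\<lambda>_. 1 :: real) \<in> borel_measurable (F (ennreal s))" "integrable P (\<lambda>_. 1 :: real)" by auto
  have eq: "(norm x)\<^sup>2 = (\<Sum>j\<in>UNIV. 1 * (x $ j * x $ j))" for x :: "real ^ 'd"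
    by (simp add: power2_norm_eq_inner inner_vec_def)
  show "integrable P (\<lambda>\<omega>. (norm (W t \<omega> - W s \<omega>))\<^sup>2)"
    unfolding eq by (intro Bochner_Integration.integrable_sum integrable_mult_increment2 one)
  have E1: "expectation (\<lambda>\<omega>. 1 * ((W t \<omega> - W s \<omega>) $ j * (W t \<omega> - W s \<omega>) $ j)) = t - s" for j
    unfolding expectation_mult_increment2[OF one] by (simp add: prob_space)
  show "expectation (\<lambda>\<omega>. (norm (W t \<omega> - W s \<omega>))\<^sup>2) = CARD('d) * (t - s)"
    unfolding eq
    by (subst Bochner_Integration.integral_sum[OF integrable_mult_increment2[OF one]])
      (simp only: E1 sum_constant)
qed

text \<open>By Cauchy-Schwarz the fourth power of the norm is at most the dimension times the sum of
  the fourth powers of the components, and each of these has mean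
  \<open>3 * (t - s)\<^sup>2\<close>; this explains the squared dimension. What matters later is
  that the bound is quadratic in \<open>t - s\<close>, hence negligible against the step
  length.\<close>

lemma
  shows integrable_increment_norm4: "integrable P (\<lambda>\<omega>. (norm (W t \<omega> - W s \<omega>)) ^ 4)"
    and expectation_increment_norm4_le:
      "expectation (\<lambda>\<omega>. (norm (W t \<omega> - W s \<omega>)) ^ 4) \<le> 3 * (CARD('d))\<^sup>2 * (t - s)\<^sup>2"
proof -
  have s: "0 < sqrt (t - s)" using st by simp
  let ?S = "\<lambda>x :: real ^ 'd. real CARD('d) * (\<Sum>j\<in>UNIV. (x $ j) ^ 4)"
  have prod4: "(\<Prod>i\<in>UNIV. (x $ i) ^ (if i = j then 4 else 0)) = (x $ j) ^ 4" for x :: "real ^ 'd" and j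
    by (simp add: prod_power_delta)
  have int: "integrable P (\<lambda>\<omega>. ((W t \<omega> - W s \<omega>) $ j) ^ 4)" for j
    using integrable_increment_monomial[of "\<lambda>i. if i = j then 4 else 0"] unfolding prod4 .
  have val: "expectation (\<lambda>\<omega>. ((W t \<omega> - W s \<omega>) $ j) ^ 4) = 3 * (t - s)\<^sup>2" for j
  proof -
    have "(\<Prod>i\<in>UNIV. normal_moment (sqrt (t - s)) (if i = j then 4 else 0)) = 
      (\<Prod>i\<in>UNIV. if i = j then 3 * (t - s)\<^sup>2 else 1)"
    proof (intro prod.cong refl)
      fix i
      have "sqrt (t - s) ^ 4 = (t - s)\<^sup>2"
        using st by (simp add: power4_eq_xxxx power2_eq_square)
      then show "normal_moment (sqrt (t - s)) (if i = j then 4 else 0) = (if i = j then 3 * (t - s)\<^sup>2 else 1)"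
        using normal_moment_values(1,4)[OF s] by (cases "i = j") simp_all
    qed
    also have "\<dots> = 3 * (t - s)\<^sup>2" by simp
    finally show ?thesis
      by (rule trans[OF expectation_increment_monomial[of "\<lambda>i. if i = j then 4 else 0", unfolded prod4]])
  qed
  have le: "norm x ^ 4 \<le> ?S x" for x :: "real ^ 'd"
  proof -
    have "norm x ^ 4 = (\<Sum>j\<in>UNIV. (x $ j)\<^sup>2 * 1)\<^sup>2"
      by (simp add: norm_eq_sqrt_inner inner_vec_def power2_eq_square power4_eq_xxxx sum_nonneg)
    also have "\<dots> \<le> (\<Sum>j\<in>UNIV. ((x $ j)\<^sup>2)\<^sup>2) * (\<Sum>j\<in>(UNIV::'d set). 1\<^sup>2)"
      by (rule Cauchy_Schwarz_ineq_sum)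
    also have "\<dots> = ?S x" by (simp add: mult.commute)
    finally show ?thesis .
  qed
  have S: "integrable P (\<lambda>\<omega>. ?S (W t \<omega> - W s \<omega>))"
    by (intro Bochner_Integration.integrable_sum integrable_mult_right int)
  have [measurable]: "W s \<in> borel_measurable P" "W t \<in> borel_measurable P"
    using W_measurable st by auto
  show i4: "integrable P (\<lambda>\<omega>. (norm (W t \<omega> - W s \<omega>)) ^ 4)"
    by (rule Bochner_Integration.integrable_bound[OF S]) (use le in \<open>auto intro!: AE_I2 order_trans[OF le]\<close>)
  have "expectation (\<lambda>\<omega>. (norm (W t \<omega> - W s \<omega>)) ^ 4) \<le> expectation (\<lambda>\<omega>. ?S (W t \<omega> - W s \<omega>))"
    by (intro integral_mono i4 S le)
  also have "\<dots> = CARD('d) * (\<Sum>j\<in>UNIV. expectation (\<lambda>\<omega>. ((W t \<omega> - W s \<omega>) $ j) ^ 4))"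
    by (simp only: integral_mult_right_zero Bochner_Integration.integral_sum[OF int])
  also have "\<dots> = 3 * (CARD('d))\<^sup>2 * (t - s)\<^sup>2"
    unfolding val by (simp add: power2_eq_square)
  finally show "expectation (\<lambda>\<omega>. (norm (W t \<omega> - W s \<omega>)) ^ 4) \<le> 3 * (CARD('d))\<^sup>2 * (t - s)\<^sup>2" .
qed

end

end

section \<open>Maximal inequality for step integrals\<close>

lemma norm_matrix_vector_le: "norm (A *v x) \<le> norm A * norm x" for A :: "real ^ 'm ^ 'n"
proof (rule power2_le_imp_le)
  have "(norm (A *v x))\<^sup>2 = (\<Sum>i\<in>UNIV. ((A $ i) \<bullet> x)\<^sup>2)"
    by (simp add: norm_vec_def L2_set_def sum_nonneg matrix_vector_mul_component)
  also have "\<dots> \<le> (\<Sum>i\<in>UNIV. (norm (A $ i))\<^sup>2 * (norm x)\<^sup>2)"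
    by (intro sum_mono) (metis Cauchy_Schwarz_ineq2 abs_le_square_iff abs_mult abs_norm_cancel power_mult_distrib)
  also have "\<dots> = (norm A * norm x)\<^sup>2"
    by (simp add: norm_vec_def[of A] L2_set_def sum_nonneg power_mult_distrib sum_distrib_right)
  finally show "(norm (A *v x))\<^sup>2 \<le> (norm A * norm x)\<^sup>2" .
qed simp

lemma norm_matrix_eq: "(norm A)\<^sup>2 = trace (transpose A ** A)" for A :: "real ^ 'm ^ 'n"
proof -
  have "(norm A)\<^sup>2 = (\<Sum>i\<in>UNIV. \<Sum>j\<in>UNIV. (A $ i $ j)\<^sup>2)"
    by (simp add: norm_vec_def L2_set_def sum_nonneg)
  also have "\<dots> = trace (transpose A ** A)"
    by (subst sum.swap) (simp add: trace_def matrix_matrix_mult_def transpose_def power2_eq_square)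
  finally show ?thesis .
qed

lemma matrix_component_le_norm: "\<bar>A $ i $ j\<bar> \<le> norm A" for A :: "real ^ 'm ^ 'n"
  using Finite_Cartesian_Product.norm_nth_le[of "A $ i" j] Finite_Cartesian_Product.norm_nth_le[of A i] by simp

lemma borel_measurable_vec_nth [measurable (raw)]:
  fixes f :: "'a \<Rightarrow> 'b :: real_normed_vector ^ 'n"
  assumes "f \<in> borel_measurable M"
  shows "(\<lambda>\<omega>. f \<omega> $ i) \<in> borel_measurable M"
proof -
  have "continuous_on UNIV (\<lambda>x :: 'b ^ 'n. x $ i)"
    by (intro continuous_intros)
  from measurable_compose[OF assms borel_measurable_continuous_onI[OF this]] show ?thesis .
qed

lemma borel_measurable_matrix_vector_mult [measurable (raw)]:
  fixes A :: "'a \<Rightarrow> real ^ 'm ^ 'n"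
  assumes "A \<in> borel_measurable M" "x \<in> borel_measurable M"
  shows "(\<lambda>\<omega>. A \<omega> *v x \<omega>) \<in> borel_measurable M"
  by (rule borel_measurable_continuous_Pair[OF assms])
    (auto simp: matrix_vector_mult_def intro!: continuous_intros)

lemma borel_measurable_transpose [measurable (raw)]:
  fixes A :: "'a \<Rightarrow> real ^ 'm ^ 'n"
  assumes "A \<in> borel_measurable M"
  shows "(\<lambda>\<omega>. transpose (A \<omega>)) \<in> borel_measurable M"
proof -
  have "continuous_on UNIV (transpose :: real ^ 'm ^ 'n \<Rightarrow> _)"
    unfolding transpose_def by (intro continuous_intros)
  from borel_measurable_continuous_onI[OF this] show ?thesis
    using assms by measurable
qed

lemma borel_measurable_matrix_mult [measurable (raw)]:
  fixes A :: "'a \<Rightarrow> real ^ 'm ^ 'n" and B :: "'a \<Rightarrow> real ^ 'k ^ 'm"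
  assumes "A \<in> borel_measurable M" "B \<in> borel_measurable M"
  shows "(\<lambda>\<omega>. A \<omega> ** B \<omega>) \<in> borel_measurable M"
  by (rule borel_measurable_continuous_Pair[OF assms])
    (auto simp: matrix_matrix_mult_def intro!: continuous_intros)

lemma norm_matrix_mult_le: "norm (A ** B) \<le> norm A * norm B"
  for A :: "real ^ 'm ^ 'n" and B :: "real ^ 'k ^ 'm"
proof (rule power2_le_imp_le)
  have "(norm (A ** B))\<^sup>2 = (\<Sum>i\<in>UNIV. \<Sum>k\<in>UNIV. ((A ** B) $ i $ k)\<^sup>2)"
    by (simp add: norm_vec_def L2_set_def sum_nonneg)
  also have "\<dots> \<le> (\<Sum>i\<in>UNIV. \<Sum>k\<in>UNIV. (\<Sum>j\<in>UNIV. (A $ i $ j)\<^sup>2) * (\<Sum>j\<in>UNIV. (B $ j $ k)\<^sup>2))"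
    by (intro sum_mono) (simp add: matrix_matrix_mult_def Cauchy_Schwarz_ineq_sum)
  also have "\<dots> = (\<Sum>i\<in>UNIV. \<Sum>j\<in>UNIV. (A $ i $ j)\<^sup>2) * (\<Sum>k\<in>UNIV. \<Sum>j\<in>UNIV. (B $ j $ k)\<^sup>2)"
    by (simp add: sum_product)
  also have "(\<Sum>k\<in>UNIV. \<Sum>j\<in>UNIV. (B $ j $ k)\<^sup>2) = (\<Sum>j\<in>UNIV. \<Sum>k\<in>UNIV. (B $ j $ k)\<^sup>2)"
    by (rule sum.swap)
  also have "(\<Sum>i\<in>UNIV. \<Sum>j\<in>UNIV. (A $ i $ j)\<^sup>2) * \<dots> = (norm A * norm B)\<^sup>2"
    by (simp add: norm_vec_def L2_set_def sum_nonneg power_mult_distrib)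
  finally show "(norm (A ** B))\<^sup>2 \<le> (norm A * norm B)\<^sup>2" .
qed simp

lemma norm_transpose: "norm (transpose A) = norm A" for A :: "real ^ 'm ^ 'n"
proof -
  have "(norm (transpose A))\<^sup>2 = (norm A)\<^sup>2"
    unfolding norm_vec_def L2_set_def
    by (simp add: sum_nonneg transpose_def) (rule sum.swap)
  then show ?thesis by simp
qed

context wiener_space
begin

lemma integrable_F_bounded:
  fixes A :: "'w \<Rightarrow> 'b :: {second_countable_topology, banach}"
  shows "A \<in> borel_measurable (F r) \<Longrightarrow> (\<And>\<omega>. \<omega> \<in> space P \<Longrightarrow> norm (A \<omega>) \<le> C) \<Longrightarrow> integrable P A"
  by (rule integrable_const_bound[of _ C]) (auto intro: F_measurable)

context
  fixes s t :: real
  assumes st: "0 \<le> s" "s < t"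
begin

lemma
  fixes a :: "'w \<Rightarrow> real ^ 'd"
  assumes a [measurable]: "a \<in> borel_measurable (F (ennreal s))" and C: "\<And>\<omega>. \<omega> \<in> space P \<Longrightarrow> norm (a \<omega>) \<le> C"
  shows integrable_inner_increment: "integrable P (\<lambda>\<omega>. a \<omega> \<bullet> (W t \<omega> - W s \<omega>))"
    and expectation_inner_increment: "expectation (\<lambda>\<omega>. a \<omega> \<bullet> (W t \<omega> - W s \<omega>)) = 0"
proof -
  have aj: "(\<lambda>\<omega>. a \<omega> $ j) \<in> borel_measurable (F (ennreal s))" for j
    by measurable
  have bd: "norm (a \<omega> $ j) \<le> C" if "\<omega> \<in> space P" for \<omega> j
    using C[OF that] Finite_Cartesian_Product.norm_nth_le[of "a \<omega>" j] by linarith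
  note i = integrable_F_bounded[OF aj bd]
  show "integrable P (\<lambda>\<omega>. a \<omega> \<bullet> (W t \<omega> - W s \<omega>))"
    unfolding inner_vec_def inner_real_def
    by (intro Bochner_Integration.integrable_sum integrable_mult_increment[OF st] aj i)
  show "expectation (\<lambda>\<omega>. a \<omega> \<bullet> (W t \<omega> - W s \<omega>)) = 0"
    unfolding inner_vec_def inner_real_def
    by (subst Bochner_Integration.integral_sum[OF integrable_mult_increment[OF st aj i]])
      (simp_all only: expectation_mult_increment[OF st aj i] sum.neutral_const)
qed

text \<open>Products of distinct components of the increment have mean zero, squares have mean
  \<open>t - s\<close>, both independently of \<open>F s\<close>, so only the diagonal of
  \<open>A\<close> survives. This is the source of the second-order term of the generator.\<close>

lemma
  fixes A :: "'w \<Rightarrow> real ^ 'd ^ 'd"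
  assumes A [measurable]: "A \<in> borel_measurable (F (ennreal s))" and C: "\<And>\<omega>. \<omega> \<in> space P \<Longrightarrow> norm (A \<omega>) \<le> C"
  shows integrable_quadratic_increment:
      "integrable P (\<lambda>\<omega>. (W t \<omega> - W s \<omega>) \<bullet> (A \<omega> *v (W t \<omega> - W s \<omega>)))"
    and expectation_quadratic_increment:
      "expectation (\<lambda>\<omega>. (W t \<omega> - W s \<omega>) \<bullet> (A \<omega> *v (W t \<omega> - W s \<omega>))) =
         (t - s) * expectation (\<lambda>\<omega>. trace (A \<omega>))"
proof -
  have Ajk: "(\<lambda>\<omega>. A \<omega> $ j $ k) \<in> borel_measurable (F (ennreal s))" for j k
    by measurable
  have bd: "norm (A \<omega> $ j $ k) \<le> C" if "\<omega> \<in> space P" for \<omega> j k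
    using C[OF that] matrix_component_le_norm[of "A \<omega>" j k] by simp
  note i = integrable_F_bounded[OF Ajk bd]
  have eq: "x \<bullet> (M *v x) = (\<Sum>j\<in>UNIV. \<Sum>k\<in>UNIV. M $ j $ k * (x $ j * x $ k))" for x :: "real ^ 'd" and M
    by (simp add: inner_vec_def matrix_vector_mult_def sum_distrib_left mult_ac)
  show "integrable P (\<lambda>\<omega>. (W t \<omega> - W s \<omega>) \<bullet> (A \<omega> *v (W t \<omega> - W s \<omega>)))"
    unfolding eq
    by (intro Bochner_Integration.integrable_sum integrable_mult_increment2[OF st] Ajk i)
  have "expectation (\<lambda>\<omega>. (W t \<omega> - W s \<omega>) \<bullet> (A \<omega> *v (W t \<omega> - W s \<omega>))) =
    (\<Sum>j\<in>UNIV. \<Sum>k\<in>UNIV. expectation (\<lambda>\<omega>. A \<omega> $ j $ k * ((W t \<omega> - W s \<omega>) $ j * (W t \<omega> - W s \<omega>) $ k)))"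
    unfolding eq
    by (simp only: Bochner_Integration.integral_sum Bochner_Integration.integrable_sum
        integrable_mult_increment2[OF st Ajk i])
  also have "\<dots> = (\<Sum>j\<in>UNIV. \<Sum>k\<in>UNIV. if j = k then (t - s) * expectation (\<lambda>\<omega>. A \<omega> $ j $ k) else 0)"
    by (simp only: expectation_mult_increment2[OF st Ajk i])
  also have "\<dots> = (t - s) * expectation (\<lambda>\<omega>. trace (A \<omega>))"
    unfolding trace_def by (subst Bochner_Integration.integral_sum[OF i]) (simp_all add: sum_distrib_left)
  finally show "expectation (\<lambda>\<omega>. (W t \<omega> - W s \<omega>) \<bullet> (A \<omega> *v (W t \<omega> - W s \<omega>))) =
         (t - s) * expectation (\<lambda>\<omega>. trace (A \<omega>))" .
qed

text \<open>Moving \<open>\<zeta>\<close> to the other factor reduces both statements to the linear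
  and the quadratic case, with coefficient vector \<open>transpose \<zeta> *v V\<close> and
  coefficient matrix \<open>transpose \<zeta> ** \<zeta>\<close>, whose trace is the squared
  Frobenius norm. The last claim is the Ito isometry for one step.\<close>

lemma
  fixes \<zeta> :: "'w \<Rightarrow> real ^ 'd ^ 'n" and V :: "'w \<Rightarrow> real ^ 'n"
  assumes [measurable]: "\<zeta> \<in> borel_measurable (F (ennreal s))" "V \<in> borel_measurable (F (ennreal s))"
    and C: "\<And>\<omega>. \<omega> \<in> space P \<Longrightarrow> norm (\<zeta> \<omega>) \<le> C" "\<And>\<omega>. \<omega> \<in> space P \<Longrightarrow> norm (V \<omega>) \<le> D"
  shows integrable_cross_increment: "integrable P (\<lambda>\<omega>. V \<omega> \<bullet> (\<zeta> \<omega> *v (W t \<omega> - W s \<omega>)))" (is ?A)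
    and expectation_cross_increment: "expectation (\<lambda>\<omega>. V \<omega> \<bullet> (\<zeta> \<omega> *v (W t \<omega> - W s \<omega>))) = 0" (is ?B)
    and integrable_norm2_matrix_increment: "integrable P (\<lambda>\<omega>. (norm (\<zeta> \<omega> *v (W t \<omega> - W s \<omega>)))\<^sup>2)" (is ?C)
    and expectation_norm2_matrix_increment:
      "expectation (\<lambda>\<omega>. (norm (\<zeta> \<omega> *v (W t \<omega> - W s \<omega>)))\<^sup>2) = (t - s) * expectation (\<lambda>\<omega>. (norm (\<zeta> \<omega>))\<^sup>2)" (is ?D)
proof -
  have eq: "V \<omega> \<bullet> (\<zeta> \<omega> *v x) = (transpose (\<zeta> \<omega>) *v V \<omega>) \<bullet> x" for \<omega> x
    by (metis dot_lmul_matrix vector_transpose_matrix transpose_transpose)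
  have bd: "norm (transpose (\<zeta> \<omega>) *v V \<omega>) \<le> C * D" if "\<omega> \<in> space P" for \<omega>
  proof -
    have "norm (transpose (\<zeta> \<omega>) *v V \<omega>) \<le> norm (\<zeta> \<omega>) * norm (V \<omega>)"
      using norm_matrix_vector_le[of "transpose (\<zeta> \<omega>)" "V \<omega>"] by (simp add: norm_transpose)
    also have "\<dots> \<le> C * D"
      using C[OF that] by (intro mult_mono) (auto intro: order_trans[OF norm_ge_zero])
    finally show ?thesis .
  qed
  have m: "(\<lambda>\<omega>. transpose (\<zeta> \<omega>) *v V \<omega>) \<in> borel_measurable (F (ennreal s))" by measurable
  show ?A ?B
    unfolding eq using integrable_inner_increment[OF m bd] expectation_inner_increment[OF m bd] by auto
  have eq2: "(norm (\<zeta> \<omega> *v x))\<^sup>2 = x \<bullet> ((transpose (\<zeta> \<omega>) ** \<zeta> \<omega>) *v x)" for \<omega> x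
    unfolding power2_norm_eq_inner
    by (metis dot_lmul_matrix inner_commute matrix_vector_mul_assoc vector_transpose_matrix)
  have m2: "(\<lambda>\<omega>. transpose (\<zeta> \<omega>) ** \<zeta> \<omega>) \<in> borel_measurable (F (ennreal s))" by measurable
  have bd2: "norm (transpose (\<zeta> \<omega>) ** \<zeta> \<omega>) \<le> C * C" if "\<omega> \<in> space P" for \<omega>
  proof -
    have "norm (transpose (\<zeta> \<omega>) ** \<zeta> \<omega>) \<le> norm (\<zeta> \<omega>) * norm (\<zeta> \<omega>)"
      using norm_matrix_mult_le[of "transpose (\<zeta> \<omega>)" "\<zeta> \<omega>"] by (simp add: norm_transpose)
    also have "\<dots> \<le> C * C"
      using C(1)[OF that] by (intro mult_mono) (auto intro: order_trans[OF norm_ge_zero])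
    finally show ?thesis .
  qed
  show ?C ?D
    unfolding eq2 norm_matrix_eq
    using integrable_quadratic_increment[OF m2 bd2] expectation_quadratic_increment[OF m2 bd2] by auto
qed

end

lemma W_grid_measurable:
  fixes q :: "nat \<Rightarrow> real"
  assumes "0 \<le> q 0" "\<And>i. i < m \<Longrightarrow> q i < q (Suc i)" "i \<le> j" "j \<le> m"
  shows "0 \<le> q i" "q i \<le> q j" "W (q i) \<in> borel_measurable (F (ennreal (q j)))"
proof -
  have mono: "i \<le> j \<Longrightarrow> j \<le> m \<Longrightarrow> q i \<le> q j" for i j
  proof (induction j)
    case (Suc j)
    then show ?case using assms(2)[of j] by (cases "i = Suc j") auto
  qed simp
  show "0 \<le> q i" "q i \<le> q j" using mono[of 0 i] mono[of i j] assms by auto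
  then show "W (q i) \<in> borel_measurable (F (ennreal (q j)))" by (rule W_measurable_F)
qed

text \<open>Kolmogorov's argument: the integrand is switched off once the integral exceeds \<open>\<epsilon>\<close> or its
  quadratic variation would exceed \<open>K\<close>; both are known at the left endpoint of each interval.\<close>

lemma grid_maximal_inequality:
  fixes q :: "nat \<Rightarrow> real" and \<zeta> :: "nat \<Rightarrow> 'w \<Rightarrow> real ^ 'd ^ 'n"
  assumes q: "0 \<le> q 0" "\<And>i. i < M \<Longrightarrow> q i < q (Suc i)"
    and \<zeta>: "\<And>i. i < M \<Longrightarrow> \<zeta> i \<in> borel_measurable (F (ennreal (q i)))"
    and \<epsilon>: "0 < \<epsilon>" and K: "0 \<le> K"
  defines "J \<equiv> \<lambda>m \<omega>. \<Sum>i<m. \<zeta> i \<omega> *v (W (q (Suc i)) \<omega> - W (q i) \<omega>)"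
  shows "prob {\<omega> \<in> space P. \<exists>m\<le>M. \<epsilon> < norm (J m \<omega>)} \<le>
    K / \<epsilon>\<^sup>2 + prob {\<omega> \<in> space P. K < (\<Sum>i<M. (norm (\<zeta> i \<omega>))\<^sup>2 * (q (Suc i) - q i))}"
proof -
  define V where "V m \<omega> = (\<Sum>i<m. (norm (\<zeta> i \<omega>))\<^sup>2 * (q (Suc i) - q i))" for m \<omega>
  define G where "G m \<omega> \<longleftrightarrow> V (Suc m) \<omega> \<le> K \<and> (\<forall>i\<le>m. norm (J i \<omega>) \<le> \<epsilon>)" for m \<omega>
  define \<eta> where "\<eta> m \<omega> = (if G m \<omega> then \<zeta> m \<omega> else 0)" for m \<omega>
  define I where "I m \<omega> = (\<Sum>i<m. \<eta> i \<omega> *v (W (q (Suc i)) \<omega> - W (q i) \<omega>))" for m \<omega>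
  note W_grid = W_grid_measurable[of q, OF q(1)]
  have \<zeta>F: "\<zeta> i \<in> borel_measurable (F (ennreal (q j)))" if "i \<le> j" "j \<le> M" "i < M" for i j
    using \<zeta>[OF that(3)] W_grid(2)[of M i j] q(2) that by (auto intro: F_mono ennreal_leI)
  have V_meas: "V m \<in> borel_measurable (F (ennreal (q j)))" if "m \<le> Suc j" "j \<le> M" "m \<le> M" for m j
    unfolding V_def
  proof (intro borel_measurable_sum)
    fix i assume "i \<in> {..<m}"
    then have [measurable]: "\<zeta> i \<in> borel_measurable (F (ennreal (q j)))"
      using that by (intro \<zeta>F) auto
    show "(\<lambda>\<omega>. (norm (\<zeta> i \<omega>))\<^sup>2 * (q (Suc i) - q i)) \<in> borel_measurable (F (ennreal (q j)))"
      by measurable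
  qed
  have J_meas: "J m \<in> borel_measurable (F (ennreal (q j)))" if "m \<le> j" "j \<le> M" for m j
    unfolding J_def using that
    by (intro borel_measurable_sum borel_measurable_matrix_vector_mult borel_measurable_diff
        \<zeta>F W_grid(3)[of M, OF q(2)]) auto
  have J_ev: "{\<omega> \<in> space (F (ennreal (q j))). norm (J m \<omega>) \<le> \<epsilon>} \<in> sets (F (ennreal (q j)))" if "m \<le> j" "j \<le> M" for m j
  proof -
    note [measurable] = J_meas[OF that]
    show ?thesis by measurable
  qed
  have G_meas: "Measurable.pred (F (ennreal (q m))) (G m)" if "m < M" for m
  proof -
    have [measurable]: "V (Suc m) \<in> borel_measurable (F (ennreal (q m)))"
      using that by (intro V_meas) auto
    have "Measurable.pred (F (ennreal (q m))) (\<lambda>\<omega>. V (Suc m) \<omega> \<le> K)"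
      by measurable
    moreover have "Measurable.pred (F (ennreal (q m))) (\<lambda>\<omega>. \<forall>i\<in>{..m}. norm (J i \<omega>) \<le> \<epsilon>)"
      using that J_ev[of _ m] by (intro pred_intros_finite) (auto simp: Measurable.pred_def)
    ultimately show ?thesis
      unfolding G_def Ball_def atMost_iff by (intro pred_intros_logic)
  qed
  have \<eta>_meas: "\<eta> m \<in> borel_measurable (F (ennreal (q m)))" if "m < M" for m
  proof -
    note [measurable] = G_meas[OF that] \<zeta>[OF that]
    show ?thesis unfolding \<eta>_def by measurable
  qed
  have q_le: "0 \<le> q (Suc i) - q i" if "i < M" for i
    using q(2)[OF that] by simp
  have V_nonneg: "0 \<le> V m \<omega>" if "m \<le> M" for m \<omega>
    unfolding V_def using q_le that by (intro sum_nonneg mult_nonneg_nonneg) auto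
  have V_mono: "V m \<omega> \<le> V n \<omega>" if "m \<le> n" "n \<le> M" for m n \<omega>
    unfolding V_def using that by (intro sum_mono2 mult_nonneg_nonneg q_le) auto
  have G_mono: "G i \<omega>" if "G m \<omega>" "i \<le> m" "m < M" for i m \<omega>
    using that V_mono[of "Suc i" "Suc m" \<omega>] unfolding G_def by auto
  \<comment> \<open>The single term of index \<open>m\<close> is part of \<open>V (Suc m)\<close>,
    which is at most \<open>K\<close> where the integrand is on. So \<open>\<eta> m\<close> is
    bounded although \<open>\<zeta> m\<close> is not assumed to be, and the moment formulas for
    bounded coefficients apply.\<close>
  have \<eta>_bound: "norm (\<eta> m \<omega>) \<le> sqrt (K / (q (Suc m) - q m))" if "m < M" for m \<omega>
  proof (cases "G m \<omega>")
    case True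
    have "(norm (\<zeta> m \<omega>))\<^sup>2 * (q (Suc m) - q m) \<le> K"
      using True V_nonneg[of m \<omega>] that by (simp add: G_def V_def)
    then have "(norm (\<zeta> m \<omega>))\<^sup>2 \<le> K / (q (Suc m) - q m)"
      using q(2)[OF that] by (simp add: field_simps)
    then show ?thesis using True by (auto simp: \<eta>_def intro: real_le_rsqrt)
  qed (use q(2)[OF that] K in \<open>simp add: \<eta>_def\<close>)
  have IJ: "I m \<omega> = J m \<omega>" if "\<forall>i<m. G i \<omega>" for m \<omega>
    unfolding I_def J_def using that by (intro sum.cong) (auto simp: \<eta>_def)
  have I2: "integrable P (\<lambda>\<omega>. (norm (I m \<omega>))\<^sup>2) \<and>
      expectation (\<lambda>\<omega>. (norm (I m \<omega>))\<^sup>2) = expectation (\<lambda>\<omega>. \<Sum>i<m. (norm (\<eta> i \<omega>))\<^sup>2 * (q (Suc i) - q i)) \<and>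
      integrable P (\<lambda>\<omega>. \<Sum>i<m. (norm (\<eta> i \<omega>))\<^sup>2 * (q (Suc i) - q i))" if "m \<le> M" for m
    using that
  proof (induction m)
    case 0
    then show ?case by (simp add: I_def)
  next
    case (Suc m)
    then have m: "m < M" "m \<le> M" by auto
    \<comment> \<open>In the cross term of the squared norm, \<open>I m\<close> may be replaced by
      this: on \<open>G m\<close> the integrand was never switched off before, so
      \<open>I m = J m\<close>, and off \<open>G m\<close> the factor \<open>\<eta> m\<close>
      vanishes. Unlike \<open>I m\<close>, it is visibly bounded, by \<open>\<epsilon>\<close>, so
      the cross term has mean zero.\<close>
    let ?V = "\<lambda>\<omega>. if G m \<omega> then J m \<omega> else 0"
    let ?w = "\<lambda>\<omega>. W (q (Suc m)) \<omega> - W (q m) \<omega>"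
    have Vm: "?V \<in> borel_measurable (F (ennreal (q m)))"
    proof -
      note [measurable] = G_meas[OF m(1)] J_meas[OF order_refl m(2)]
      show ?thesis by measurable
    qed
    have Vb: "norm (?V \<omega>) \<le> \<epsilon>" for \<omega>
      using \<epsilon> by (auto simp: G_def)
    have qm: "0 \<le> q m" "q m < q (Suc m)" using W_grid(1)[of M m m, OF q(2)] q(2) m by auto
    note cross = integrable_cross_increment[OF qm \<eta>_meas[OF m(1)] Vm \<eta>_bound[OF m(1)] Vb]
      expectation_cross_increment[OF qm \<eta>_meas[OF m(1)] Vm \<eta>_bound[OF m(1)] Vb]
    note sq = integrable_norm2_matrix_increment[OF qm \<eta>_meas[OF m(1)] Vm \<eta>_bound[OF m(1)] Vb]
      expectation_norm2_matrix_increment[OF qm \<eta>_meas[OF m(1)] Vm \<eta>_bound[OF m(1)] Vb]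
    have \<eta>2: "integrable P (\<lambda>\<omega>. (norm (\<eta> m \<omega>))\<^sup>2)"
    proof (rule integrable_F_bounded)
      show "(\<lambda>\<omega>. (norm (\<eta> m \<omega>))\<^sup>2) \<in> borel_measurable (F (ennreal (q m)))"
      proof -
        note [measurable] = \<eta>_meas[OF m(1)]
        show ?thesis by measurable
      qed
      show "norm ((norm (\<eta> m \<omega>))\<^sup>2) \<le> (sqrt (K / (q (Suc m) - q m)))\<^sup>2" for \<omega>
        using power_mono[OF \<eta>_bound[OF m(1)], of \<omega> 2] by simp
    qed
    have eq: "(norm (I (Suc m) \<omega>))\<^sup>2 =
        ((norm (I m \<omega>))\<^sup>2 + 2 * (?V \<omega> \<bullet> (\<eta> m \<omega> *v ?w \<omega>))) + (norm (\<eta> m \<omega> *v ?w \<omega>))\<^sup>2" for \<omega>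
    proof (cases "G m \<omega>")
      case True
      then have "I m \<omega> = J m \<omega>" using G_mono m by (intro IJ) auto
      then show ?thesis using True
        by (simp add: I_def[of "Suc m"] I_def[of m, symmetric] power2_norm_eq_inner inner_add_left inner_add_right inner_commute)
    next
      case False
      then show ?thesis by (simp add: I_def \<eta>_def)
    qed
    have i1: "integrable P (\<lambda>\<omega>. (norm (I m \<omega>))\<^sup>2 + 2 * (?V \<omega> \<bullet> (\<eta> m \<omega> *v ?w \<omega>)))"
      using Suc.IH m cross by auto
    have "expectation (\<lambda>\<omega>. (norm (I (Suc m) \<omega>))\<^sup>2) =
       expectation (\<lambda>\<omega>. (norm (I m \<omega>))\<^sup>2) + (q (Suc m) - q m) * expectation (\<lambda>\<omega>. (norm (\<eta> m \<omega>))\<^sup>2)"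
      unfolding eq using Suc.IH m cross sq i1 by simp
    then show ?case using Suc.IH m \<eta>2 sq i1 unfolding eq by simp
  qed
  have V_bound: "(\<Sum>i<m. (norm (\<eta> i \<omega>))\<^sup>2 * (q (Suc i) - q i)) \<le> K" if "m \<le> M" for m \<omega>
    using that
  proof (induction m)
    case (Suc m)
    show ?case
    proof (cases "G m \<omega>")
      case True
      have "(\<Sum>i<Suc m. (norm (\<eta> i \<omega>))\<^sup>2 * (q (Suc i) - q i)) \<le> V (Suc m) \<omega>"
        unfolding V_def using Suc.prems
        by (intro sum_mono mult_right_mono q_le) (auto simp: \<eta>_def)
      then show ?thesis using True by (simp add: G_def)
    qed (use Suc in \<open>simp add: \<eta>_def\<close>)
  qed (use K in simp)
  have EI: "expectation (\<lambda>\<omega>. (norm (I M \<omega>))\<^sup>2) \<le> K"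
  proof -
    have "expectation (\<lambda>\<omega>. \<Sum>i<M. (norm (\<eta> i \<omega>))\<^sup>2 * (q (Suc i) - q i)) \<le> expectation (\<lambda>_. K)"
      using I2[of M] V_bound by (intro integral_mono) auto
    then show ?thesis using I2[of M] by (simp add: prob_space)
  qed
  have IM [measurable]: "(\<lambda>\<omega>. (norm (I M \<omega>))\<^sup>2) \<in> borel_measurable P"
    using I2[of M] by (auto dest: borel_measurable_integrable)
  have VM [measurable]: "V M \<in> borel_measurable P"
    using V_meas[of M M] F_measurable by auto
  \<comment> \<open>Consider the first index \<open>m0\<close> at which \<open>J\<close> exceeds
    \<open>\<epsilon>\<close>. If \<open>V M \<le> K\<close>, the integrand is on before
    \<open>m0\<close> and off from \<open>m0\<close> onwards, so \<open>I M\<close> keeps the value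
    \<open>J m0\<close>. A maximum over the grid is thereby turned into one terminal value, to which
    Markov's inequality applies.\<close>
  have sub: "{\<omega> \<in> space P. \<exists>m\<le>M. \<epsilon> < norm (J m \<omega>)} \<subseteq>
      {\<omega> \<in> space P. \<epsilon>\<^sup>2 \<le> (norm (I M \<omega>))\<^sup>2} \<union> {\<omega> \<in> space P. K < V M \<omega>}"
  proof (safe, goal_cases)
    case (1 \<omega> m)
    then have VK: "V M \<omega> \<le> K" by simp
    obtain m0 where "\<epsilon> < norm (J m0 \<omega>)" "m0 \<le> m" and least: "\<And>i. i < m0 \<Longrightarrow> \<not> \<epsilon> < norm (J i \<omega>)"
    proof (rule that)
      show "\<epsilon> < norm (J (LEAST m. \<epsilon> < norm (J m \<omega>)) \<omega>)" by (rule LeastI) (rule 1)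
      show "(LEAST m. \<epsilon> < norm (J m \<omega>)) \<le> m" by (rule Least_le) (rule 1)
    qed (rule not_less_Least)
    with 1 have m0: "\<epsilon> < norm (J m0 \<omega>)" "m0 \<le> M" "\<And>i. i < m0 \<Longrightarrow> norm (J i \<omega>) \<le> \<epsilon>"
      by (auto simp: not_less)
    have "G i \<omega>" if "i < m0" for i
      using that m0 VK V_mono[of "Suc i" M \<omega>] by (auto simp: G_def)
    then have "I m0 \<omega> = J m0 \<omega>" by (intro IJ) auto
    moreover have "I M \<omega> = I m0 \<omega>"
    proof -
      have "\<not> G i \<omega>" if "m0 \<le> i" for i
        using that m0(1) by (auto simp: G_def not_le)
      then show ?thesis
        unfolding I_def using m0(2)
        by (intro sum.mono_neutral_right) (auto simp: \<eta>_def)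
    qed
    ultimately show ?case using m0(1) \<epsilon> by (intro power_mono) auto
  qed
  have "prob {\<omega> \<in> space P. \<exists>m\<le>M. \<epsilon> < norm (J m \<omega>)} \<le>
      prob ({\<omega> \<in> space P. \<epsilon>\<^sup>2 \<le> (norm (I M \<omega>))\<^sup>2} \<union> {\<omega> \<in> space P. K < V M \<omega>})"
    by (intro finite_measure_mono sub) measurable
  also have "\<dots> \<le> prob {\<omega> \<in> space P. \<epsilon>\<^sup>2 \<le> (norm (I M \<omega>))\<^sup>2} + prob {\<omega> \<in> space P. K < V M \<omega>}"
    by (intro measure_Un_le) measurable
  also have "prob {\<omega> \<in> space P. \<epsilon>\<^sup>2 \<le> (norm (I M \<omega>))\<^sup>2} \<le> expectation (\<lambda>\<omega>. (norm (I M \<omega>))\<^sup>2) / \<epsilon>\<^sup>2"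
    using I2[of M] \<epsilon> by (intro integral_Markov_inequality_measure[where A = "{}"]) auto
  also have "\<dots> \<le> K / \<epsilon>\<^sup>2" using EI by (intro divide_right_mono) auto
  finally show ?thesis unfolding V_def by simp
qed

end

section \<open>Merging families of intervals into a common grid\<close>

lemma matrix_vector_mult_sum_left: "(\<Sum>a\<in>A. B a) *v x = (\<Sum>a\<in>A. B a *v x)"
  for B :: "'a \<Rightarrow> real ^ 'm ^ 'n"
  by (induction A rule: infinite_finite_induct) (simp_all add: matrix_vector_mult_add_rdistrib)

lemma matrix_vector_mult_sum_right: "B *v (\<Sum>a\<in>A. x a) = (\<Sum>a\<in>A. B *v x a)"
  for B :: "real ^ 'm ^ 'n"
  by (induction A rule: infinite_finite_induct) (simp_all add: matrix_vector_right_distrib)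

lemma strict_grid_mono:
  fixes q :: "nat \<Rightarrow> real"
  assumes "\<And>i. i < M \<Longrightarrow> q i < q (Suc i)" "i \<le> j" "j \<le> M"
  shows "q i \<le> q j"
  using assms(2,3)
proof (induction j)
  case (Suc j)
  then show ?case using assms(1)[of j] by (cases "i = Suc j") auto
qed simp

lemma nth_image_lessThan_length: "(!) xs ` {..<length xs} = set xs"
  by (auto simp: set_conv_nth)

lemma finite_real_grid:
  fixes Q :: "real set"
  assumes "finite Q" "Q \<noteq> {}"
  obtains q M where "\<And>i. i < M \<Longrightarrow> q i < q (Suc i)" "q ` {..M :: nat} = Q"
proof
  let ?xs = "sorted_list_of_set Q"
  have len: "length ?xs = card Q" "0 < card Q"
    using assms by (simp_all add: card_gt_0_iff)
  show "?xs ! i < ?xs ! Suc i" if "i < card Q - 1" for i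
    using sorted_wrt_nth_less[of "(<)" ?xs i "Suc i"] that len by simp
  have "(!) ?xs ` {..card Q - 1} = (!) ?xs ` {..<length ?xs}"
    using len by (intro arg_cong2[where f = image]) auto
  also have "\<dots> = Q"
    unfolding nth_image_lessThan_length by (rule set_sorted_list_of_set[OF assms(1)])
  finally show "(!) ?xs ` {..card Q - 1} = Q" .
qed

text \<open>By \<open>gap\<close>, neither \<open>u\<close> nor \<open>v\<close> lies in the
  interior of a cell, so a cell is contained in \<open>(u, v]\<close> exactly when its right
  endpoint is, and the sum telescopes between the clipped points.\<close>

lemma telescoping_on_grid:
  fixes q :: "nat \<Rightarrow> real" and f :: "real \<Rightarrow> 'b :: real_vector"
  assumes q: "\<And>i. i < M \<Longrightarrow> q i < q (Suc i)" and uv: "q 0 \<le> u" "u < v"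
    and gap: "\<And>i. i < M \<Longrightarrow> u < q (Suc i) \<Longrightarrow> u \<le> q i" "\<And>i. i < M \<Longrightarrow> v < q (Suc i) \<Longrightarrow> v \<le> q i"
    and "i \<le> M"
  shows "(\<Sum>m<i. indicator {u<..v} (q (Suc m)) *\<^sub>R (f (q (Suc m)) - f (q m))) =
    f (min (q i) v) - f (min (q i) u)"
  using \<open>i \<le> M\<close>
proof (induction i)
  case 0
  then show ?case using uv by simp
next
  case (Suc i)
  then have i: "i < M" by simp
  note qi = q[OF i]
  consider "q (Suc i) \<le> u" | "u < q (Suc i)" "q (Suc i) \<le> v" | "v < q (Suc i)" by linarith
  then show ?case
  proof cases
    case 1
    then show ?thesis using Suc qi uv by (simp add: min_def)
  next
    case 2
    then show ?thesis using Suc qi uv gap(1)[OF i] by (simp add: min_def)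
  next
    case 3
    then show ?thesis using Suc qi uv gap[OF i] by (simp add: min_def)
  qed
qed

context wiener_space
begin

text \<open>Dominated convergence for the indicators; it converts pathwise convergence into
  convergence in probability.\<close>

lemma prob_tendsto_zero:
  assumes A: "\<And>n. A n \<in> events" and ae: "AE \<omega> in P. \<forall>\<^sub>F n in sequentially. \<omega> \<notin> A n"
  shows "(\<lambda>n. prob (A n)) \<longlonglongrightarrow> 0"
proof -
  have "(\<lambda>n. \<integral>\<omega>. indicator (A n) \<omega> \<partial>P) \<longlonglongrightarrow> (\<integral>\<omega>. (0 :: real) \<partial>P)"
  proof (rule integral_dominated_convergence[where w = "\<lambda>_. 1"])
    show "AE \<omega> in P. (\<lambda>n. indicator (A n) \<omega> :: real) \<longlonglongrightarrow> 0"
      using ae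
    proof eventually_elim
      case (elim \<omega>)
      then have "\<forall>\<^sub>F n in sequentially. indicator (A n) \<omega> = (0 :: real)"
        by eventually_elim (simp add: indicator_def)
      then show ?case by (rule tendsto_eventually)
    qed
  qed (use A in \<open>auto simp: indicator_def\<close>)
  then show ?thesis using A by simp
qed

text \<open>The intervals may overlap, so the family can be the union of two unrelated partitions.
  Refining by all endpoints and all evaluation times in \<open>\<Theta>\<close> yields one grid on
  which the integrand is constant on cells, and \<open>grid_maximal_inequality\<close>
  applies.\<close>

lemma interval_family_maximal_inequality:
  fixes A :: "'a set" and u v :: "'a \<Rightarrow> real" and \<xi> :: "'a \<Rightarrow> 'w \<Rightarrow> real ^ 'd ^ 'n"
  assumes A: "finite A" and uv: "\<And>a. a \<in> A \<Longrightarrow> 0 \<le> u a" "\<And>a. a \<in> A \<Longrightarrow> u a < v a"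
    and \<xi>: "\<And>a. a \<in> A \<Longrightarrow> \<xi> a \<in> borel_measurable (F (ennreal (u a)))"
    and \<Theta>: "finite \<Theta>" "\<Theta> \<subseteq> {0..l}" and l: "0 \<le> l" and \<epsilon>: "0 < \<epsilon>" and K: "0 \<le> K"
  shows "prob {\<omega> \<in> space P. \<exists>t\<in>\<Theta>. \<epsilon> < norm (\<Sum>a\<in>A. \<xi> a \<omega> *v (W (min t (v a)) \<omega> - W (min t (u a)) \<omega>))} \<le>
    K / \<epsilon>\<^sup>2 + prob {\<omega> \<in> space P. ennreal K <
      (\<integral>\<^sup>+ s\<in>{0..l}. ennreal ((norm (\<Sum>a\<in>A. indicator {u a<..v a} s *\<^sub>R \<xi> a \<omega>))\<^sup>2) \<partial>lborel)}"
proof -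
  \<comment> \<open>Endpoints beyond \<open>l\<close> are left out: the sums are evaluated at times
    up to \<open>l\<close>, where \<open>min\<close> absorbs them. Adding 0 and \<open>l\<close>
    makes the grid span exactly \<open>{0..l}\<close>.\<close>
  define Q where "Q = insert 0 (insert l (\<Theta> \<union> ((u ` A \<union> v ` A) \<inter> {0..l})))"
  have Q: "finite Q" "Q \<noteq> {}" "Q \<subseteq> {0..l}" "0 \<in> Q" "l \<in> Q" "\<Theta> \<subseteq> Q"
    using A \<Theta> l by (auto simp: Q_def)
  obtain q M where q: "\<And>i. i < M \<Longrightarrow> q i < q (Suc i)" and qQ: "q ` {..M :: nat} = Q"
    using finite_real_grid[OF Q(1,2)] by metis
  note q_mono = strict_grid_mono[of M q, OF q]
  have qi: "q i \<in> {0..l}" if "i \<le> M" for i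
    using that qQ Q(3) by auto
  have q0: "q 0 = 0"
  proof -
    obtain i where "i \<le> M" "q i = 0" using Q(4) qQ by (metis atMost_iff imageE)
    then show ?thesis using q_mono[of 0 i] qi[of 0] by auto
  qed
  have gap: "x \<le> q i" if "x < q (Suc i)" "i < M" "x \<in> u ` A \<union> v ` A" for x i
  proof -
    have "0 \<le> x" using that(3) uv by force
    moreover have "x \<le> l" using that qi[of "Suc i"] by auto
    ultimately have "x \<in> Q" using that(3) by (auto simp: Q_def)
    then obtain j where j: "j \<le> M" "x = q j" using qQ by (metis atMost_iff imageE)
    then have "j \<le> i"
      using q_mono[of "Suc i" j] that by (meson leD not_less_eq_eq)
    then show ?thesis using j q_mono[of j i] that by auto
  qed
  define Z where "Z s \<omega> = (\<Sum>a\<in>A. indicator {u a<..v a} s *\<^sub>R \<xi> a \<omega>)" for s \<omega>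
  \<comment> \<open>Sampling at the right endpoint of the cell fits the right-closed intervals. The
    value is nevertheless known at \<open>q m\<close>: by \<open>gap\<close>, an interval containing
    \<open>q (Suc m)\<close> starts no later than \<open>q m\<close>.\<close>
  define \<zeta> where "\<zeta> m = Z (q (Suc m))" for m
  have \<zeta>: "\<zeta> m \<in> borel_measurable (F (ennreal (q m)))" if "m < M" for m
    unfolding \<zeta>_def Z_def
  proof (intro borel_measurable_sum)
    fix a assume a: "a \<in> A"
    show "(\<lambda>\<omega>. indicator {u a<..v a} (q (Suc m)) *\<^sub>R \<xi> a \<omega>) \<in> borel_measurable (F (ennreal (q m)))"
    proof (cases "u a < q (Suc m)")
      case True
      then have "u a \<le> q m" using gap that a by blast
      then have [measurable]: "\<xi> a \<in> borel_measurable (F (ennreal (q m)))"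
        using \<xi>[OF a] by (auto intro: F_mono ennreal_leI)
      show ?thesis by measurable
    qed simp
  qed
  have Z_q: "Z s \<omega> = \<zeta> m \<omega>" if "m < M" "q m < s" "s \<le> q (Suc m)" for m s \<omega>
    unfolding \<zeta>_def Z_def
  proof (intro sum.cong refl arg_cong2[where f = scaleR])
    fix a assume a: "a \<in> A"
    have "u a < s \<longleftrightarrow> u a < q (Suc m)" "s \<le> v a \<longleftrightarrow> q (Suc m) \<le> v a"
      using gap[of "u a" m] gap[of "v a" m] that a by force+
    then show "indicator {u a<..v a} s = (indicator {u a<..v a} (q (Suc m)) :: real)"
      by (simp add: indicator_def)
  qed
  have J: "(\<Sum>m<i. \<zeta> m \<omega> *v (W (q (Suc m)) \<omega> - W (q m) \<omega>)) =
      (\<Sum>a\<in>A. \<xi> a \<omega> *v (W (min (q i) (v a)) \<omega> - W (min (q i) (u a)) \<omega>))" if "i \<le> M" for i \<omega>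
  proof -
    have "(\<Sum>m<i. \<zeta> m \<omega> *v (W (q (Suc m)) \<omega> - W (q m) \<omega>)) =
      (\<Sum>a\<in>A. \<Sum>m<i. \<xi> a \<omega> *v (indicator {u a<..v a} (q (Suc m)) *\<^sub>R (W (q (Suc m)) \<omega> - W (q m) \<omega>)))"
      unfolding \<zeta>_def Z_def matrix_vector_mult_sum_left
      by (subst sum.swap) (simp add: matrix_vector_mult_scaleR scaleR_matrix_vector_assoc)
    also have "\<dots> = (\<Sum>a\<in>A. \<xi> a \<omega> *v (W (min (q i) (v a)) \<omega> - W (min (q i) (u a)) \<omega>))"
      unfolding matrix_vector_mult_sum_right[symmetric]
      using that gap uv q0
      by (intro sum.cong refl arg_cong2[where f = "(*v)"] telescoping_on_grid[where f = "\<lambda>t. W t \<omega>" and M = M] q) auto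
    finally show ?thesis .
  qed
  have \<xi>P [measurable]: "\<xi> a \<in> borel_measurable P" if "a \<in> A" for a
    using \<xi>[OF that] by (rule F_measurable)
  have meas: "(\<lambda>\<omega>. \<integral>\<^sup>+ s\<in>{0..l}. ennreal ((norm (Z s \<omega>))\<^sup>2) \<partial>lborel) \<in> borel_measurable P"
  proof (rule lborel.borel_measurable_nn_integral)
    have "(\<lambda>(\<omega>, s). Z s \<omega>) \<in> borel_measurable (P \<Otimes>\<^sub>M lborel)"
      unfolding Z_def split_def
    proof (intro borel_measurable_sum borel_measurable_scaleR)
      fix a assume a: "a \<in> A"
      show "(\<lambda>x. indicator {u a<..v a} (snd x) :: real) \<in> borel_measurable (P \<Otimes>\<^sub>M lborel)"
        by measurable
      show "(\<lambda>x. \<xi> a (fst x)) \<in> borel_measurable (P \<Otimes>\<^sub>M lborel)"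
        using \<xi>P[OF a] by (intro measurable_compose[OF measurable_fst])
    qed
    then have [measurable]: "(\<lambda>x. Z (snd x) (fst x)) \<in> borel_measurable (P \<Otimes>\<^sub>M lborel)"
      by (simp add: split_def)
    show "(\<lambda>(\<omega>, s). ennreal ((norm (Z s \<omega>))\<^sup>2) * indicator {0..l} s) \<in> borel_measurable (P \<Otimes>\<^sub>M lborel)"
      unfolding split_def by measurable
  qed
  have V: "ennreal (\<Sum>m<M. (norm (\<zeta> m \<omega>))\<^sup>2 * (q (Suc m) - q m)) \<le>
      (\<integral>\<^sup>+ s\<in>{0..l}. ennreal ((norm (Z s \<omega>))\<^sup>2) \<partial>lborel)" for \<omega>
  proof -
    have "ennreal (\<Sum>m<M. (norm (\<zeta> m \<omega>))\<^sup>2 * (q (Suc m) - q m)) =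
        (\<Sum>m<M. ennreal ((norm (\<zeta> m \<omega>))\<^sup>2) * ennreal (q (Suc m) - q m))"
      using q by (subst sum_ennreal[symmetric]) (auto simp: ennreal_mult less_imp_le)
    also have "\<dots> = (\<Sum>m<M. \<integral>\<^sup>+ s. ennreal ((norm (\<zeta> m \<omega>))\<^sup>2) * indicator {q m<..q (Suc m)} s \<partial>lborel)"
      using q by (intro sum.cong refl) (simp add: nn_integral_cmult_indicator less_imp_le)
    also have "\<dots> = (\<integral>\<^sup>+ s. (\<Sum>m<M. ennreal ((norm (\<zeta> m \<omega>))\<^sup>2) * indicator {q m<..q (Suc m)} s) \<partial>lborel)"
      by (rule nn_integral_sum[symmetric]) simp
    also have "\<dots> \<le> (\<integral>\<^sup>+ s\<in>{0..l}. ennreal ((norm (Z s \<omega>))\<^sup>2) \<partial>lborel)"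
    proof (rule nn_integral_mono)
      fix s
      show "(\<Sum>m<M. ennreal ((norm (\<zeta> m \<omega>))\<^sup>2) * indicator {q m<..q (Suc m)} s) \<le>
          ennreal ((norm (Z s \<omega>))\<^sup>2) * indicator {0..l} s"
      proof (cases "\<exists>m<M. s \<in> {q m<..q (Suc m)}")
        case True
        then obtain m where m: "m < M" "q m < s" "s \<le> q (Suc m)" by auto
        have unique: "k = m" if "k < M" "s \<in> {q k<..q (Suc k)}" for k
          using that m q_mono[of "Suc k" m] q_mono[of "Suc m" k] by (cases k m rule: linorder_cases) auto
        have "(\<Sum>k<M. ennreal ((norm (\<zeta> k \<omega>))\<^sup>2) * indicator {q k<..q (Suc k)} s) =
            (\<Sum>k<M. if k = m then ennreal ((norm (\<zeta> m \<omega>))\<^sup>2) else 0)"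
        proof (intro sum.cong refl)
          fix k assume k: "k \<in> {..<M}"
          have "indicator {q k<..q (Suc k)} s = (if k = m then 1 else 0 :: ennreal)"
          proof (cases "k = m")
            case False
            then have "s \<notin> {q k<..q (Suc k)}" using unique k by blast
            then show ?thesis unfolding if_not_P[OF False] indicator_def by simp
          next
            case True
            have "s \<in> {q m<..q (Suc m)}" using m by simp
            then show ?thesis unfolding True indicator_def by simp
          qed
          then show "ennreal ((norm (\<zeta> k \<omega>))\<^sup>2) * indicator {q k<..q (Suc k)} s =
              (if k = m then ennreal ((norm (\<zeta> m \<omega>))\<^sup>2) else 0)"
            by (cases "k = m") (simp_all only: simp_thms if_True if_False mult_1_right mult_zero_right)
        qed
        also have "\<dots> = ennreal ((norm (Z s \<omega>))\<^sup>2)"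
          using m by (simp add: Z_q)
        finally show ?thesis using m qi[of m] qi[of "Suc m"] by (simp add: indicator_def)
      next
        case False
        then have "(\<Sum>m<M. ennreal ((norm (\<zeta> m \<omega>))\<^sup>2) * indicator {q m<..q (Suc m)} s) = 0"
          by (intro sum.neutral) auto
        then show ?thesis by simp
      qed
    qed
    finally show ?thesis .
  qed
  have "prob {\<omega> \<in> space P. \<exists>t\<in>\<Theta>. \<epsilon> < norm (\<Sum>a\<in>A. \<xi> a \<omega> *v (W (min t (v a)) \<omega> - W (min t (u a)) \<omega>))} \<le>
    prob {\<omega> \<in> space P. \<exists>m\<le>M. \<epsilon> < norm (\<Sum>i<m. \<zeta> i \<omega> *v (W (q (Suc i)) \<omega> - W (q i) \<omega>))}"
  proof (rule finite_measure_mono)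
    have Wm: "W (q i) \<in> borel_measurable P" if "i \<le> M" for i
      using qi[OF that] by (intro W_measurable) auto
    have sum_meas: "(\<lambda>\<omega>. \<Sum>i<m. \<zeta> i \<omega> *v (W (q (Suc i)) \<omega> - W (q i) \<omega>)) \<in> borel_measurable P" if "m \<le> M" for m
      using that by (intro borel_measurable_sum borel_measurable_matrix_vector_mult borel_measurable_diff
          Wm F_measurable[OF \<zeta>]) auto
    have "{\<omega> \<in> space P. \<epsilon> < norm (\<Sum>i<m. \<zeta> i \<omega> *v (W (q (Suc i)) \<omega> - W (q i) \<omega>))} \<in> events" if "m \<le> M" for m
    proof -
      note [measurable] = sum_meas[OF that]
      show ?thesis by measurable
    qed
    then have "(\<Union>m\<in>{..M}. {\<omega> \<in> space P. \<epsilon> < norm (\<Sum>i<m. \<zeta> i \<omega> *v (W (q (Suc i)) \<omega> - W (q i) \<omega>))}) \<in> events"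
      by (intro sets.finite_UN) auto
    also have "(\<Union>m\<in>{..M}. {\<omega> \<in> space P. \<epsilon> < norm (\<Sum>i<m. \<zeta> i \<omega> *v (W (q (Suc i)) \<omega> - W (q i) \<omega>))}) =
       {\<omega> \<in> space P. \<exists>m\<le>M. \<epsilon> < norm (\<Sum>i<m. \<zeta> i \<omega> *v (W (q (Suc i)) \<omega> - W (q i) \<omega>))}"
      by auto
    finally show "{\<omega> \<in> space P. \<exists>m\<le>M. \<epsilon> < norm (\<Sum>i<m. \<zeta> i \<omega> *v (W (q (Suc i)) \<omega> - W (q i) \<omega>))} \<in> events" .
    show "{\<omega> \<in> space P. \<exists>t\<in>\<Theta>. \<epsilon> < norm (\<Sum>a\<in>A. \<xi> a \<omega> *v (W (min t (v a)) \<omega> - W (min t (u a)) \<omega>))} \<subseteq>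
      {\<omega> \<in> space P. \<exists>m\<le>M. \<epsilon> < norm (\<Sum>i<m. \<zeta> i \<omega> *v (W (q (Suc i)) \<omega> - W (q i) \<omega>))}"
    proof safe
      fix \<omega> t assume t: "t \<in> \<Theta>" "\<epsilon> < norm (\<Sum>a\<in>A. \<xi> a \<omega> *v (W (min t (v a)) \<omega> - W (min t (u a)) \<omega>))"
      have "t \<in> q ` {..M}" unfolding qQ using Q(6) t(1) by (rule subsetD)
      then obtain i where i: "i \<le> M" "t = q i" unfolding image_iff Bex_def atMost_iff by (elim exE conjE)
      show "\<exists>m\<le>M. \<epsilon> < norm (\<Sum>i<m. \<zeta> i \<omega> *v (W (q (Suc i)) \<omega> - W (q i) \<omega>))"
        using i(1) t(2)[unfolded i(2) J[OF i(1), symmetric]] by (intro exI[of _ i] conjI)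
    qed
  qed
  also have "\<dots> \<le> K / \<epsilon>\<^sup>2 + prob {\<omega> \<in> space P. K < (\<Sum>i<M. (norm (\<zeta> i \<omega>))\<^sup>2 * (q (Suc i) - q i))}"
    by (rule grid_maximal_inequality) (use q0 q \<zeta> \<epsilon> K in auto)
  also have "prob {\<omega> \<in> space P. K < (\<Sum>i<M. (norm (\<zeta> i \<omega>))\<^sup>2 * (q (Suc i) - q i))} \<le>
      prob {\<omega> \<in> space P. ennreal K < (\<integral>\<^sup>+ s\<in>{0..l}. ennreal ((norm (Z s \<omega>))\<^sup>2) \<partial>lborel)}"
  proof (rule finite_measure_mono)
    show "{\<omega> \<in> space P. ennreal K < (\<integral>\<^sup>+ s\<in>{0..l}. ennreal ((norm (Z s \<omega>))\<^sup>2) \<partial>lborel)} \<in> events"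
      using meas by (intro borel_measurable_less) auto
    show "{\<omega> \<in> space P. K < (\<Sum>i<M. (norm (\<zeta> i \<omega>))\<^sup>2 * (q (Suc i) - q i))} \<subseteq>
        {\<omega> \<in> space P. ennreal K < (\<integral>\<^sup>+ s\<in>{0..l}. ennreal ((norm (Z s \<omega>))\<^sup>2) \<partial>lborel)}"
      using K by (auto intro!: less_le_trans[OF _ V] simp: ennreal_less_iff)
  qed
  finally show ?thesis unfolding Z_def by simp
qed

end

section \<open>Riemann sums for the Ito integral\<close>

lemma norm_add_power2_le: "(norm (a + b))\<^sup>2 \<le> 2 * (norm a)\<^sup>2 + 2 * (norm b)\<^sup>2"
  for a b :: "'a :: real_normed_vector"
proof -
  have "(norm (a + b))\<^sup>2 \<le> (norm a + norm b)\<^sup>2"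
    by (intro power_mono norm_triangle_ineq) simp
  also have "\<dots> \<le> 2 * (norm a)\<^sup>2 + 2 * (norm b)\<^sup>2"
    using zero_le_power2[of "norm a - norm b"] by (simp add: power2_sum power2_diff)
  finally show ?thesis .
qed

lemma nn_integral_norm_diff_power2_le:
  fixes f g h :: "real \<Rightarrow> 'b :: {real_normed_vector, second_countable_topology}"
  assumes [measurable]: "A \<in> sets borel" "f \<in> borel_measurable borel" "g \<in> borel_measurable borel" "h \<in> borel_measurable borel"
  shows "(\<integral>\<^sup>+ s\<in>A. ennreal ((norm (f s - g s))\<^sup>2) \<partial>lborel) \<le>
    2 * (\<integral>\<^sup>+ s. ennreal ((norm (f s - h s))\<^sup>2) * indicator A s \<partial>lborel) +
    2 * (\<integral>\<^sup>+ s. ennreal ((norm (g s - h s))\<^sup>2) * indicator A s \<partial>lborel)"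
proof -
  have "(\<integral>\<^sup>+ s\<in>A. ennreal ((norm (f s - g s))\<^sup>2) \<partial>lborel) \<le>
    (\<integral>\<^sup>+ s. 2 * (ennreal ((norm (f s - h s))\<^sup>2) * indicator A s) + 2 * (ennreal ((norm (g s - h s))\<^sup>2) * indicator A s) \<partial>lborel)"
  proof (rule nn_integral_mono)
    fix s
    have "ennreal ((norm (f s - g s))\<^sup>2) \<le> ennreal (2 * (norm (f s - h s))\<^sup>2 + 2 * (norm (g s - h s))\<^sup>2)"
      using norm_add_power2_le[of "f s - h s" "h s - g s"] by (intro ennreal_leI) (simp add: norm_minus_commute)
    also have "\<dots> = 2 * ennreal ((norm (f s - h s))\<^sup>2) + 2 * ennreal ((norm (g s - h s))\<^sup>2)"
      by (simp add: ennreal_plus ennreal_mult)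
    finally show "ennreal ((norm (f s - g s))\<^sup>2) * indicator A s \<le>
      2 * (ennreal ((norm (f s - h s))\<^sup>2) * indicator A s) + 2 * (ennreal ((norm (g s - h s))\<^sup>2) * indicator A s)"
      by (simp add: indicator_def)
  qed
  also have "\<dots> = 2 * (\<integral>\<^sup>+ s. ennreal ((norm (f s - h s))\<^sup>2) * indicator A s \<partial>lborel) +
    2 * (\<integral>\<^sup>+ s. ennreal ((norm (g s - h s))\<^sup>2) * indicator A s \<partial>lborel)"
    by (subst nn_integral_add) (simp_all add: nn_integral_cmult)
  finally show ?thesis .
qed

context wiener_space
begin

lemma step_process_integral_measurable:
  fixes H :: "real \<Rightarrow> 'w \<Rightarrow> real ^ 'd ^ 'n" and \<xi> :: "nat \<Rightarrow> 'w \<Rightarrow> real ^ 'd ^ 'n"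
  assumes H: "(\<lambda>(s, \<omega>). H s \<omega>) \<in> borel_measurable (restrict_space borel {0..} \<Otimes>\<^sub>M P)"
    and \<xi>: "\<And>i. i < N \<Longrightarrow> \<xi> i \<in> borel_measurable P"
  shows "(\<lambda>\<omega>. \<integral>\<^sup>+ s\<in>{0..l}. ennreal ((norm (step_process N p \<xi> s \<omega> - H s \<omega>))\<^sup>2) \<partial>lborel) \<in> borel_measurable P"
    and "\<omega> \<in> space P \<Longrightarrow> (\<lambda>s. H (max 0 s) \<omega>) \<in> borel_measurable borel"
proof -
  \<comment> \<open>\<open>H\<close> is jointly measurable on nonnegative times only. Composing the
    time with \<open>max 0\<close> extends it to the whole line and leaves the integral over
    \<open>{0..l}\<close> unchanged.\<close>
  have map: "(\<lambda>x. (max 0 (snd x), fst x)) \<in> P \<Otimes>\<^sub>M lborel \<rightarrow>\<^sub>M restrict_space borel {0 :: real..} \<Otimes>\<^sub>M P"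
  proof (rule measurable_Pair)
    show "(\<lambda>x. max 0 (snd x)) \<in> P \<Otimes>\<^sub>M lborel \<rightarrow>\<^sub>M restrict_space borel {0 :: real..}"
    proof (rule measurable_restrict_space2)
      show "(\<lambda>x. max (0 :: real) (snd x)) \<in> borel_measurable (P \<Otimes>\<^sub>M lborel)"
        by measurable
    qed simp
    show "fst \<in> P \<Otimes>\<^sub>M lborel \<rightarrow>\<^sub>M P" by (rule measurable_fst)
  qed
  have Hm [measurable]: "(\<lambda>x. H (max 0 (snd x)) (fst x)) \<in> borel_measurable (P \<Otimes>\<^sub>M lborel)"
    using measurable_compose[OF map H] by simp
  show "(\<lambda>s. H (max 0 s) \<omega>) \<in> borel_measurable borel" if "\<omega> \<in> space P"
  proof -
    have "(\<lambda>s. (\<omega>, s)) \<in> borel \<rightarrow>\<^sub>M P \<Otimes>\<^sub>M lborel"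
      using that by (intro measurable_Pair) auto
    from measurable_compose[OF this Hm] show ?thesis by simp
  qed
  have [measurable]: "(\<lambda>x. step_process N p \<xi> (snd x) (fst x)) \<in> borel_measurable (P \<Otimes>\<^sub>M lborel)"
    unfolding step_process_def
  proof (intro borel_measurable_sum borel_measurable_scaleR)
    fix i assume i: "i \<in> {..<N}"
    show "(\<lambda>x. indicator {p i<..p (Suc i)} (snd x) :: real) \<in> borel_measurable (P \<Otimes>\<^sub>M lborel)"
      by measurable
    show "(\<lambda>x. \<xi> i (fst x)) \<in> borel_measurable (P \<Otimes>\<^sub>M lborel)"
      using \<xi> i by (intro measurable_compose[OF measurable_fst]) auto
  qed
  have "(\<lambda>\<omega>. \<integral>\<^sup>+ s\<in>{0..l}. ennreal ((norm (step_process N p \<xi> s \<omega> - H (max 0 s) \<omega>))\<^sup>2) \<partial>lborel) \<in> borel_measurable P"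
  proof (rule lborel.borel_measurable_nn_integral)
    show "(\<lambda>(\<omega>, s). ennreal ((norm (step_process N p \<xi> s \<omega> - H (max 0 s) \<omega>))\<^sup>2) * indicator {0..l} s)
        \<in> borel_measurable (P \<Otimes>\<^sub>M lborel)"
      unfolding split_def by measurable
  qed
  also have "(\<lambda>\<omega>. \<integral>\<^sup>+ s\<in>{0..l}. ennreal ((norm (step_process N p \<xi> s \<omega> - H (max 0 s) \<omega>))\<^sup>2) \<partial>lborel) =
    (\<lambda>\<omega>. \<integral>\<^sup>+ s\<in>{0..l}. ennreal ((norm (step_process N p \<xi> s \<omega> - H s \<omega>))\<^sup>2) \<partial>lborel)"
    by (intro ext nn_integral_cong) (auto simp: indicator_def)
  finally show "(\<lambda>\<omega>. \<integral>\<^sup>+ s\<in>{0..l}. ennreal ((norm (step_process N p \<xi> s \<omega> - H s \<omega>))\<^sup>2) \<partial>lborel) \<in> borel_measurable P" .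
qed

lemma step_integral_measurable:
  fixes \<xi> :: "nat \<Rightarrow> 'w \<Rightarrow> real ^ 'd ^ 'n"
  assumes "\<And>i. i < N \<Longrightarrow> \<xi> i \<in> borel_measurable P" "\<And>i. i \<le> N \<Longrightarrow> 0 \<le> p i" "0 \<le> t"
  shows "step_integral W N p \<xi> t \<in> borel_measurable P"
  unfolding step_integral_def using assms
  by (intro borel_measurable_sum borel_measurable_matrix_vector_mult borel_measurable_diff W_measurable) auto

text \<open>Negating the second integrand and joining the two index sets by \<open><+>\<close>
  writes the difference as the integral of a single family of intervals. The quarter of
  \<open>K\<close> comes from comparing both integrands with \<open>H\<close>: a squared distance is
  at most twice the sum of the squared distances to a third point, so two bounds
  \<open>K / 4\<close> give \<open>K\<close>.\<close>

lemma step_integral_maximal_inequality: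
  fixes \<xi> \<xi>' :: "nat \<Rightarrow> 'w \<Rightarrow> real ^ 'd ^ 'n" and H :: "real \<Rightarrow> 'w \<Rightarrow> real ^ 'd ^ 'n"
  assumes H: "(\<lambda>(s, \<omega>). H s \<omega>) \<in> borel_measurable (restrict_space borel {0..} \<Otimes>\<^sub>M P)"
    and p: "0 \<le> p 0" "\<And>i. i < N \<Longrightarrow> p i < p (Suc i)" "\<And>i. i < N \<Longrightarrow> \<xi> i \<in> borel_measurable (F (ennreal (p i)))"
    and p': "0 \<le> p' 0" "\<And>i. i < N' \<Longrightarrow> p' i < p' (Suc i)" "\<And>i. i < N' \<Longrightarrow> \<xi>' i \<in> borel_measurable (F (ennreal (p' i)))"
    and \<Theta>: "finite \<Theta>" "\<Theta> \<subseteq> {0..l}" and l: "0 \<le> l" and \<epsilon>: "0 < \<epsilon>" and K: "0 \<le> K"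
  shows "prob {\<omega> \<in> space P. \<exists>t\<in>\<Theta>. \<epsilon> < norm (step_integral W N p \<xi> t \<omega> - step_integral W N' p' \<xi>' t \<omega>)} \<le>
    K / \<epsilon>\<^sup>2 +
    prob {\<omega> \<in> space P. ennreal (K / 4) < (\<integral>\<^sup>+ s\<in>{0..l}. ennreal ((norm (step_process N p \<xi> s \<omega> - H s \<omega>))\<^sup>2) \<partial>lborel)} +
    prob {\<omega> \<in> space P. ennreal (K / 4) < (\<integral>\<^sup>+ s\<in>{0..l}. ennreal ((norm (step_process N' p' \<xi>' s \<omega> - H s \<omega>))\<^sup>2) \<partial>lborel)}"
proof -
  define A where "A = {..<N} <+> {..<N'}"
  define u where "u = case_sum p p'"
  define v where "v = case_sum (\<lambda>i. p (Suc i)) (\<lambda>i. p' (Suc i))"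
  define \<zeta> where "\<zeta> = case_sum \<xi> (\<lambda>i \<omega>. - \<xi>' i \<omega>)"
  have pos: "0 \<le> p i" if "i \<le> N" for i
    using strict_grid_mono[of N p 0 i] p that by fastforce
  have pos': "0 \<le> p' i" if "i \<le> N'" for i
    using strict_grid_mono[of N' p' 0 i] p' that by fastforce
  have \<xi>P: "\<xi> i \<in> borel_measurable P" if "i < N" for i
    using p(3)[OF that] by (rule F_measurable)
  have \<xi>P': "\<xi>' i \<in> borel_measurable P" if "i < N'" for i
    using p'(3)[OF that] by (rule F_measurable)
  have neg: "(- B) *v x = - (B *v x)" for B :: "real ^ 'd ^ 'n" and x
    by (simp add: vec_eq_iff matrix_vector_mult_def sum_negf)
  have int: "(\<Sum>a\<in>A. \<zeta> a \<omega> *v (W (min t (v a)) \<omega> - W (min t (u a)) \<omega>)) =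
      step_integral W N p \<xi> t \<omega> - step_integral W N' p' \<xi>' t \<omega>" for t \<omega>
    unfolding A_def step_integral_def
    by (subst sum.Plus) (simp_all add: u_def v_def \<zeta>_def neg sum_negf)
  have proc: "(\<Sum>a\<in>A. indicator {u a<..v a} s *\<^sub>R \<zeta> a \<omega>) =
      step_process N p \<xi> s \<omega> - step_process N' p' \<xi>' s \<omega>" for s \<omega>
    unfolding A_def step_process_def
    by (subst sum.Plus) (simp_all add: u_def v_def \<zeta>_def sum_negf)
  let ?D = "\<lambda>\<omega>. \<integral>\<^sup>+ s\<in>{0..l}. ennreal ((norm (step_process N p \<xi> s \<omega> - step_process N' p' \<xi>' s \<omega>))\<^sup>2) \<partial>lborel"
  let ?R = "\<lambda>\<omega>. \<integral>\<^sup>+ s\<in>{0..l}. ennreal ((norm (step_process N p \<xi> s \<omega> - H s \<omega>))\<^sup>2) \<partial>lborel"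
  let ?R' = "\<lambda>\<omega>. \<integral>\<^sup>+ s\<in>{0..l}. ennreal ((norm (step_process N' p' \<xi>' s \<omega> - H s \<omega>))\<^sup>2) \<partial>lborel"
  have "prob {\<omega> \<in> space P. \<exists>t\<in>\<Theta>. \<epsilon> < norm (\<Sum>a\<in>A. \<zeta> a \<omega> *v (W (min t (v a)) \<omega> - W (min t (u a)) \<omega>))} \<le>
    K / \<epsilon>\<^sup>2 + prob {\<omega> \<in> space P. ennreal K <
      (\<integral>\<^sup>+ s\<in>{0..l}. ennreal ((norm (\<Sum>a\<in>A. indicator {u a<..v a} s *\<^sub>R \<zeta> a \<omega>))\<^sup>2) \<partial>lborel)}"
  proof (rule interval_family_maximal_inequality[OF _ _ _ _ \<Theta> l \<epsilon> K])
    fix a assume "a \<in> A"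
    then consider i where "a = Inl i" "i < N" | i where "a = Inr i" "i < N'" by (auto simp: A_def)
    note a_cases = this
    show "0 \<le> u a" using a_cases by cases (simp_all add: u_def pos pos')
    show "u a < v a" using a_cases by cases (simp_all add: u_def v_def p p')
    show "\<zeta> a \<in> borel_measurable (F (ennreal (u a)))"
      using a_cases by cases (simp_all add: u_def \<zeta>_def p p')
  qed (simp add: A_def)
  also have "prob {\<omega> \<in> space P. ennreal K <
      (\<integral>\<^sup>+ s\<in>{0..l}. ennreal ((norm (\<Sum>a\<in>A. indicator {u a<..v a} s *\<^sub>R \<zeta> a \<omega>))\<^sup>2) \<partial>lborel)} =
    prob {\<omega> \<in> space P. ennreal K < ?D \<omega>}"
    unfolding proc ..
  also have "\<dots> \<le> prob ({\<omega> \<in> space P. ennreal (K / 4) < ?R \<omega>} \<union> {\<omega> \<in> space P. ennreal (K / 4) < ?R' \<omega>})"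
  proof (rule finite_measure_mono)
    show "{\<omega> \<in> space P. ennreal (K / 4) < ?R \<omega>} \<union> {\<omega> \<in> space P. ennreal (K / 4) < ?R' \<omega>} \<in> events"
      by (intro sets.Un borel_measurable_less borel_measurable_const step_process_integral_measurable(1)[OF H] \<xi>P \<xi>P')
    show "{\<omega> \<in> space P. ennreal K < ?D \<omega>} \<subseteq> {\<omega> \<in> space P. ennreal (K / 4) < ?R \<omega>} \<union> {\<omega> \<in> space P. ennreal (K / 4) < ?R' \<omega>}"
    proof (rule subsetI, rule ccontr)
      fix \<omega> assume \<omega>: "\<omega> \<in> {\<omega> \<in> space P. ennreal K < ?D \<omega>}"
        and "\<omega> \<notin> {\<omega> \<in> space P. ennreal (K / 4) < ?R \<omega>} \<union> {\<omega> \<in> space P. ennreal (K / 4) < ?R' \<omega>}"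
      then have le: "?R \<omega> \<le> ennreal (K / 4)" "?R' \<omega> \<le> ennreal (K / 4)" by auto
      have R: "(\<integral>\<^sup>+ s. ennreal ((norm (step_process N p \<xi> s \<omega> - H (max 0 s) \<omega>))\<^sup>2) * indicator {0..l} s \<partial>lborel) =
          (\<integral>\<^sup>+ s\<in>{0..l}. ennreal ((norm (step_process N p \<xi> s \<omega> - H s \<omega>))\<^sup>2) \<partial>lborel)"
        for N p and \<xi> :: "nat \<Rightarrow> 'w \<Rightarrow> real ^ 'd ^ 'n"
        by (intro nn_integral_cong) (auto simp: indicator_def)
      have [measurable]: "(\<lambda>s. step_process N p \<xi> s \<omega>) \<in> borel_measurable borel"
        for N p and \<xi> :: "nat \<Rightarrow> 'w \<Rightarrow> real ^ 'd ^ 'n"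
        unfolding step_process_def by measurable
      have [measurable]: "(\<lambda>s. H (max 0 s) \<omega>) \<in> borel_measurable borel"
        using step_process_integral_measurable(2)[OF H, of 0] \<omega> by simp
      have "?D \<omega> \<le>
        2 * (\<integral>\<^sup>+ s. ennreal ((norm (step_process N p \<xi> s \<omega> - H (max 0 s) \<omega>))\<^sup>2) * indicator {0..l} s \<partial>lborel) +
        2 * (\<integral>\<^sup>+ s. ennreal ((norm (step_process N' p' \<xi>' s \<omega> - H (max 0 s) \<omega>))\<^sup>2) * indicator {0..l} s \<partial>lborel)"
        by (rule nn_integral_norm_diff_power2_le) measurable
      also have "\<dots> \<le> 2 * ennreal (K / 4) + 2 * ennreal (K / 4)"
        unfolding R using le by (intro add_mono mult_left_mono) auto
      also have "\<dots> = ennreal K"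
      proof -
        have "2 * ennreal (K / 4) = ennreal (K / 2)"
          using ennreal_mult[of 2 "K / 4"] K by simp
        then show ?thesis using K by (simp flip: ennreal_plus)
      qed
      finally have "?D \<omega> \<le> ennreal K" .
      moreover have "ennreal K < ?D \<omega>" using \<omega> by (simp only: mem_Collect_eq)
      ultimately show False by (rule leD[THEN notE])
    qed
  qed
  also have "\<dots> \<le> prob {\<omega> \<in> space P. ennreal (K / 4) < ?R \<omega>} + prob {\<omega> \<in> space P. ennreal (K / 4) < ?R' \<omega>}"
    by (intro measure_Un_le borel_measurable_less borel_measurable_const step_process_integral_measurable(1)[OF H] \<xi>P \<xi>P')
  finally show ?thesis unfolding int by simp
qed

text \<open>\<open>ito_integral\<close> provides some approximating steps, not the sums over the
  given grid. Since both integrands approximate \<open>H\<close>, the maximal inequality compares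
  their integrals at all grid points simultaneously. The sampled values of \<open>H\<close> may be
  unbounded, which that inequality tolerates.\<close>

lemma ito_integral_grid_approximation:
  fixes H :: "real \<Rightarrow> 'w \<Rightarrow> real ^ 'd ^ 'n"
  assumes ito: "ito_integral P F W H I" and l: "0 < l" and \<epsilon>: "0 < \<epsilon>"
  defines "t \<equiv> \<lambda>n i. real i * (l / real (Suc n))"
  assumes conv: "AE \<omega> in P. (\<lambda>n. \<integral>\<^sup>+ s\<in>{0..l}. ennreal ((norm (
      step_process (Suc n) (t n) (\<lambda>i. H (t n i)) s \<omega> - H s \<omega>))\<^sup>2) \<partial>lborel) \<longlonglongrightarrow> 0"
  shows "(\<lambda>n. prob {\<omega> \<in> space P. \<exists>i\<le>Suc n. \<epsilon> < norm (
      step_integral W (Suc n) (t n) (\<lambda>i. H (t n i)) (t n i) \<omega> - I (t n i) \<omega>)}) \<longlonglongrightarrow> 0"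
proof -
  have H: "(\<lambda>(s, \<omega>). H s \<omega>) \<in> borel_measurable (restrict_space borel {0..} \<Otimes>\<^sub>M P)"
    and HF: "\<And>t. 0 \<le> t \<Longrightarrow> H t \<in> borel_measurable (F (ennreal t))"
    and I: "\<And>t. 0 \<le> t \<Longrightarrow> I t \<in> borel_measurable P"
    using ito by (auto simp: ito_integral_def)
  have "\<exists>N p \<xi>. (\<forall>k. step_data P F (N k) (p k) (\<xi> k)) \<and>
        (\<forall>t\<ge>0. \<forall>\<epsilon>>0.
           (\<lambda>k. prob {\<omega>\<in>space P. ennreal \<epsilon> <
                (\<integral>\<^sup>+ s\<in>{0..t}. ennreal ((norm (step_process (N k) (p k) (\<xi> k) s \<omega> - H s \<omega>))\<^sup>2) \<partial>lborel)})
             \<longlonglongrightarrow> 0 \<and>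
           (\<lambda>k. prob {\<omega>\<in>space P. \<epsilon> < norm (step_integral W (N k) (p k) (\<xi> k) t \<omega> - I t \<omega>)}) \<longlonglongrightarrow> 0)"
    using ito unfolding ito_integral_def by (elim conjE)
  then obtain N p \<xi> where \<xi>_all: "\<forall>k. step_data P F (N k) (p k) (\<xi> k)" and
    lims: "\<forall>t\<ge>0. \<forall>\<epsilon>>0.
           (\<lambda>k. prob {\<omega>\<in>space P. ennreal \<epsilon> <
                (\<integral>\<^sup>+ s\<in>{0..t}. ennreal ((norm (step_process (N k) (p k) (\<xi> k) s \<omega> - H s \<omega>))\<^sup>2) \<partial>lborel)})
             \<longlonglongrightarrow> 0 \<and>
           (\<lambda>k. prob {\<omega>\<in>space P. \<epsilon> < norm (step_integral W (N k) (p k) (\<xi> k) t \<omega> - I t \<omega>)}) \<longlonglongrightarrow> 0"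
    by (elim exE conjE)
  note \<xi> = \<xi>_all[rule_format]
  note R'_lim = lims[rule_format, THEN conjunct1] and I_lim = lims[rule_format, THEN conjunct2]
  let ?S = "\<lambda>n. step_integral W (Suc n) (t n) (\<lambda>i. H (t n i))"
  let ?J = "\<lambda>k. step_integral W (N k) (p k) (\<xi> k)"
  let ?R = "\<lambda>n \<omega>. \<integral>\<^sup>+ s\<in>{0..l}. ennreal ((norm (step_process (Suc n) (t n) (\<lambda>i. H (t n i)) s \<omega> - H s \<omega>))\<^sup>2) \<partial>lborel"
  let ?R' = "\<lambda>k \<omega>. \<integral>\<^sup>+ s\<in>{0..l}. ennreal ((norm (step_process (N k) (p k) (\<xi> k) s \<omega> - H s \<omega>))\<^sup>2) \<partial>lborel"
  have t: "0 \<le> t n i" "t n i < t n (Suc i)" for n i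
    using l by (simp_all add: t_def divide_strict_right_mono)
  have tl: "t n i \<le> l" if "i \<le> Suc n" for n i
    using l that by (simp add: t_def field_simps flip: of_nat_Suc)
  have pk: "0 \<le> p k 0" "\<And>i. i < N k \<Longrightarrow> p k i < p k (Suc i)" "\<And>i. i < N k \<Longrightarrow> \<xi> k i \<in> borel_measurable (F (ennreal (p k i)))" for k
    using \<xi>[of k] by (auto simp: step_data_def)
  have pk0: "0 \<le> p k i" if "i \<le> N k" for k i
    using strict_grid_mono[of "N k" "p k" 0 i, OF pk(2)] pk(1)[of k] that by force
  have S_meas: "?S n s \<in> borel_measurable P" if "0 \<le> s" for n s
    using t that by (intro step_integral_measurable F_measurable[OF HF]) auto
  have J_meas: "?J k s \<in> borel_measurable P" if "0 \<le> s" for k s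
    using pk0 that by (intro step_integral_measurable F_measurable[OF pk(3)]) auto
  have R_meas: "?R n \<in> borel_measurable P" for n
    by (intro step_process_integral_measurable(1)[OF H] F_measurable[OF HF] t)
  \<comment> \<open>Here \<open>n\<close> is fixed and \<open>k\<close> tends to infinity: the term
    with \<open>?R'\<close> vanishes, and so does the sum, as it runs over finitely many grid
    points. Halving \<open>\<epsilon>\<close> accounts for the detour from \<open>?S\<close> to
    \<open>I\<close> through \<open>?J\<close>.\<close>
  have bound: "prob {\<omega> \<in> space P. \<exists>i\<le>Suc n. \<epsilon> < norm (?S n (t n i) \<omega> - I (t n i) \<omega>)} \<le>
      K / (\<epsilon> / 2)\<^sup>2 + prob {\<omega> \<in> space P. ennreal (K / 4) < ?R n \<omega>}" if K: "0 < K" for n K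
  proof (rule LIMSEQ_le_const)
    show "(\<lambda>k. K / (\<epsilon> / 2)\<^sup>2 + prob {\<omega> \<in> space P. ennreal (K / 4) < ?R n \<omega>} +
          prob {\<omega> \<in> space P. ennreal (K / 4) < ?R' k \<omega>} +
          (\<Sum>i\<le>Suc n. prob {\<omega> \<in> space P. \<epsilon> / 2 < norm (?J k (t n i) \<omega> - I (t n i) \<omega>)}))
      \<longlonglongrightarrow> K / (\<epsilon> / 2)\<^sup>2 + prob {\<omega> \<in> space P. ennreal (K / 4) < ?R n \<omega>}"
      using tendsto_add[OF tendsto_add[OF tendsto_const R'_lim[of l "K / 4"]]
          tendsto_sum[of "{..Suc n}", OF I_lim[of "t n _" "\<epsilon> / 2"]]] l \<epsilon> K t
      by auto
    have "prob {\<omega> \<in> space P. \<exists>i\<le>Suc n. \<epsilon> < norm (?S n (t n i) \<omega> - I (t n i) \<omega>)} \<le>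
          K / (\<epsilon> / 2)\<^sup>2 + prob {\<omega> \<in> space P. ennreal (K / 4) < ?R n \<omega>} +
          prob {\<omega> \<in> space P. ennreal (K / 4) < ?R' k \<omega>} +
          (\<Sum>i\<le>Suc n. prob {\<omega> \<in> space P. \<epsilon> / 2 < norm (?J k (t n i) \<omega> - I (t n i) \<omega>)})" for k
    proof -
      let ?A = "\<lambda>i. {\<omega> \<in> space P. \<epsilon> / 2 < norm (?S n (t n i) \<omega> - ?J k (t n i) \<omega>)}"
      let ?A' = "{\<omega> \<in> space P. \<exists>t\<in>t n ` {..Suc n}. \<epsilon> / 2 < norm (?S n t \<omega> - ?J k t \<omega>)}"
      let ?B = "\<lambda>i. {\<omega> \<in> space P. \<epsilon> / 2 < norm (?J k (t n i) \<omega> - I (t n i) \<omega>)}"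
      have A: "?A i \<in> events" for i
      proof -
        note [measurable] = S_meas[OF t(1)[of n i]] J_meas[OF t(1)[of n i]]
        show ?thesis by measurable
      qed
      have B: "?B i \<in> events" for i
      proof -
        note [measurable] = I[OF t(1)[of n i]] J_meas[OF t(1)[of n i]]
        show ?thesis by measurable
      qed
      have A'_eq: "(\<Union>i\<in>{..Suc n}. ?A i) = ?A'" by auto
      have A': "?A' \<in> events"
        unfolding A'_eq[symmetric] using A by (intro sets.finite_UN) auto
      have UB: "(\<Union>i\<in>{..Suc n}. ?B i) \<in> events"
        using B by (intro sets.finite_UN) auto
      have "prob {\<omega> \<in> space P. \<exists>i\<le>Suc n. \<epsilon> < norm (?S n (t n i) \<omega> - I (t n i) \<omega>)} \<le>
          prob (?A' \<union> (\<Union>i\<in>{..Suc n}. ?B i))"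
      proof (intro finite_measure_mono sets.Un A' UB subsetI)
        fix \<omega> assume "\<omega> \<in> {\<omega> \<in> space P. \<exists>i\<le>Suc n. \<epsilon> < norm (?S n (t n i) \<omega> - I (t n i) \<omega>)}"
        then obtain i where i: "\<omega> \<in> space P" "i \<le> Suc n" "\<epsilon> < norm (?S n (t n i) \<omega> - I (t n i) \<omega>)" by auto
        have "norm (?S n (t n i) \<omega> - I (t n i) \<omega>) \<le>
            norm (?S n (t n i) \<omega> - ?J k (t n i) \<omega>) + norm (?J k (t n i) \<omega> - I (t n i) \<omega>)"
          using norm_triangle_ineq[of "?S n (t n i) \<omega> - ?J k (t n i) \<omega>" "?J k (t n i) \<omega> - I (t n i) \<omega>"] by simp
        then have "\<omega> \<in> ?A i \<or> \<omega> \<in> ?B i"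
          using i by (simp, linarith)
        then show "\<omega> \<in> ?A' \<union> (\<Union>i\<in>{..Suc n}. ?B i)"
          using i(2) unfolding A'_eq[symmetric] by blast
      qed
      also have "\<dots> \<le> prob ?A' + prob (\<Union>i\<in>{..Suc n}. ?B i)"
        by (rule measure_Un_le[OF A' UB])
      also have "prob (\<Union>i\<in>{..Suc n}. ?B i) \<le> (\<Sum>i\<le>Suc n. prob (?B i))"
        using B by (intro measure_UNION_le) auto
      also have "prob ?A' \<le> K / (\<epsilon> / 2)\<^sup>2 + prob {\<omega> \<in> space P. ennreal (K / 4) < ?R n \<omega>} +
          prob {\<omega> \<in> space P. ennreal (K / 4) < ?R' k \<omega>}"
        using t tl l \<epsilon> K
        by (intro step_integral_maximal_inequality[OF H _ _ _ pk] HF) auto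
      finally show ?thesis by simp
    qed
    then show "\<exists>M. \<forall>k\<ge>M. prob {\<omega> \<in> space P. \<exists>i\<le>Suc n. \<epsilon> < norm (?S n (t n i) \<omega> - I (t n i) \<omega>)} \<le>
          K / (\<epsilon> / 2)\<^sup>2 + prob {\<omega> \<in> space P. ennreal (K / 4) < ?R n \<omega>} +
          prob {\<omega> \<in> space P. ennreal (K / 4) < ?R' k \<omega>} +
          (\<Sum>i\<le>Suc n. prob {\<omega> \<in> space P. \<epsilon> / 2 < norm (?J k (t n i) \<omega> - I (t n i) \<omega>)})" by blast
  qed
  show ?thesis
  proof (rule LIMSEQ_I)
    fix r :: real assume r: "0 < r"
    define K where "K = r * \<epsilon>\<^sup>2 / 8"
    have K: "0 < K" "K / (\<epsilon> / 2)\<^sup>2 = r / 2"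
      using r \<epsilon> by (simp_all add: K_def power2_eq_square)
    have "(\<lambda>n. prob {\<omega> \<in> space P. ennreal (K / 4) < ?R n \<omega>}) \<longlonglongrightarrow> 0"
    proof (rule prob_tendsto_zero)
      show "{\<omega> \<in> space P. ennreal (K / 4) < ?R n \<omega>} \<in> events" for n
        using R_meas[of n] by (intro borel_measurable_less) auto
      show "AE \<omega> in P. \<forall>\<^sub>F n in sequentially. \<omega> \<notin> {\<omega> \<in> space P. ennreal (K / 4) < ?R n \<omega>}"
        using conv
      proof eventually_elim
        case (elim \<omega>)
        have "\<forall>\<^sub>F n in sequentially. ?R n \<omega> < ennreal (K / 4)"
          using K by (intro order_tendstoD(2)[OF elim]) simp
        then show ?case by eventually_elim (auto simp: not_less)
      qed
    qed
    then have "\<forall>\<^sub>F n in sequentially. prob {\<omega> \<in> space P. ennreal (K / 4) < ?R n \<omega>} < r / 2"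
      using r by (intro order_tendstoD(2)) auto
    then obtain n0 where n0: "\<And>n. n0 \<le> n \<Longrightarrow> prob {\<omega> \<in> space P. ennreal (K / 4) < ?R n \<omega>} < r / 2"
      by (auto simp: eventually_sequentially)
    show "\<exists>n0. \<forall>n\<ge>n0. norm (prob {\<omega> \<in> space P. \<exists>i\<le>Suc n. \<epsilon> < norm (?S n (t n i) \<omega> - I (t n i) \<omega>)} - 0) < r"
    proof (intro exI[of _ n0] allI impI)
      fix n assume "n0 \<le> n"
      have "prob {\<omega> \<in> space P. \<exists>i\<le>Suc n. \<epsilon> < norm (?S n (t n i) \<omega> - I (t n i) \<omega>)} < r"
        using bound[OF K(1), of n] n0[OF \<open>n0 \<le> n\<close>] unfolding K(2) by linarith
      then show "norm (prob {\<omega> \<in> space P. \<exists>i\<le>Suc n. \<epsilon> < norm (?S n (t n i) \<omega> - I (t n i) \<omega>)} - 0) < r"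
        by simp
    qed
  qed
qed

end

section \<open>One step of the Euler scheme\<close>

lemma abs_trace_le: "\<bar>trace A\<bar> \<le> CARD('n) * norm A" for A :: "real ^ 'n ^ 'n"
proof -
  have "\<bar>trace A\<bar> \<le> (\<Sum>i\<in>UNIV. \<bar>A $ i $ i\<bar>)"
    unfolding trace_def by (rule sum_abs)
  also have "\<dots> \<le> (\<Sum>i\<in>(UNIV :: 'n set). norm A)"
    by (intro sum_mono matrix_component_le_norm)
  finally show ?thesis by simp
qed

lemma trace_diff: "trace (A - B) = trace A - trace B" for A B :: "real ^ 'n ^ 'n"
  by (simp add: trace_def sum_subtractf)

lemma matrix_mult_diff_distrib: "A ** (B - C) = A ** B - A ** C"
  for A :: "real ^ 'm ^ 'n" and B C :: "real ^ 'k ^ 'm"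
  by (simp add: matrix_matrix_mult_def vec_eq_iff right_diff_distrib sum_subtractf)

lemma norm_mult_transpose_le:
  fixes \<eta> :: "real ^ 'd ^ 'n"
  assumes "norm \<eta> \<le> C" "norm A \<le> B"
  shows "norm (\<eta> ** transpose \<eta> ** A) \<le> C\<^sup>2 * B"
proof -
  have "norm (\<eta> ** transpose \<eta> ** A) \<le> norm (\<eta> ** transpose \<eta>) * norm A"
    by (rule norm_matrix_mult_le)
  also have "\<dots> \<le> (norm \<eta> * norm (transpose \<eta>)) * norm A"
    by (intro mult_right_mono norm_matrix_mult_le) simp
  also have "\<dots> = (norm \<eta>)\<^sup>2 * norm A"
    by (simp add: norm_transpose power2_eq_square)
  also have "\<dots> \<le> C\<^sup>2 * B"
    using assms by (intro mult_mono power_mono) auto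
  finally show ?thesis .
qed

text \<open>Cyclicity of the trace. The left side is what the quadratic form of the noise produces,
  the right side has the shape of the diffusion operator.\<close>

lemma trace_sandwich: "trace (transpose \<eta> ** A ** \<eta>) = trace (\<eta> ** transpose \<eta> ** A)"
  for A :: "real ^ 'n ^ 'n" and \<eta> :: "real ^ 'd ^ 'n"
proof -
  have "trace (transpose \<eta> ** A ** \<eta>) = trace (\<eta> ** (transpose \<eta> ** A))"
    by (rule trace_mul_sym)
  then show ?thesis by (simp add: matrix_mul_assoc)
qed

text \<open>Boundedness and the modulus are required on the whole space, with one \<open>d\<close>
  for all three functions, because Gaussian increments confine the Euler sums to no compact
  set.\<close>

locale C2_uniform =
  fixes G :: "real ^ 'n \<Rightarrow> real" and DG :: "real ^ 'n \<Rightarrow> real ^ 'n" and D2 :: "real ^ 'n \<Rightarrow> real ^ 'n ^ 'n"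
    and B :: real
  assumes G_deriv: "(G has_derivative (\<lambda>v. DG x \<bullet> v)) (at x)"
    and DG_deriv: "(DG has_derivative (\<lambda>v. D2 x *v v)) (at x)"
    and bound: "\<bar>G x\<bar> \<le> B" "norm (DG x) \<le> B" "norm (D2 x) \<le> B"
    and modulus: "0 < e \<Longrightarrow> \<exists>d>0. \<forall>x y. norm (x - y) < d \<longrightarrow>
        \<bar>G x - G y\<bar> \<le> e \<and> norm (DG x - DG y) \<le> e \<and> norm (D2 x - D2 y) \<le> e"
begin

lemma B_nonneg: "0 \<le> B"
  using bound(2)[of 0] norm_ge_zero[of "DG 0"] by linarith

lemma continuous_G: "continuous_on UNIV G"
  by (rule has_derivative_continuous_on[of UNIV G "\<lambda>x v. DG x \<bullet> v"]) (simp add: G_deriv)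

lemma continuous_DG: "continuous_on UNIV DG"
  by (rule has_derivative_continuous_on[of UNIV DG "\<lambda>x v. D2 x *v v"]) (simp add: DG_deriv)

lemma continuous_D2: "continuous_on UNIV D2"
  unfolding continuous_on_iff
proof (intro ballI allI impI)
  fix x and e :: real assume "0 < e"
  then obtain d where d: "d > 0" "\<And>x y. norm (x - y) < d \<Longrightarrow> norm (D2 x - D2 y) \<le> e / 2"
    using modulus[of "e / 2"] by auto
  show "\<exists>d>0. \<forall>y\<in>UNIV. dist y x < d \<longrightarrow> dist (D2 y) (D2 x) < e"
  proof (intro exI[of _ d] conjI d(1) ballI impI)
    fix y assume "dist y x < d"
    then have "norm (D2 y - D2 x) \<le> e / 2" by (intro d(2)) (simp add: dist_norm)
    then show "dist (D2 y) (D2 x) < e" using \<open>0 < e\<close> by (simp add: dist_norm)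
  qed
qed

lemma G_meas [measurable]: "G \<in> borel_measurable borel"
  by (rule borel_measurable_continuous_onI[OF continuous_G])

lemma DG_meas [measurable]: "DG \<in> borel_measurable borel"
  by (rule borel_measurable_continuous_onI[OF continuous_DG])

lemma D2_meas [measurable]: "D2 \<in> borel_measurable borel"
  by (rule borel_measurable_continuous_onI[OF continuous_D2])

lemma G_line_deriv: "((\<lambda>t. G (x + t *\<^sub>R u)) has_real_derivative DG (x + t *\<^sub>R u) \<bullet> u) (at t)"
proof -
  have "((\<lambda>t. x + t *\<^sub>R u) has_derivative (\<lambda>s. s *\<^sub>R u)) (at t)"
    by (auto intro!: derivative_eq_intros)
  from has_derivative_compose[OF this G_deriv] show ?thesis
    by (simp add: has_field_derivative_def mult_commute_abs)
qed

lemma DG_line_deriv: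
  "((\<lambda>t. DG (x + t *\<^sub>R u) \<bullet> u) has_real_derivative u \<bullet> (D2 (x + t *\<^sub>R u) *v u)) (at t)"
proof -
  have "((\<lambda>t. x + t *\<^sub>R u) has_derivative (\<lambda>s. s *\<^sub>R u)) (at t)"
    by (auto intro!: derivative_eq_intros)
  from has_derivative_compose[OF this DG_deriv]
  have "((\<lambda>t. DG (x + t *\<^sub>R u)) has_derivative (\<lambda>s. s *\<^sub>R (D2 (x + t *\<^sub>R u) *v u))) (at t)"
    by (simp add: matrix_vector_mult_scaleR)
  from has_derivative_inner_left[OF this, of u] show ?thesis
    by (simp add: has_field_derivative_def mult_commute_abs inner_commute)
qed

lemma first_order:
  assumes "\<And>x y. norm (x - y) < d \<Longrightarrow> norm (DG x - DG y) \<le> e" "norm u < d"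
  shows "\<bar>G (x + u) - G x - DG x \<bullet> u\<bar> \<le> e * norm u"
proof -
  obtain t where t: "0 < t" "t < 1" "G (x + u) = G x + DG (x + t *\<^sub>R u) \<bullet> u"
    using MVT2[of 0 1 "\<lambda>t. G (x + t *\<^sub>R u)" "\<lambda>t. DG (x + t *\<^sub>R u) \<bullet> u"] G_line_deriv by fastforce
  have "norm (t *\<^sub>R u) \<le> norm u"
    using t by (simp add: mult_left_le_one_le)
  then have "norm (DG (x + t *\<^sub>R u) - DG x) \<le> e"
    using assms(2) by (intro assms(1)) simp
  have "\<bar>G (x + u) - G x - DG x \<bullet> u\<bar> = \<bar>(DG (x + t *\<^sub>R u) - DG x) \<bullet> u\<bar>"
    using t by (simp add: inner_diff_left)
  also have "\<dots> \<le> norm (DG (x + t *\<^sub>R u) - DG x) * norm u"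
    by (rule Cauchy_Schwarz_ineq2)
  also have "\<dots> \<le> e * norm u"
    by (intro mult_right_mono) (fact, simp)
  finally show ?thesis .
qed

text \<open>For \<open>norm u < d\<close> the modulus bounds the change of the second derivative by
  \<open>e\<close>. For larger \<open>u\<close> only the crude bound \<open>2 * B\<close> is
  available, and it is at most \<open>2 * B / d\<^sup>2 * (norm u)\<^sup>2\<close>. Large jumps are
  thus charged to the fourth power of the norm, whose mean is quadratic in the step length.\<close>

lemma second_order:
  assumes d: "0 < d" "\<And>x y. norm (x - y) < d \<Longrightarrow> norm (D2 x - D2 y) \<le> e" and e: "0 \<le> e"
  shows "\<bar>G (x + u) - G x - DG x \<bullet> u - 1/2 * (u \<bullet> (D2 x *v u))\<bar> \<le>
    1/2 * (e * (norm u)\<^sup>2 + 2 * B / d\<^sup>2 * norm u ^ 4)"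
proof -
  define D where "D m t = (if m = 0 then G (x + t *\<^sub>R u) else if m = 1 then DG (x + t *\<^sub>R u) \<bullet> u
      else u \<bullet> (D2 (x + t *\<^sub>R u) *v u))" for m :: nat and t
  have D_fun: "D 0 = (\<lambda>t. G (x + t *\<^sub>R u))" "D (Suc 0) = (\<lambda>t. DG (x + t *\<^sub>R u) \<bullet> u)"
    by (simp_all add: D_def fun_eq_iff)
  have "\<exists>t. 0 < t \<and> t < 1 \<and> G (x + 1 *\<^sub>R u) = (\<Sum>m<2. D m 0 / fact m * 1 ^ m) + D 2 t / fact 2 * 1 ^ 2"
  proof (rule Maclaurin[where f = "\<lambda>t. G (x + t *\<^sub>R u)"])
    show "\<forall>m t. m < 2 \<and> 0 \<le> t \<and> t \<le> 1 \<longrightarrow> DERIV (D m) t :> D (Suc m) t"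
    proof (intro allI impI)
      fix m :: nat and t :: real assume "m < 2 \<and> 0 \<le> t \<and> t \<le> (1 :: real)"
      then consider "m = 0" | "m = 1" by linarith
      then show "DERIV (D m) t :> D (Suc m) t"
        using G_line_deriv[of x u t] DG_line_deriv[of x u t] D_fun by cases (simp_all add: D_def)
    qed
  qed (auto simp: D_def)
  then obtain t where t: "0 < t" "t < 1"
    "G (x + u) = G x + DG x \<bullet> u + 1/2 * (u \<bullet> (D2 (x + t *\<^sub>R u) *v u))"
    by (auto simp: D_def numeral_2_eq_2)
  have "norm (D2 (x + t *\<^sub>R u) - D2 x) \<le> e + 2 * B / d\<^sup>2 * (norm u)\<^sup>2"
  proof (cases "norm u < d")
    case True
    have "norm (t *\<^sub>R u) \<le> norm u" using t by (simp add: mult_left_le_one_le)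
    then have "norm (D2 (x + t *\<^sub>R u) - D2 x) \<le> e" using True by (intro d(2)) simp
    moreover have "0 \<le> 2 * B / d\<^sup>2 * (norm u)\<^sup>2" using B_nonneg by simp
    ultimately show ?thesis by linarith
  next
    case False
    then have "d\<^sup>2 \<le> (norm u)\<^sup>2" using d(1) by (intro power_mono) auto
    then have "2 * B * 1 \<le> 2 * B * ((norm u)\<^sup>2 / d\<^sup>2)"
      using d(1) B_nonneg by (intro mult_left_mono) auto
    moreover have "norm (D2 (x + t *\<^sub>R u) - D2 x) \<le> 2 * B"
      using norm_triangle_ineq4[of "D2 (x + t *\<^sub>R u)" "D2 x"] bound(3)[of "x + t *\<^sub>R u"] bound(3)[of x] by linarith
    ultimately show ?thesis using e by simp
  qed
  note D2_le = this
  have "\<bar>G (x + u) - G x - DG x \<bullet> u - 1/2 * (u \<bullet> (D2 x *v u))\<bar> = 1/2 * \<bar>u \<bullet> ((D2 (x + t *\<^sub>R u) - D2 x) *v u)\<bar>"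
  proof -
    have "G (x + u) - G x - DG x \<bullet> u - 1/2 * (u \<bullet> (D2 x *v u)) = 1/2 * (u \<bullet> ((D2 (x + t *\<^sub>R u) - D2 x) *v u))"
      unfolding t(3) matrix_vector_mult_diff_rdistrib inner_diff_right by (simp add: diff_divide_distrib)
    then show ?thesis by (simp only: abs_mult)
  qed
  also have "\<bar>u \<bullet> ((D2 (x + t *\<^sub>R u) - D2 x) *v u)\<bar> \<le> norm u * norm ((D2 (x + t *\<^sub>R u) - D2 x) *v u)"
    by (rule Cauchy_Schwarz_ineq2)
  also have "\<dots> \<le> norm u * (norm (D2 (x + t *\<^sub>R u) - D2 x) * norm u)"
    by (intro mult_left_mono norm_matrix_vector_le) simp
  also have "\<dots> \<le> norm u * ((e + 2 * B / d\<^sup>2 * (norm u)\<^sup>2) * norm u)"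
    by (intro mult_left_mono mult_right_mono D2_le) auto
  also have "\<dots> = e * (norm u)\<^sup>2 + 2 * B / d\<^sup>2 * norm u ^ 4"
    by (simp add: algebra_simps power2_eq_square power4_eq_xxxx)
  finally show ?thesis by simp
qed

end

locale wiener_C2 = wiener_space P F W + C2_uniform G DG D2 B
  for P :: "'w measure" and F and W :: "real \<Rightarrow> 'w \<Rightarrow> real ^ 'd"
    and G :: "real ^ 'n \<Rightarrow> real" and DG D2 B
begin

text \<open>The coefficients are separate arguments because they are read off the solution while
  \<open>G\<close> is differentiated at the Euler sum, a different point.\<close>

definition generator :: "real ^ 'n \<Rightarrow> real ^ 'n \<Rightarrow> real ^ 'd ^ 'n \<Rightarrow> real" where
  "generator z \<beta> \<eta> = DG z \<bullet> \<beta> + 1/2 * trace (\<eta> ** transpose \<eta> ** D2 z)"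

text \<open>The step is split: the drift moves \<open>Z\<close> to a point that is still known at
  time \<open>s\<close>, and the noise is expanded to second order around that point. There the
  linear term has mean zero, the quadratic one becomes a trace, and the remainder is governed by
  second and fourth moments. Returning from the drifted point to \<open>Z\<close> costs a multiple
  of \<open>e\<close> only.\<close>

lemma one_step:
  fixes Z \<beta> :: "'w \<Rightarrow> real ^ 'n" and \<eta> :: "'w \<Rightarrow> real ^ 'd ^ 'n"
  assumes s: "0 \<le> s" "0 < \<Delta>"
    and meas [measurable]: "Z \<in> borel_measurable (F (ennreal s))" "\<beta> \<in> borel_measurable (F (ennreal s))"
      "\<eta> \<in> borel_measurable (F (ennreal s))"
    and C: "\<And>\<omega>. \<omega> \<in> space P \<Longrightarrow> norm (\<beta> \<omega>) \<le> C" "\<And>\<omega>. \<omega> \<in> space P \<Longrightarrow> norm (\<eta> \<omega>) \<le> C"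
    and d: "0 < d" "\<And>x y. norm (x - y) < d \<Longrightarrow> norm (DG x - DG y) \<le> e"
      "\<And>x y. norm (x - y) < d \<Longrightarrow> norm (D2 x - D2 y) \<le> e" and e: "0 \<le> e"
    and small: "\<Delta> * C < d"
  shows "expectation (\<lambda>\<omega>. G (Z \<omega> + \<Delta> *\<^sub>R \<beta> \<omega> + \<eta> \<omega> *v (W (s + \<Delta>) \<omega> - W s \<omega>))) \<le>
      expectation (\<lambda>\<omega>. G (Z \<omega>) + \<Delta> * generator (Z \<omega>) (\<beta> \<omega>) (\<eta> \<omega>)) +
      \<Delta> * (e * (C + real CARD('d) * C\<^sup>2 + real CARD('n) * C\<^sup>2) + 3 * B * C ^ 4 * (real CARD('d))\<^sup>2 / d\<^sup>2 * \<Delta>)"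
proof -
  let ?w = "\<lambda>\<omega>. W (s + \<Delta>) \<omega> - W s \<omega>"
  have st: "0 \<le> s" "s < s + \<Delta>" using s by auto
  have [measurable]: "W s \<in> borel_measurable P" "W (s + \<Delta>) \<in> borel_measurable P"
    using s by (auto intro: W_measurable)
  note [measurable] = meas[THEN F_measurable]
  obtain \<omega>0 where "\<omega>0 \<in> space P" using not_empty by auto
  then have C0: "0 \<le> C" using C(1)[of \<omega>0] norm_ge_zero[of "\<beta> \<omega>0"] by linarith
  let ?Z = "\<lambda>\<omega>. Z \<omega> + \<Delta> *\<^sub>R \<beta> \<omega>"
  let ?Q = "\<lambda>\<omega>. transpose (\<eta> \<omega>) ** D2 (?Z \<omega>) ** \<eta> \<omega>"
  have Q_eq: "(\<eta> \<omega> *v x) \<bullet> (D2 (?Z \<omega>) *v (\<eta> \<omega> *v x)) = x \<bullet> (?Q \<omega> *v x)" for \<omega> x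
  proof -
    have "?Q \<omega> *v x = (D2 (?Z \<omega>) *v (\<eta> \<omega> *v x)) v* \<eta> \<omega>"
      by (simp add: matrix_vector_mul_assoc[symmetric])
    then show ?thesis
      by (simp only: dot_lmul_matrix inner_commute[of x] inner_commute[of "\<eta> \<omega> *v x"])
  qed
  have Q_meas: "?Q \<in> borel_measurable (F (ennreal s))" by measurable
  have Q_bound: "norm (?Q \<omega>) \<le> C * B * C" if "\<omega> \<in> space P" for \<omega>
  proof -
    have "norm (?Q \<omega>) \<le> norm (transpose (\<eta> \<omega>) ** D2 (?Z \<omega>)) * norm (\<eta> \<omega>)"
      by (rule norm_matrix_mult_le)
    also have "\<dots> \<le> (norm (transpose (\<eta> \<omega>)) * norm (D2 (?Z \<omega>))) * norm (\<eta> \<omega>)"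
      by (intro mult_right_mono norm_matrix_mult_le) simp
    also have "\<dots> \<le> C * B * C"
      unfolding norm_transpose using C(2)[OF that] bound(3)[of "?Z \<omega>"] C0 B_nonneg
      by (intro mult_mono mult_nonneg_nonneg) auto
    finally show ?thesis .
  qed
  note quad = integrable_quadratic_increment[OF st Q_meas Q_bound] expectation_quadratic_increment[OF st Q_meas Q_bound]
  have DG_m: "(\<lambda>\<omega>. DG (?Z \<omega>)) \<in> borel_measurable (F (ennreal s))" by measurable
  note lin = integrable_cross_increment[OF st meas(3) DG_m C(2) bound(2)]
    expectation_cross_increment[OF st meas(3) DG_m C(2) bound(2)]
  note n2 = integrable_increment_norm2[OF st] expectation_increment_norm2[OF st]
  note n4 = integrable_increment_norm4[OF st] expectation_increment_norm4_le[OF st]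
  have gen_bound: "\<bar>generator (Z \<omega>) (\<beta> \<omega>) (\<eta> \<omega>)\<bar> \<le> B * C + 1/2 * (CARD('n) * (C\<^sup>2 * B))" if "\<omega> \<in> space P" for \<omega>
  proof -
    have "\<bar>DG (Z \<omega>) \<bullet> \<beta> \<omega>\<bar> \<le> norm (DG (Z \<omega>)) * norm (\<beta> \<omega>)"
      by (rule Cauchy_Schwarz_ineq2)
    also have "\<dots> \<le> B * C"
      using C(1)[OF that] bound(2) B_nonneg by (intro mult_mono) auto
    finally have 1: "\<bar>DG (Z \<omega>) \<bullet> \<beta> \<omega>\<bar> \<le> B * C" .
    have "\<bar>trace (\<eta> \<omega> ** transpose (\<eta> \<omega>) ** D2 (Z \<omega>))\<bar> \<le> CARD('n) * norm (\<eta> \<omega> ** transpose (\<eta> \<omega>) ** D2 (Z \<omega>))"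
      by (rule abs_trace_le)
    also have "\<dots> \<le> CARD('n) * (C\<^sup>2 * B)"
      using C(2)[OF that] bound(3) by (intro mult_left_mono norm_mult_transpose_le) auto
    finally show ?thesis using 1 unfolding generator_def by linarith
  qed
  have gen_meas: "(\<lambda>\<omega>. generator (Z \<omega>) (\<beta> \<omega>) (\<eta> \<omega>)) \<in> borel_measurable P"
    unfolding generator_def trace_def by measurable
  have gen_int: "integrable P (\<lambda>\<omega>. generator (Z \<omega>) (\<beta> \<omega>) (\<eta> \<omega>))"
    using gen_bound by (intro integrable_const_bound[of _ "B * C + 1/2 * (CARD('n) * (C\<^sup>2 * B))"] gen_meas AE_I2) simp
  have G_int: "integrable P (\<lambda>\<omega>. G (X \<omega>))" if [measurable]: "X \<in> borel_measurable P" for X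
    using bound(1) by (intro integrable_const_bound[of _ B] AE_I2) auto
  define R where "R \<omega> = 1/2 * (e * (C\<^sup>2 * (norm (?w \<omega>))\<^sup>2) + 2 * B / d\<^sup>2 * (C ^ 4 * norm (?w \<omega>) ^ 4))" for \<omega>
  have R_int: "integrable P R"
    unfolding R_def by (intro integrable_mult_right Bochner_Integration.integrable_add n2(1) n4(1))
  have ER: "expectation R \<le> 1/2 * (e * (C\<^sup>2 * (CARD('d) * \<Delta>)) + 2 * B / d\<^sup>2 * (C ^ 4 * (3 * (CARD('d))\<^sup>2 * \<Delta>\<^sup>2)))"
  proof -
    have "expectation R = 1/2 * (e * (C\<^sup>2 * expectation (\<lambda>\<omega>. (norm (?w \<omega>))\<^sup>2)) +
        2 * B / d\<^sup>2 * (C ^ 4 * expectation (\<lambda>\<omega>. norm (?w \<omega>) ^ 4)))"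
      unfolding R_def using n2(1) n4(1) by (simp only: integral_mult_right_zero Bochner_Integration.integral_add integrable_mult_right)
    also have "\<dots> \<le> 1/2 * (e * (C\<^sup>2 * (CARD('d) * \<Delta>)) + 2 * B / d\<^sup>2 * (C ^ 4 * (3 * (CARD('d))\<^sup>2 * \<Delta>\<^sup>2)))"
      using n2(2) n4(2) B_nonneg C0 e by (intro mult_left_mono add_mono) auto
    finally show ?thesis .
  qed
  have step: "G (?Z \<omega> + \<eta> \<omega> *v ?w \<omega>) \<le> G (?Z \<omega>) + DG (?Z \<omega>) \<bullet> (\<eta> \<omega> *v ?w \<omega>) +
      1/2 * (?w \<omega> \<bullet> (?Q \<omega> *v ?w \<omega>)) + R \<omega>" if "\<omega> \<in> space P" for \<omega>
  proof -
    let ?u = "\<eta> \<omega> *v ?w \<omega>"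
    have u: "norm ?u \<le> C * norm (?w \<omega>)"
      using norm_matrix_vector_le[of "\<eta> \<omega>" "?w \<omega>"] mult_right_mono[OF C(2)[OF that] norm_ge_zero[of "?w \<omega>"]] by linarith
    have "1/2 * (e * (norm ?u)\<^sup>2 + 2 * B / d\<^sup>2 * norm ?u ^ 4) \<le>
        1/2 * (e * (C * norm (?w \<omega>))\<^sup>2 + 2 * B / d\<^sup>2 * (C * norm (?w \<omega>)) ^ 4)"
      using u e B_nonneg by (intro mult_left_mono add_mono power_mono) auto
    also have "\<dots> = R \<omega>" by (simp add: R_def power_mult_distrib)
    finally show ?thesis
      using second_order[OF d(1,3) e, of "?Z \<omega>" ?u] unfolding Q_eq by linarith
  qed
  have E1: "expectation (\<lambda>\<omega>. G (?Z \<omega> + \<eta> \<omega> *v ?w \<omega>)) \<le>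
      expectation (\<lambda>\<omega>. G (?Z \<omega>)) + 1/2 * (\<Delta> * expectation (\<lambda>\<omega>. trace (?Q \<omega>))) + expectation R"
  proof -
    have "expectation (\<lambda>\<omega>. G (?Z \<omega> + \<eta> \<omega> *v ?w \<omega>)) \<le>
      expectation (\<lambda>\<omega>. G (?Z \<omega>) + DG (?Z \<omega>) \<bullet> (\<eta> \<omega> *v ?w \<omega>) + 1/2 * (?w \<omega> \<bullet> (?Q \<omega> *v ?w \<omega>)) + R \<omega>)"
      using lin(1) quad(1) R_int
      by (intro integral_mono step G_int Bochner_Integration.integrable_add integrable_mult_right) measurable
    also have "\<dots> = expectation (\<lambda>\<omega>. G (?Z \<omega>)) + expectation (\<lambda>\<omega>. DG (?Z \<omega>) \<bullet> (\<eta> \<omega> *v ?w \<omega>)) +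
        1/2 * expectation (\<lambda>\<omega>. ?w \<omega> \<bullet> (?Q \<omega> *v ?w \<omega>)) + expectation R"
    proof -
      have "integrable P (\<lambda>\<omega>. G (?Z \<omega>))" by (rule G_int) measurable
      then show ?thesis using lin(1) quad(1) R_int
        by (simp only: integral_mult_right_zero Bochner_Integration.integral_add integrable_mult_right
            Bochner_Integration.integrable_add)
    qed
    also have "\<dots> = expectation (\<lambda>\<omega>. G (?Z \<omega>)) + 1/2 * (\<Delta> * expectation (\<lambda>\<omega>. trace (?Q \<omega>))) + expectation R"
    proof -
      have "expectation (\<lambda>\<omega>. DG (?Z \<omega>) \<bullet> (\<eta> \<omega> *v ?w \<omega>)) = 0" by (rule lin(2))
      moreover have "expectation (\<lambda>\<omega>. ?w \<omega> \<bullet> (?Q \<omega> *v ?w \<omega>)) = \<Delta> * expectation (\<lambda>\<omega>. trace (?Q \<omega>))"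
        using quad(2) by simp
      ultimately show ?thesis by (simp only: add_0_right)
    qed
    finally show ?thesis .
  qed
  \<comment> \<open>The drift displacement has norm at most \<open>\<Delta> * C < d\<close>. Hence
    \<open>G\<close> may be expanded to first order along it, and the second derivative inside the
    trace may be moved back to \<open>Z\<close>, with error controlled by \<open>e\<close> in both
    places.\<close>
  have comp: "G (?Z \<omega>) + 1/2 * (\<Delta> * trace (?Q \<omega>)) \<le>
      G (Z \<omega>) + \<Delta> * generator (Z \<omega>) (\<beta> \<omega>) (\<eta> \<omega>) + \<Delta> * (e * C + 1/2 * (CARD('n) * (C\<^sup>2 * e)))" if "\<omega> \<in> space P" for \<omega>
  proof -
    have nb: "norm (\<Delta> *\<^sub>R \<beta> \<omega>) \<le> \<Delta> * C"
      using s C(1)[OF that] by simp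
    then have "\<bar>G (?Z \<omega>) - G (Z \<omega>) - DG (Z \<omega>) \<bullet> (\<Delta> *\<^sub>R \<beta> \<omega>)\<bar> \<le> e * norm (\<Delta> *\<^sub>R \<beta> \<omega>)"
      using small by (intro first_order[of d] d(2)) auto
    moreover have "e * norm (\<Delta> *\<^sub>R \<beta> \<omega>) \<le> e * (\<Delta> * C)"
      by (intro mult_left_mono nb e)
    ultimately have 1: "G (?Z \<omega>) \<le> G (Z \<omega>) + \<Delta> * (DG (Z \<omega>) \<bullet> \<beta> \<omega>) + \<Delta> * (e * C)"
      by (simp add: mult_ac)
    have D2e: "norm (D2 (?Z \<omega>) - D2 (Z \<omega>)) \<le> e"
      using nb small by (intro d(3)) simp
    have "trace (?Q \<omega>) - trace (\<eta> \<omega> ** transpose (\<eta> \<omega>) ** D2 (Z \<omega>)) =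
        trace (\<eta> \<omega> ** transpose (\<eta> \<omega>) ** (D2 (?Z \<omega>) - D2 (Z \<omega>)))"
      by (simp add: trace_sandwich matrix_mult_diff_distrib trace_diff)
    also have "\<dots> \<le> CARD('n) * norm (\<eta> \<omega> ** transpose (\<eta> \<omega>) ** (D2 (?Z \<omega>) - D2 (Z \<omega>)))"
      using abs_trace_le[of "\<eta> \<omega> ** transpose (\<eta> \<omega>) ** (D2 (?Z \<omega>) - D2 (Z \<omega>))"] by linarith
    also have "\<dots> \<le> CARD('n) * (C\<^sup>2 * e)"
      using C(2)[OF that] D2e by (intro mult_left_mono norm_mult_transpose_le) auto
    finally have "\<Delta> * trace (?Q \<omega>) \<le> \<Delta> * (trace (\<eta> \<omega> ** transpose (\<eta> \<omega>) ** D2 (Z \<omega>)) + CARD('n) * (C\<^sup>2 * e))"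
      using s by (intro mult_left_mono) auto
    then show ?thesis
      using 1 unfolding generator_def by (simp add: algebra_simps)
  qed
  have Q_int: "integrable P (\<lambda>\<omega>. trace (?Q \<omega>))"
  proof (rule integrable_const_bound)
    show "AE \<omega> in P. norm (trace (?Q \<omega>)) \<le> CARD('d) * (C * B * C)"
      using abs_trace_le[of "?Q _"] Q_bound
      by (intro AE_I2) (smt (verit) mult_left_mono of_nat_0_le_iff real_norm_def)
    have [measurable]: "?Q \<in> borel_measurable P" using Q_meas by (rule F_measurable)
    show "(\<lambda>\<omega>. trace (?Q \<omega>)) \<in> borel_measurable P"
      unfolding trace_def by measurable
  qed
  have E2: "expectation (\<lambda>\<omega>. G (?Z \<omega>)) + 1/2 * (\<Delta> * expectation (\<lambda>\<omega>. trace (?Q \<omega>))) \<le>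
      expectation (\<lambda>\<omega>. G (Z \<omega>) + \<Delta> * generator (Z \<omega>) (\<beta> \<omega>) (\<eta> \<omega>)) + \<Delta> * (e * C + 1/2 * (CARD('n) * (C\<^sup>2 * e)))"
  proof -
    have GZ: "integrable P (\<lambda>\<omega>. G (?Z \<omega>))" "integrable P (\<lambda>\<omega>. G (Z \<omega>))" by (rule G_int, measurable)+
    have "expectation (\<lambda>\<omega>. G (?Z \<omega>)) + 1/2 * (\<Delta> * expectation (\<lambda>\<omega>. trace (?Q \<omega>))) =
        expectation (\<lambda>\<omega>. G (?Z \<omega>) + 1/2 * (\<Delta> * trace (?Q \<omega>)))"
      using GZ Q_int by (simp only: integral_mult_right_zero Bochner_Integration.integral_add integrable_mult_right)
    also have "\<dots> \<le> expectation (\<lambda>\<omega>. G (Z \<omega>) + \<Delta> * generator (Z \<omega>) (\<beta> \<omega>) (\<eta> \<omega>) + \<Delta> * (e * C + 1/2 * (CARD('n) * (C\<^sup>2 * e))))"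
      using GZ Q_int gen_int
      by (intro integral_mono comp Bochner_Integration.integrable_add integrable_mult_right integrable_const)
    also have "\<dots> = expectation (\<lambda>\<omega>. G (Z \<omega>) + \<Delta> * generator (Z \<omega>) (\<beta> \<omega>) (\<eta> \<omega>)) + \<Delta> * (e * C + 1/2 * (CARD('n) * (C\<^sup>2 * e)))"
      using GZ gen_int
      by (subst Bochner_Integration.integral_add)
        (auto intro!: Bochner_Integration.integrable_add integrable_mult_right simp: prob_space)
    finally show ?thesis .
  qed
  \<comment> \<open>The factors 1/2 of the two terms with \<open>e\<close> and
    \<open>C\<^sup>2\<close> are given away for a simpler bound.\<close>
  have "1/2 * (e * (C\<^sup>2 * (CARD('d) * \<Delta>)) + 2 * B / d\<^sup>2 * (C ^ 4 * (3 * (CARD('d))\<^sup>2 * \<Delta>\<^sup>2))) +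
      \<Delta> * (e * C + 1/2 * (CARD('n) * (C\<^sup>2 * e))) \<le>
      \<Delta> * (e * (C + real CARD('d) * C\<^sup>2 + real CARD('n) * C\<^sup>2) + 3 * B * C ^ 4 * (real CARD('d))\<^sup>2 / d\<^sup>2 * \<Delta>)"
  proof -
    have "0 \<le> e * (C\<^sup>2 * (CARD('d) * \<Delta>))" "0 \<le> \<Delta> * (CARD('n) * (C\<^sup>2 * e))"
      using e s by auto
    then show ?thesis by (simp add: algebra_simps power2_eq_square)
  qed
  then show ?thesis using E1 E2 ER by linarith
qed

end

section \<open>The truncated barrier function\<close>

definition outer :: "real ^ 'n \<Rightarrow> real ^ 'n ^ 'n" where
  "outer a = (\<chi> i j. a $ i * a $ j)"

lemma outer_mult_vec: "outer a *v v = (a \<bullet> v) *\<^sub>R a"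
  by (simp add: outer_def matrix_vector_mult_def inner_vec_def vec_eq_iff sum_distrib_left mult_ac)

text \<open>The trace is the squared norm of \<open>transpose \<eta> *v a\<close>. Its sign is what
  makes a concave outer function harmless in the differential inequality.\<close>

lemma trace_outer_nonneg: "0 \<le> trace (\<eta> ** transpose \<eta> ** outer a)"
  for \<eta> :: "real ^ 'd ^ 'n"
proof -
  have "transpose \<eta> ** outer a ** \<eta> = outer (transpose \<eta> *v a)"
    by (simp add: outer_def matrix_matrix_mult_def matrix_vector_mult_def transpose_def vec_eq_iff
        sum_distrib_left sum_distrib_right mult_ac)
  then have "trace (\<eta> ** transpose \<eta> ** outer a) = trace (outer (transpose \<eta> *v a))"
    by (simp flip: trace_sandwich)
  also have "0 \<le> \<dots>" by (simp add: trace_def outer_def sum_nonneg)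
  finally show ?thesis .
qed

text \<open>As \<open>\<eta> ** transpose \<eta>\<close> is symmetric, the trace takes the same
  value for a matrix and its transpose. This reconciles the Jacobian of the gradient with
  \<open>hessian\<close>, which is its transpose.\<close>

lemma trace_mult_transpose_right:
  "trace (\<eta> ** transpose \<eta> ** transpose A) = trace (\<eta> ** transpose \<eta> ** A)"
  for \<eta> :: "real ^ 'd ^ 'n" and A :: "real ^ 'n ^ 'n"
proof -
  have "trace (\<eta> ** transpose \<eta> ** transpose A) = trace (transpose (\<eta> ** transpose \<eta> ** transpose A))"
    by (simp add: trace_def transpose_def[of "\<eta> ** transpose \<eta> ** transpose A"])
  also have "\<dots> = trace (A ** (\<eta> ** transpose \<eta>))"
    by (simp add: matrix_transpose_mul)
  also have "\<dots> = trace (\<eta> ** transpose \<eta> ** A)" by (rule trace_mul_sym)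
  finally show ?thesis .
qed

text \<open>A working form of \<open>C2_on\<close>: gradient and Jacobian of the gradient are named
  functions, so the chain rule and gluing act on formulas instead of on
  \<open>frechet_derivative\<close>.\<close>

definition has_C2 ::
  "(real ^ 'n) set \<Rightarrow> (real ^ 'n \<Rightarrow> real) \<Rightarrow> (real ^ 'n \<Rightarrow> real ^ 'n) \<Rightarrow> (real ^ 'n \<Rightarrow> real ^ 'n ^ 'n) \<Rightarrow> bool"
where
  "has_C2 S y Dy D2y \<longleftrightarrow>
     (\<forall>x\<in>S. (y has_derivative (\<lambda>v. Dy x \<bullet> v)) (at x)) \<and>
     (\<forall>x\<in>S. (Dy has_derivative (\<lambda>v. D2y x *v v)) (at x)) \<and>
     continuous_on S D2y"

definition grad :: "(real ^ 'n \<Rightarrow> real) \<Rightarrow> real ^ 'n \<Rightarrow> real ^ 'n" where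
  "grad y x = (\<chi> j. frechet_derivative y (at x) (axis j 1))"

lemma linear_axis_expansion:
  fixes f :: "real ^ 'n \<Rightarrow> real"
  assumes "linear f"
  shows "f v = (\<chi> j. f (axis j 1)) \<bullet> v"
proof -
  have "f v = f (\<Sum>i\<in>UNIV. v $ i *\<^sub>R axis i 1)"
    using basis_expansion[of v] by (simp add: scalar_mult_eq_scaleR)
  also have "\<dots> = (\<Sum>i\<in>UNIV. v $ i * f (axis i 1))"
    by (simp add: linear_sum[OF assms] linear_scale[OF assms])
  finally show ?thesis by (simp add: inner_vec_def mult.commute)
qed

text \<open>The transpose reflects the order of indices: entry \<open>(i, j)\<close> of
  \<open>hessian\<close> is the derivative in direction \<open>i\<close> of the \<open>j\<close>-th
  partial derivative, which in the Jacobian of the gradient stands in row \<open>j\<close> and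
  column \<open>i\<close>.\<close>

lemma C2_on_imp_has_C2:
  fixes y :: "real ^ 'n \<Rightarrow> real"
  assumes "C2_on S y"
  shows "has_C2 S y (grad y) (\<lambda>x. transpose (hessian y x))"
  unfolding has_C2_def
proof (intro conjI ballI)
  let ?D = "\<lambda>j z. frechet_derivative y (at z) (axis j 1)"
  fix x assume x: "x \<in> S"
  have d: "y differentiable (at x)" and d2: "\<And>v. (\<lambda>z. frechet_derivative y (at z) v) differentiable (at x)"
    using assms x by (auto simp: C2_on_def)
  have "linear (frechet_derivative y (at x))"
    using d frechet_derivative_works has_derivative_linear by blast
  then have "frechet_derivative y (at x) = (\<lambda>v. grad y x \<bullet> v)"
    unfolding grad_def by (intro ext linear_axis_expansion)
  then show "(y has_derivative (\<lambda>v. grad y x \<bullet> v)) (at x)"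
    using d frechet_derivative_works by metis
  have "(?D j has_derivative (\<lambda>v. (transpose (hessian y x) *v v) $ j)) (at x)" for j
  proof -
    have der: "(?D j has_derivative frechet_derivative (?D j) (at x)) (at x)"
      using d2[of "axis j 1"] frechet_derivative_works by blast
    have "frechet_derivative (?D j) (at x) v = (transpose (hessian y x) *v v) $ j" for v
      unfolding linear_axis_expansion[OF has_derivative_linear[OF der], of v]
      by (simp add: matrix_vector_mul_component transpose_def hessian_def inner_vec_def)
    then have "frechet_derivative (?D j) (at x) = (\<lambda>v. (transpose (hessian y x) *v v) $ j)" by blast
    then show ?thesis using der by metis
  qed
  then have "((\<lambda>z. grad y z $ j) has_derivative (\<lambda>v. (transpose (hessian y x) *v v) $ j)) (at x)" for j
    by (simp add: grad_def)
  then show "(grad y has_derivative (\<lambda>v. transpose (hessian y x) *v v)) (at x)"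
    unfolding has_derivative_componentwise_within[of "grad y"]
    by (auto simp: Basis_vec_def inner_axis)
next
  have "continuous_on S (\<lambda>x. frechet_derivative (\<lambda>z. frechet_derivative y (at z) v) (at x) w)" for v w
    using assms by (auto simp: C2_on_def)
  then show "continuous_on S (\<lambda>x. transpose (hessian y x))"
    unfolding transpose_def hessian_def
    by (auto intro!: continuous_on_vec_lambda)
qed

lemma has_C2_frechet_derivative:
  assumes "has_C2 S y Dy D2y" "x \<in> S"
  shows "frechet_derivative y (at x) = (\<lambda>v. Dy x \<bullet> v)"
  using assms frechet_derivative_at[of y "\<lambda>v. Dy x \<bullet> v" x] by (auto simp: has_C2_def)

text \<open>Openness makes the gradient formula valid at all points near \<open>x\<close>, so that
  it can be differentiated once more there.\<close>

lemma has_C2_second_frechet_derivative: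
  fixes y :: "real ^ 'n \<Rightarrow> real"
  assumes "open S" "has_C2 S y Dy D2y" "x \<in> S"
  shows "((\<lambda>z. frechet_derivative y (at z) v) has_derivative (\<lambda>w. (D2y x *v w) \<bullet> v)) (at x)"
proof -
  have "((\<lambda>z. Dy z \<bullet> v) has_derivative (\<lambda>w. (D2y x *v w) \<bullet> v)) (at x)"
    using assms by (intro has_derivative_inner_left) (auto simp: has_C2_def)
  then show ?thesis
    using assms(1,3) by (rule has_derivative_transform_within_open)
      (simp add: has_C2_frechet_derivative[OF assms(2)])
qed

lemma has_C2_imp_C2_on:
  fixes y :: "real ^ 'n \<Rightarrow> real"
  assumes "open S" "has_C2 S y Dy D2y"
  shows "C2_on S y"
  unfolding C2_on_def
proof (intro conjI ballI allI)
  fix x assume x: "x \<in> S"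
  show "y differentiable (at x)"
    using assms x by (auto simp: has_C2_def differentiable_def)
  show "(\<lambda>z. frechet_derivative y (at z) v) differentiable (at x)" for v
    using has_C2_second_frechet_derivative[OF assms x] by (auto simp: differentiable_def)
next
  fix v w
  have "frechet_derivative (\<lambda>z. frechet_derivative y (at z) v) (at x) w = (D2y x *v w) \<bullet> v" if "x \<in> S" for x
    using frechet_derivative_at[OF has_C2_second_frechet_derivative[OF assms that, of v]] by metis
  moreover have "continuous_on S (\<lambda>x. (D2y x *v w) \<bullet> v)"
  proof -
    have "continuous_on S D2y" using assms by (simp add: has_C2_def)
    then show ?thesis unfolding matrix_vector_mult_def
      by (auto intro!: continuous_intros)
  qed
  ultimately show "continuous_on S (\<lambda>x. frechet_derivative (\<lambda>z. frechet_derivative y (at z) v) (at x) w)"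
    by (simp cong: continuous_on_cong)
qed

lemma has_C2_hessian:
  fixes y :: "real ^ 'n \<Rightarrow> real"
  assumes "open S" "has_C2 S y Dy D2y" "x \<in> S"
  shows "hessian y x = transpose (D2y x)"
proof -
  have "frechet_derivative (\<lambda>z. frechet_derivative y (at z) v) (at x) w = (D2y x *v w) \<bullet> v" for v w
    using frechet_derivative_at[OF has_C2_second_frechet_derivative[OF assms, of v]] by metis
  then show ?thesis
    by (simp add: hessian_def transpose_def vec_eq_iff inner_axis matrix_vector_mul_component)
qed

lemma has_C2_compose:
  fixes y :: "real ^ 'n \<Rightarrow> real"
  assumes y: "has_C2 S y Dy D2y"
    and r: "\<And>x. x \<in> S \<Longrightarrow> (r has_real_derivative r' (y x)) (at (y x))"
    and r': "\<And>x. x \<in> S \<Longrightarrow> (r' has_real_derivative r'' (y x)) (at (y x))"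
    and r'': "continuous_on (y ` S) r''"
  shows "has_C2 S (\<lambda>x. r (y x)) (\<lambda>x. r' (y x) *\<^sub>R Dy x)
    (\<lambda>x. r' (y x) *\<^sub>R D2y x + r'' (y x) *\<^sub>R outer (Dy x))"
  unfolding has_C2_def
proof (intro conjI ballI)
  fix x assume x: "x \<in> S"
  have dy: "(y has_derivative (\<lambda>v. Dy x \<bullet> v)) (at x)" and dDy: "(Dy has_derivative (\<lambda>v. D2y x *v v)) (at x)"
    using y x by (auto simp: has_C2_def)
  show "((\<lambda>x. r (y x)) has_derivative (\<lambda>v. (r' (y x) *\<^sub>R Dy x) \<bullet> v)) (at x)"
    using has_derivative_compose[OF dy, of r "(*) (r' (y x))"] r[OF x] by (simp add: has_field_derivative_def)
  have "((\<lambda>x. r' (y x)) has_derivative (\<lambda>v. r'' (y x) * (Dy x \<bullet> v))) (at x)"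
    using has_derivative_compose[OF dy, of r' "(*) (r'' (y x))"] r'[OF x] by (simp add: has_field_derivative_def)
  from has_derivative_scaleR[OF this dDy]
  show "((\<lambda>x. r' (y x) *\<^sub>R Dy x) has_derivative
      (\<lambda>v. (r' (y x) *\<^sub>R D2y x + r'' (y x) *\<^sub>R outer (Dy x)) *v v)) (at x)"
    by (simp add: matrix_vector_mult_add_rdistrib scaleR_matrix_vector_assoc[symmetric] outer_mult_vec)
next
  have cy: "continuous_on S y" "continuous_on S Dy" "continuous_on S D2y"
    using y has_derivative_continuous_on[of S y "\<lambda>x v. Dy x \<bullet> v"] has_derivative_continuous_on[of S Dy "\<lambda>x v. D2y x *v v"]
    unfolding has_C2_def by (blast intro: has_derivative_at_withinI)+
  have cr'': "continuous_on S (\<lambda>x. r'' (y x))"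
    using continuous_on_compose2[OF r'' cy(1)] by simp
  have "continuous_on (y ` S) r'"
    by (intro continuous_at_imp_continuous_on) (auto intro: DERIV_isCont r')
  then have cr': "continuous_on S (\<lambda>x. r' (y x))"
    using continuous_on_compose2[OF _ cy(1), of "y ` S" r'] by simp
  have "continuous_on S (\<lambda>x. outer (Dy x))"
    unfolding outer_def using cy(2) by (intro continuous_intros)
  then show "continuous_on S (\<lambda>x. r' (y x) *\<^sub>R D2y x + r'' (y x) *\<^sub>R outer (Dy x))"
    using cr' cr'' cy by (intro continuous_intros)
qed

text \<open>At the kink, Caratheodory's criterion applies with slope function
  \<open>max 0 z ^ Suc n\<close>, which is continuous and vanishes at 0 since its exponent is
  positive. Used for the powers 3 and 2, this gives the two derivatives of the truncation.\<close>

lemma has_real_derivative_max0_power: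
  "((\<lambda>x :: real. max 0 x ^ Suc (Suc n)) has_real_derivative real (Suc (Suc n)) * max 0 x ^ Suc n) (at x)"
proof -
  consider "x < 0" | "x = 0" | "0 < x" by linarith
  then show ?thesis
  proof cases
    case 1
    have "((\<lambda>x :: real. 0) has_real_derivative 0) (at x)" by simp
    then have "((\<lambda>x :: real. max 0 x ^ Suc (Suc n)) has_real_derivative 0) (at x)"
      using open_lessThan[of "0 :: real"] by (rule has_field_derivative_transform_within_open) (use 1 in auto)
    then show ?thesis using 1 by simp
  next
    case 2
    have "isCont (\<lambda>z :: real. max 0 z ^ Suc n) 0" by (intro continuous_intros)
    moreover have "max 0 z ^ Suc (Suc n) = max 0 z ^ Suc n * z" for z :: real by (cases "0 \<le> z") auto
    ultimately have "((\<lambda>x :: real. max 0 x ^ Suc (Suc n)) has_real_derivative 0) (at 0)"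
      unfolding CARAT_DERIV by (intro exI[of _ "\<lambda>z. max 0 z ^ Suc n"]) auto
    then show ?thesis using 2 by simp
  next
    case 3
    have "((\<lambda>x :: real. x ^ Suc (Suc n)) has_real_derivative real (Suc (Suc n)) * x ^ Suc n) (at x)"
      using DERIV_pow[of "Suc (Suc n)" x UNIV] by (simp only: diff_Suc_Suc diff_zero)
    then have "((\<lambda>x :: real. max 0 x ^ Suc (Suc n)) has_real_derivative real (Suc (Suc n)) * x ^ Suc n) (at x)"
      using open_greaterThan[of "0 :: real"] by (rule has_field_derivative_transform_within_open) (use 3 in auto)
    then show ?thesis using 3 by simp
  qed
qed

text \<open>For the second claim, \<open>K\<close> lies in a ball of radius \<open>r\<close>, and
  \<open>f\<close> is uniformly continuous on the ball of radius \<open>r + 1\<close>. Two points at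
  distance below 1 either both lie in the larger ball or both lie outside \<open>K\<close>, where
  \<open>f\<close> vanishes.\<close>

lemma continuous_compact_support:
  fixes f :: "'a :: euclidean_space \<Rightarrow> 'b :: real_normed_vector"
  assumes f: "continuous_on UNIV f" and K: "compact K" and zero: "\<And>x. x \<notin> K \<Longrightarrow> f x = 0"
  shows "\<exists>B. \<forall>x. norm (f x) \<le> B"
    and "0 < e \<Longrightarrow> \<exists>d>0. \<forall>x y. norm (x - y) < d \<longrightarrow> norm (f x - f y) \<le> e"
proof -
  have fK: "continuous_on A f" for A using f continuous_on_subset by blast
  have "bounded (f ` K)" by (intro compact_imp_bounded compact_continuous_image fK K)
  then obtain B where "\<And>x. x \<in> K \<Longrightarrow> norm (f x) \<le> B" by (auto simp: bounded_iff)
  then have "norm (f x) \<le> max B 0" for x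
    using zero[of x] by (cases "x \<in> K") (auto simp: le_max_iff_disj)
  then show "\<exists>B. \<forall>x. norm (f x) \<le> B" by blast
  obtain r where "\<forall>x\<in>K. norm x \<le> r"
    using compact_imp_bounded[OF K] by (auto simp: bounded_iff)
  then have r: "K \<subseteq> cball 0 r" by auto
  assume "0 < e"
  moreover have "uniformly_continuous_on (cball 0 (r + 1)) f"
    by (intro compact_uniformly_continuous fK) simp
  ultimately obtain d where d: "0 < d" "\<And>x y. x \<in> cball 0 (r + 1) \<Longrightarrow> y \<in> cball 0 (r + 1) \<Longrightarrow> dist y x < d \<Longrightarrow> dist (f y) (f x) < e"
    unfolding uniformly_continuous_on_def by blast
  show "\<exists>d>0. \<forall>x y. norm (x - y) < d \<longrightarrow> norm (f x - f y) \<le> e"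
  proof (intro exI[of _ "min d 1"] conjI allI impI)
    show "0 < min d 1" using d(1) by simp
    fix x y :: 'a assume xy: "norm (x - y) < min d 1"
    show "norm (f x - f y) \<le> e"
    proof (cases "norm x \<le> r \<or> norm y \<le> r")
      case True
      have "norm x \<le> norm y + norm (x - y)" "norm y \<le> norm x + norm (x - y)"
        using norm_triangle_sub[of x y] norm_triangle_sub[of y x] by (simp_all add: norm_minus_commute)
      then have "dist (f x) (f y) < e" using True xy by (intro d(2)) (auto simp: dist_norm)
      then show ?thesis by (simp add: dist_norm)
    next
      case False
      then have "x \<notin> K" "y \<notin> K" using r by auto
      then show ?thesis using zero \<open>0 < e\<close> by simp
    qed
  qed
qed

text \<open>The truncation \<open>trunc c v\<close>, equal to \<open>c\<^sup>3\<close> for \<open>v \<ge> c\<close>, is concave and vanishes at \<open>0\<close>, so that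
  composing with it preserves the differential inequality \<open>L V \<le> \<gamma> V\<close>.\<close>

definition trunc :: "real \<Rightarrow> real \<Rightarrow> real" where
  "trunc c v = c ^ 3 - max 0 (c - v) ^ 3"

definition trunc' :: "real \<Rightarrow> real \<Rightarrow> real" where
  "trunc' c v = 3 * max 0 (c - v) ^ 2"

definition trunc'' :: "real \<Rightarrow> real \<Rightarrow> real" where
  "trunc'' c v = - 6 * max 0 (c - v)"

lemma trunc_deriv: "(trunc c has_real_derivative trunc' c v) (at v)"
  and trunc'_deriv: "(trunc' c has_real_derivative trunc'' c v) (at v)"
proof -
  have inner: "((\<lambda>v. c - v) has_real_derivative - 1) (at v)"
    by (auto intro!: derivative_eq_intros)
  have chain: "((\<lambda>v. max 0 (c - v) ^ Suc (Suc n)) has_real_derivative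
      (real (Suc (Suc n)) * max 0 (c - v) ^ Suc n) * - 1) (at v)" for n
    by (rule DERIV_chain2[where f = "\<lambda>x. max 0 x ^ Suc (Suc n)" and g = "\<lambda>v. c - v",
        OF has_real_derivative_max0_power inner])
  show "(trunc c has_real_derivative trunc' c v) (at v)"
    using DERIV_diff[OF DERIV_const[of "c ^ 3"] chain[of 1]]
    by (simp add: trunc_def[abs_def] trunc'_def numeral_3_eq_3 numeral_2_eq_2)
  show "(trunc' c has_real_derivative trunc'' c v) (at v)"
    using DERIV_cmult[OF chain[of 0], of 3]
    by (simp add: trunc'_def[abs_def] trunc''_def numeral_2_eq_2)
qed

text \<open>The third and fourth bounds express concavity together with the value 0 at 0: the
  tangent at \<open>v\<close> is compared with the function at 0, and the tangent at 0 with the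
  function at \<open>v\<close>. The third is what turns \<open>\<gamma> * v\<close> into
  \<open>\<gamma> * trunc c v\<close>; the fourth yields the factor 3 in the final estimate.\<close>

lemma trunc_bounds:
  assumes "0 \<le> c" "0 \<le> v"
  shows "0 \<le> trunc c v" "trunc c v \<le> c ^ 3" "v * trunc' c v \<le> trunc c v" "trunc c v \<le> 3 * c\<^sup>2 * v"
    "0 \<le> trunc' c v" "trunc'' c v \<le> 0"
proof -
  let ?m = "max 0 (c - v)"
  show "0 \<le> trunc c v" "trunc c v \<le> c ^ 3"
    using assms unfolding trunc_def by (auto intro: power_mono)
  show "0 \<le> trunc' c v" "trunc'' c v \<le> 0" by (auto simp: trunc'_def trunc''_def)
  show "v * trunc' c v \<le> trunc c v"
  proof (cases "v \<le> c")
    case True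
    have "trunc c v - v * trunc' c v = v\<^sup>2 * (v + 3 * (c - v))"
      using True by (simp add: trunc_def trunc'_def algebra_simps power2_eq_square power3_eq_cube)
    also have "\<dots> \<ge> 0" using True assms by simp
    finally show ?thesis by simp
  qed (use assms in \<open>simp add: trunc_def trunc'_def\<close>)
  show "trunc c v \<le> 3 * c\<^sup>2 * v"
  proof (cases "v \<le> c")
    case True
    have "3 * c\<^sup>2 * v - trunc c v = v\<^sup>2 * (2 * c + (c - v))"
      using True by (simp add: trunc_def algebra_simps power2_eq_square power3_eq_cube)
    also have "\<dots> \<ge> 0" using True assms by simp
    finally show ?thesis by simp
  next
    case False
    have "c\<^sup>2 * c \<le> c\<^sup>2 * (3 * v)" using False assms by (intro mult_left_mono) auto
    then show ?thesis using False by (simp add: trunc_def power2_eq_square power3_eq_cube mult_ac)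
  qed
qed

text \<open>The open set \<open>S\<close> and the complement of the compact sublevel set cover the
  space; on the second set the function is constantly \<open>c ^ 3\<close>, and the formulas agree
  on the overlap. So \<open>G - c ^ 3\<close> and both derivatives are continuous with compact
  support, which gives the bounds and the moduli.\<close>

lemma C2_uniform_trunc:
  fixes V :: "real ^ 'n \<Rightarrow> real"
  assumes S: "open S" and V: "has_C2 S V DV D2V" and K: "compact {x \<in> S. V x \<le> c}"
  shows "\<exists>B. C2_uniform (\<lambda>x. if x \<in> S then trunc c (V x) else c ^ 3)
    (\<lambda>x. if x \<in> S then trunc' c (V x) *\<^sub>R DV x else 0)
    (\<lambda>x. if x \<in> S then trunc' c (V x) *\<^sub>R D2V x + trunc'' c (V x) *\<^sub>R outer (DV x) else 0) B"
proof -
  let ?K = "{x \<in> S. V x \<le> c}"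
  let ?G = "\<lambda>x. if x \<in> S then trunc c (V x) else c ^ 3"
  let ?D = "\<lambda>x. if x \<in> S then trunc' c (V x) *\<^sub>R DV x else 0"
  let ?D2 = "\<lambda>x. if x \<in> S then trunc' c (V x) *\<^sub>R D2V x + trunc'' c (V x) *\<^sub>R outer (DV x) else 0"
  have C2: "has_C2 S (\<lambda>x. trunc c (V x)) (\<lambda>x. trunc' c (V x) *\<^sub>R DV x)
      (\<lambda>x. trunc' c (V x) *\<^sub>R D2V x + trunc'' c (V x) *\<^sub>R outer (DV x))"
    by (rule has_C2_compose[OF V trunc_deriv trunc'_deriv])
      (auto simp: trunc''_def intro!: continuous_intros)
  have out: "?G x = c ^ 3" "?D x = 0" "?D2 x = 0" if "x \<notin> ?K" for x
    using that by (auto simp: trunc_def trunc'_def trunc''_def)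
  have opK: "open (- ?K)" using compact_imp_closed[OF K] by (simp add: open_Compl)
  have SK: "x \<in> S \<or> x \<in> - ?K" for x by auto
  have der: "(?G has_derivative (\<lambda>v. ?D x \<bullet> v)) (at x)" for x
    using SK[of x]
  proof
    assume x: "x \<in> S"
    have "((\<lambda>x. trunc c (V x)) has_derivative (\<lambda>v. ?D x \<bullet> v)) (at x)"
      using C2 x by (auto simp: has_C2_def)
    then show ?thesis using S x by (rule has_derivative_transform_within_open) simp
  next
    assume x: "x \<in> - ?K"
    have "((\<lambda>x. c ^ 3) has_derivative (\<lambda>v. ?D x \<bullet> v)) (at x)"
      using out(2)[of x] x by (simp del: mem_Collect_eq)
    then show ?thesis using opK x by (rule has_derivative_transform_within_open) (rule out(1)[symmetric], simp)
  qed
  have der2: "(?D has_derivative (\<lambda>v. ?D2 x *v v)) (at x)" for x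
    using SK[of x]
  proof
    assume x: "x \<in> S"
    have "((\<lambda>x. trunc' c (V x) *\<^sub>R DV x) has_derivative (\<lambda>v. ?D2 x *v v)) (at x)"
      using C2 x by (auto simp: has_C2_def)
    then show ?thesis using S x by (rule has_derivative_transform_within_open) simp
  next
    assume x: "x \<in> - ?K"
    have "((\<lambda>x. 0) has_derivative (\<lambda>v. ?D2 x *v v)) (at x)"
      using out(3)[of x] x by (simp del: mem_Collect_eq)
    then show ?thesis using opK x by (rule has_derivative_transform_within_open) (rule out(2)[symmetric], simp)
  qed
  have "continuous_on S ?D2"
    using C2 by (auto simp: has_C2_def cong: continuous_on_cong)
  moreover have "continuous_on (- ?K) ?D2"
    by (subst continuous_on_cong[OF refl, of _ _ "\<lambda>_. 0"]) (rule out(3), simp, simp)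
  ultimately have "continuous_on (S \<union> - ?K) ?D2" by (intro continuous_on_open_Un S opK)
  moreover have "S \<union> - ?K = UNIV" by auto
  ultimately have c2: "continuous_on UNIV ?D2" by simp
  have c1: "continuous_on UNIV ?D"
    by (rule has_derivative_continuous_on[of UNIV ?D "\<lambda>x v. ?D2 x *v v"]) (use der2 in simp)
  have c0: "continuous_on UNIV (\<lambda>x. ?G x - c ^ 3)"
    by (intro continuous_on_diff continuous_on_const has_derivative_continuous_on[of UNIV ?G "\<lambda>x v. ?D x \<bullet> v"])
      (use der in simp)
  have out0: "?G x - c ^ 3 = 0" if "x \<notin> ?K" for x
    unfolding out(1)[OF that] by simp
  note cs0 = continuous_compact_support[OF c0 K out0] and cs1 = continuous_compact_support[OF c1 K out(2)]
    and cs2 = continuous_compact_support[OF c2 K out(3)]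
  obtain B0 where B0: "\<forall>x. norm (?G x - c ^ 3) \<le> B0" using cs0(1) by (rule exE)
  obtain B1 where B1: "\<forall>x. norm (?D x) \<le> B1" using cs1(1) by (rule exE)
  obtain B2 where B2: "\<forall>x. norm (?D2 x) \<le> B2" using cs2(1) by (rule exE)
  note B = B0[rule_format] B1[rule_format] B2[rule_format]
  let ?B = "max (B0 + \<bar>c ^ 3\<bar>) (max B1 B2)"
  have "C2_uniform ?G ?D ?D2 ?B"
  proof
    fix x
    show "(?G has_derivative (\<lambda>v. ?D x \<bullet> v)) (at x)" by (rule der)
    show "(?D has_derivative (\<lambda>v. ?D2 x *v v)) (at x)" by (rule der2)
    have "\<bar>?G x\<bar> \<le> B0 + \<bar>c ^ 3\<bar>" using B(1)[of x] unfolding real_norm_def by linarith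
    then show "\<bar>?G x\<bar> \<le> ?B" by simp
    show "norm (?D x) \<le> ?B" using B(2)[of x] by linarith
    show "norm (?D2 x) \<le> ?B" using B(3)[of x] by linarith
  next
    fix e :: real assume e: "0 < e"
    obtain d0 where d0: "0 < d0" "\<And>x y. norm (x - y) < d0 \<Longrightarrow> norm ((?G x - c ^ 3) - (?G y - c ^ 3)) \<le> e"
      using cs0(2)[OF _ e] by blast
    obtain d1 where d1: "0 < d1" "\<And>x y. norm (x - y) < d1 \<Longrightarrow> norm (?D x - ?D y) \<le> e"
      using cs1(2)[OF _ e] by blast
    obtain d2 where d2: "0 < d2" "\<And>x y. norm (x - y) < d2 \<Longrightarrow> norm (?D2 x - ?D2 y) \<le> e"
      using cs2(2)[OF _ e] by blast
    show "\<exists>d>0. \<forall>x y. norm (x - y) < d \<longrightarrow> \<bar>?G x - ?G y\<bar> \<le> e \<and> norm (?D x - ?D y) \<le> e \<and> norm (?D2 x - ?D2 y) \<le> e"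
    proof (intro exI[of _ "min d0 (min d1 d2)"] conjI allI impI)
      show "0 < min d0 (min d1 d2)" using d0 d1 d2 by simp
      fix x y :: "real ^ 'n" assume xy: "norm (x - y) < min d0 (min d1 d2)"
      have "\<bar>(?G x - c ^ 3) - (?G y - c ^ 3)\<bar> \<le> e" using d0(2)[of x y] xy unfolding real_norm_def by linarith
      then show "\<bar>?G x - ?G y\<bar> \<le> e" by linarith
      show "norm (?D x - ?D y) \<le> e" by (rule d1(2)) (use xy in linarith)
      show "norm (?D2 x - ?D2 y) \<le> e" by (rule d2(2)) (use xy in linarith)
    qed
  qed
  then show ?thesis by blast
qed

section \<open>From the barrier condition to a differential inequality for the truncated
  function\<close>

lemma gen_drift_eq:
  assumes "linear (frechet_derivative y (at x))"
  shows "gen_drift f g (\<phi> x) uo y x = frechet_derivative y (at x) (closed_loop_drift f g uo \<phi> x)"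
proof -
  let ?D = "frechet_derivative y (at x)"
  let ?u = "\<phi> x + uo x"
  have "lie_mat g y x \<bullet> ?u = (\<Sum>j\<in>UNIV. ?u $ j * ?D (column j (g x)))"
    by (simp add: lie_mat_def inner_vec_def mult.commute)
  also have "\<dots> = ?D (\<Sum>j\<in>UNIV. ?u $ j *\<^sub>R column j (g x))"
    by (simp add: linear_sum[OF assms] linear_scale[OF assms])
  also have "(\<Sum>j\<in>UNIV. ?u $ j *\<^sub>R column j (g x)) = g x *v ?u"
    by (simp add: matrix_mult_sum scalar_mult_eq_scaleR)
  finally show ?thesis
    by (simp add: gen_drift_def closed_loop_drift_def lie_vec_def linear_add[OF assms] add.commute)
qed

text \<open>The diffusion part of \<open>h\<close> occurs on both sides of the barrier condition and
  cancels, leaving the lower bound \<open>(h x)\<^sup>2 * gen_diff \<sigma> (\<lambda>z. 1 / h z) x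
  - \<gamma> * h x\<close> for the derivative of \<open>h\<close> along the drift. Division by
  \<open>(h x)\<^sup>2\<close> gives the claim, because the gradient of \<open>1 / h\<close> is that
  of \<open>h\<close> divided by \<open>- (h x)\<^sup>2\<close>.\<close>

lemma reciprocal_barrier:
  fixes h :: "real ^ 'n \<Rightarrow> real"
  assumes S: "open S" and h: "C2_on S h" and pos: "\<And>x. x \<in> S \<Longrightarrow> 0 < h x"
    and zcbf: "AS_ZCBF f g \<sigma> uo S h \<phi> \<gamma>"
  obtains DV D2V where "has_C2 S (\<lambda>x. 1 / h x) DV D2V"
    "\<And>x. x \<in> S \<Longrightarrow> DV x \<bullet> closed_loop_drift f g uo \<phi> x + 1/2 * trace (\<sigma> x ** transpose (\<sigma> x) ** D2V x) \<le> \<gamma> * (1 / h x)"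
proof
  note C2h = C2_on_imp_has_C2[OF h]
  let ?DV = "\<lambda>x. (- 1 / (h x)\<^sup>2) *\<^sub>R grad h x"
  let ?D2V = "\<lambda>x. (- 1 / (h x)\<^sup>2) *\<^sub>R transpose (hessian h x) + (2 / h x ^ 3) *\<^sub>R outer (grad h x)"
  show C2V: "has_C2 S (\<lambda>x. 1 / h x) ?DV ?D2V"
  proof (rule has_C2_compose[OF C2h, of "\<lambda>s. 1 / s" "\<lambda>s. - 1 / s\<^sup>2" "\<lambda>s. 2 / s ^ 3"])
    fix x assume x: "x \<in> S"
    show "((\<lambda>s. 1 / s) has_real_derivative - 1 / (h x)\<^sup>2) (at (h x))"
      using pos[OF x] by (auto intro!: derivative_eq_intros simp: power2_eq_square)
    show "((\<lambda>s. - 1 / s\<^sup>2) has_real_derivative 2 / h x ^ 3) (at (h x))"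
      using pos[OF x] by (auto intro!: derivative_eq_intros simp: power2_eq_square power3_eq_cube)
  next
    show "continuous_on (h ` S) (\<lambda>s. 2 / s ^ 3)"
      using pos by (intro continuous_intros) force
  qed
  fix x assume x: "x \<in> S"
  let ?b = "closed_loop_drift f g uo \<phi> x"
  have fd: "frechet_derivative h (at x) = (\<lambda>v. grad h x \<bullet> v)"
    by (rule has_C2_frechet_derivative[OF C2h x])
  have lin: "linear (frechet_derivative h (at x))"
    unfolding fd by (rule bounded_linear.linear[OF bounded_linear_inner_right])
  have diffV: "gen_diff \<sigma> (\<lambda>z. 1 / h z) x = 1/2 * trace (\<sigma> x ** transpose (\<sigma> x) ** ?D2V x)"
    unfolding gen_diff_def has_C2_hessian[OF S C2V x] trace_mult_transpose_right ..
  have "gen f g \<sigma> (\<phi> x) uo h x \<ge> - \<gamma> * h x + gen_diff \<sigma> h x + (h x)\<^sup>2 * gen_diff \<sigma> (\<lambda>z. 1 / h z) x"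
    using zcbf x by (auto simp: AS_ZCBF_def)
  then have "(h x)\<^sup>2 * gen_diff \<sigma> (\<lambda>z. 1 / h z) x - \<gamma> * h x \<le> grad h x \<bullet> ?b"
    unfolding gen_def gen_drift_eq[OF lin] fd by simp
  then have "((h x)\<^sup>2 * gen_diff \<sigma> (\<lambda>z. 1 / h z) x - \<gamma> * h x) / (h x)\<^sup>2 \<le> (grad h x \<bullet> ?b) / (h x)\<^sup>2"
    by (intro divide_right_mono) auto
  then have "gen_diff \<sigma> (\<lambda>z. 1 / h z) x - \<gamma> * (1 / h x) \<le> (grad h x \<bullet> ?b) / (h x)\<^sup>2"
    using pos[OF x] by (simp add: diff_divide_distrib power2_eq_square)
  then show "?DV x \<bullet> ?b + 1/2 * trace (\<sigma> x ** transpose (\<sigma> x) ** ?D2V x) \<le> \<gamma> * (1 / h x)"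
    unfolding diffV by simp
qed

text \<open>The first derivative multiplies the given inequality by a nonnegative factor, and
  concavity replaces \<open>v * trunc' c v\<close> by \<open>trunc c v\<close>. The second
  derivative contributes a nonpositive multiple of a nonnegative trace.\<close>

lemma trunc_generator_le:
  fixes \<eta> :: "real ^ 'd ^ 'n"
  assumes "0 \<le> c" "0 \<le> v" "0 \<le> \<gamma>" "a \<bullet> b + 1/2 * trace (\<eta> ** transpose \<eta> ** A) \<le> \<gamma> * v"
  shows "(trunc' c v *\<^sub>R a) \<bullet> b + 1/2 * trace (\<eta> ** transpose \<eta> ** (trunc' c v *\<^sub>R A + trunc'' c v *\<^sub>R outer a)) \<le> \<gamma> * trunc c v"
proof -
  have tr: "trace (\<eta> ** transpose \<eta> ** (p *\<^sub>R A + r *\<^sub>R outer a)) =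
      p * trace (\<eta> ** transpose \<eta> ** A) + r * trace (\<eta> ** transpose \<eta> ** outer a)" for p r
    by (simp add: trace_def matrix_matrix_mult_def sum.distrib sum_distrib_left distrib_left mult_ac)
  have "trunc' c v * (a \<bullet> b + 1/2 * trace (\<eta> ** transpose \<eta> ** A)) \<le> trunc' c v * (\<gamma> * v)"
    using assms by (intro mult_left_mono trunc_bounds)
  also have "\<dots> = \<gamma> * (v * trunc' c v)" by simp
  also have "\<dots> \<le> \<gamma> * trunc c v"
    using assms by (intro mult_left_mono trunc_bounds)
  finally have "trunc' c v * (a \<bullet> b + 1/2 * trace (\<eta> ** transpose \<eta> ** A)) \<le> \<gamma> * trunc c v" .
  moreover have "trunc'' c v * trace (\<eta> ** transpose \<eta> ** outer a) \<le> 0"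
    using trunc_bounds(6)[OF assms(1,2)] trace_outer_nonneg[of \<eta> a] by (simp add: mult_le_0_iff)
  ultimately show ?thesis unfolding tr by (simp add: algebra_simps)
qed

section \<open>Euler schemes on a grid\<close>

text \<open>Uniform continuity bounds the error of each cell by \<open>e * \<Delta>\<close>. The
  errors add up to \<open>e\<close> times the elapsed time, so one mesh size serves all partial
  sums.\<close>

lemma riemann_sum_uniform:
  fixes p :: "real \<Rightarrow> 'b :: euclidean_space"
  assumes p: "continuous_on {0..\<theta>} p" and \<theta>: "0 \<le> \<theta>" and \<epsilon>: "0 < \<epsilon>"
  shows "\<exists>\<delta>>0. \<forall>\<Delta> i. 0 < \<Delta> \<longrightarrow> \<Delta> < \<delta> \<longrightarrow> real i * \<Delta> \<le> \<theta> \<longrightarrow>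
    norm ((\<Sum>m<i. \<Delta> *\<^sub>R p (real m * \<Delta>)) - (LINT s:{0..real i * \<Delta>}|lborel. p s)) < \<epsilon>"
proof -
  \<comment> \<open>The summand 1 keeps the denominator positive when
    \<open>\<theta> = 0\<close>.\<close>
  define e where "e = \<epsilon> / (2 * (\<theta> + 1))"
  have e: "0 < e" "e * \<theta> < \<epsilon>"
  proof -
    show "0 < e" using \<epsilon> \<theta> by (simp add: e_def)
    have "e * \<theta> \<le> e * (\<theta> + 1)" using \<open>0 < e\<close> by simp
    also have "\<dots> = \<epsilon> / 2"
    proof -
      have "\<epsilon> / (2 * k) * k = \<epsilon> / 2" if "k \<noteq> 0" for k :: real using that by simp
      from this[of "\<theta> + 1"] show ?thesis using \<theta> unfolding e_def by simp
    qed
    finally show "e * \<theta> < \<epsilon>" using \<epsilon> by simp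
  qed
  have "uniformly_continuous_on {0..\<theta>} p"
    using p by (rule compact_uniformly_continuous) simp
  then obtain \<delta> where \<delta>: "0 < \<delta>" "\<And>x y. x \<in> {0..\<theta>} \<Longrightarrow> y \<in> {0..\<theta>} \<Longrightarrow> dist y x < \<delta> \<Longrightarrow> dist (p y) (p x) < e"
    using e unfolding uniformly_continuous_on_def by blast
  have main: "norm ((\<Sum>m<i. \<Delta> *\<^sub>R p (real m * \<Delta>)) - integral {0..real i * \<Delta>} p) \<le> e * (real i * \<Delta>)"
    if \<Delta>: "0 < \<Delta>" "\<Delta> < \<delta>" and "real i * \<Delta> \<le> \<theta>" for \<Delta> i
    using that(3)
  proof (induction i)
    case (Suc i)
    define a b where ab_def: "a = real i * \<Delta>" "b = real (Suc i) * \<Delta>"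
    have ab: "0 \<le> a" "a \<le> b" "b - a = \<Delta>" "b \<le> \<theta>"
      using \<Delta> Suc.prems by (auto simp: ab_def algebra_simps)
    have c: "continuous_on A p" if "A \<subseteq> {0..\<theta>}" for A
      using p that by (rule continuous_on_subset)
    have int: "p integrable_on {0..b}" "p integrable_on {a..b}"
      using ab by (intro integrable_continuous_real c; simp)+
    have split: "integral {0..b} p = integral {0..a} p + integral {a..b} p"
      using Henstock_Kurzweil_Integration.integral_combine[OF ab(1,2) int(1)] by simp
    have f1: "norm (\<Delta> *\<^sub>R p a - integral {a..b} p) \<le> e * \<Delta>"
    proof -
      have "integral {a..b} (\<lambda>s. p s - p a) = integral {a..b} p - \<Delta> *\<^sub>R p a"
        using has_integral_diff[OF integrable_integral[OF int(2)] has_integral_const_real[of "p a" a b]] ab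
        by (auto dest!: integral_unique)
      moreover have "norm (integral {a..b} (\<lambda>s. p s - p a)) \<le> e * (b - a)"
      proof (rule integral_bound)
        show "a \<le> b" by (rule ab)
        show "continuous_on {a..b} (\<lambda>s. p s - p a)"
          using ab by (intro continuous_intros c) auto
        fix s assume "s \<in> {a..b}"
        then have "dist (p s) (p a) < e"
          using ab \<Delta> by (intro \<delta>(2)) (auto simp: dist_real_def)
        then show "norm (p s - p a) \<le> e" by (simp add: dist_norm)
      qed
      ultimately show ?thesis using ab(3) by (simp add: norm_minus_commute)
    qed
    have f2: "norm ((\<Sum>m<i. \<Delta> *\<^sub>R p (real m * \<Delta>)) - integral {0..a} p) \<le> e * a"
      using Suc.IH ab by (simp add: ab_def)
    have f3: "(\<Sum>m<Suc i. \<Delta> *\<^sub>R p (real m * \<Delta>)) - integral {0..b} p =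
        ((\<Sum>m<i. \<Delta> *\<^sub>R p (real m * \<Delta>)) - integral {0..a} p) + (\<Delta> *\<^sub>R p a - integral {a..b} p)"
      unfolding split by (simp add: ab_def)
    have "norm ((\<Sum>m<Suc i. \<Delta> *\<^sub>R p (real m * \<Delta>)) - integral {0..b} p) \<le> e * a + e * \<Delta>"
      unfolding f3 by (rule norm_triangle_le, rule add_mono[OF f2 f1])
    also have "\<dots> = e * b" by (simp add: ab_def algebra_simps)
    finally show ?case unfolding ab_def .
  qed simp
  show ?thesis
  proof (intro exI[of _ \<delta>] conjI \<delta>(1) allI impI)
    fix \<Delta> i assume a: "0 < \<Delta>" "\<Delta> < \<delta>" "real i * \<Delta> \<le> \<theta>"
    have "continuous_on {0..real i * \<Delta>} p"
      using p a by (intro continuous_on_subset[OF p]) auto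
    then have "set_integrable lborel {0..real i * \<Delta>} p"
      by (rule borel_integrable_atLeastAtMost')
    then have "(LINT s:{0..real i * \<Delta>}|lborel. p s) = integral {0..real i * \<Delta>} p"
      by (rule set_borel_integral_eq_integral(2))
    moreover have "e * (real i * \<Delta>) \<le> e * \<theta>" using a e by (intro mult_left_mono) auto
    then have "norm ((\<Sum>m<i. \<Delta> *\<^sub>R p (real m * \<Delta>)) - integral {0..real i * \<Delta>} p) < \<epsilon>"
      using main[OF a] e(2) by linarith
    ultimately show "norm ((\<Sum>m<i. \<Delta> *\<^sub>R p (real m * \<Delta>)) - (LINT s:{0..real i * \<Delta>}|lborel. p s)) < \<epsilon>"
      by (simp only:)
  qed
qed

lemma step_process_eq:
  assumes "m < N" "p m < s" "s \<le> p (Suc m)" "\<And>i. i < N \<Longrightarrow> p i < p (Suc i)"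
  shows "step_process N p \<xi> s \<omega> = \<xi> m \<omega>"
proof -
  note q_mono = strict_grid_mono[of N p, OF assms(4)]
  have "indicator {p k<..p (Suc k)} s *\<^sub>R \<xi> k \<omega> = (if k = m then \<xi> m \<omega> else 0)" if "k < N" for k
  proof -
    consider "k = m" | "Suc k \<le> m" | "Suc m \<le> k" by linarith
    then show ?thesis
    proof cases
      case 2
      then have "p (Suc k) \<le> p m" using q_mono assms(1) by simp
      then show ?thesis using 2 assms by simp
    next
      case 3
      then have "p (Suc m) \<le> p k" using q_mono that by simp
      then show ?thesis using 3 assms by simp
    qed (use assms in simp)
  qed
  then have "step_process N p \<xi> s \<omega> = (\<Sum>k<N. if k = m then \<xi> m \<omega> else 0)"
    unfolding step_process_def by (intro sum.cong) auto
  then show ?thesis using assms(1) by simp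
qed

text \<open>The cells are left-open and right-closed, as in \<open>step_process\<close>; hence the
  ceiling, and the index is one less than it.\<close>

lemma uniform_grid_cell:
  assumes "0 < s" "s \<le> real N * \<Delta>" "0 < \<Delta>"
  obtains m where "m < N" "real m * \<Delta> < s" "s \<le> real (Suc m) * \<Delta>"
proof
  define j where "j = nat \<lceil>s / \<Delta>\<rceil>"
  have sj: "0 < s / \<Delta>" "s / \<Delta> \<le> real N" using assms by (simp_all add: pos_divide_le_eq)
  have c: "0 < \<lceil>s / \<Delta>\<rceil>" "\<lceil>s / \<Delta>\<rceil> \<le> int N" using sj by (simp_all add: ceiling_le_iff)
  then have j: "0 < j" "j \<le> N" "real j = of_int \<lceil>s / \<Delta>\<rceil>"
    unfolding j_def by linarith+
  then have j1: "real (j - 1) = of_int \<lceil>s / \<Delta>\<rceil> - 1" by (simp add: of_nat_diff)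
  show "j - 1 < N" using j by simp
  show "real (j - 1) * \<Delta> < s"
    using ceiling_correct[of "s / \<Delta>"] assms(3) unfolding j1 by (simp add: field_simps)
  show "s \<le> real (Suc (j - 1)) * \<Delta>"
  proof -
    have "s / \<Delta> \<le> real j" unfolding j(3) by (rule le_of_int_ceiling)
    then have "s \<le> real j * \<Delta>" using assms(3) by (simp add: pos_divide_le_eq)
    then show ?thesis using j(1) by simp
  qed
qed

text \<open>The integrand of a solution stopped at \<open>\<theta>\<close> may jump to zero there,
  so sampling is not uniformly close to it. The bad times fill at most one mesh length, on which the
  difference is bounded, so the square integral still tends to zero.\<close>

lemma step_process_stopped_path_tendsto:
  fixes p H :: "real \<Rightarrow> real ^ 'd ^ 'n"
  assumes p: "continuous_on {0..\<theta>} p" and \<theta>: "0 \<le> \<theta>" and l: "0 < l"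
    and H: "\<And>s. 0 \<le> s \<Longrightarrow> H s = (if s < \<theta> then p s else 0)"
  shows "(\<lambda>n. \<integral>\<^sup>+ s\<in>{0..l}. ennreal ((norm (
      step_process (Suc n) (\<lambda>i. real i * (l / real (Suc n))) (\<lambda>i _. H (real i * (l / real (Suc n)))) s \<omega> - H s))\<^sup>2) \<partial>lborel)
      \<longlonglongrightarrow> 0"
proof -
  have "bounded (p ` {0..\<theta>})"
    by (intro compact_imp_bounded compact_continuous_image p) simp
  then obtain C where "\<forall>s\<in>{0..\<theta>}. norm (p s) \<le> C" by (auto simp: bounded_iff)
  then have C: "norm (p s) \<le> C" if "s \<in> {0..\<theta>}" for s using that by blast
  have C0: "0 \<le> C" using C[of 0] \<theta> norm_ge_zero[of "p 0"] by (simp, linarith)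
  have HC: "norm (H s) \<le> C" if "0 \<le> s" for s
    using H[OF that] C[of s] C0 that by simp
  have uc: "uniformly_continuous_on {0..\<theta>} p"
    using p by (rule compact_uniformly_continuous) simp
  show ?thesis
  proof (rule tendsto_zero_ennreal)
    fix r :: real assume r: "0 < r"
    define e where "e = sqrt (r / (4 * l))"
    have e: "0 < e" "e\<^sup>2 * l = r / 4" using r l by (simp_all add: e_def)
    obtain \<delta> where \<delta>: "0 < \<delta>" "\<And>x y. x \<in> {0..\<theta>} \<Longrightarrow> y \<in> {0..\<theta>} \<Longrightarrow> dist y x < \<delta> \<Longrightarrow> dist (p y) (p x) < e"
      using uc e(1) unfolding uniformly_continuous_on_def by blast
    have lim: "(\<lambda>n. l / real (Suc n)) \<longlonglongrightarrow> 0"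
      using tendsto_mult[OF tendsto_const[of l] LIMSEQ_inverse_real_of_nat] by (simp add: divide_inverse)
    have "(\<lambda>n. C\<^sup>2 * (l / real (Suc n))) \<longlonglongrightarrow> 0"
      using tendsto_mult[OF tendsto_const[of "C\<^sup>2"] lim] by simp
    then have "\<forall>\<^sub>F n in sequentially. C\<^sup>2 * (l / real (Suc n)) < r / 2"
      by (rule order_tendstoD(2)) (use r in simp)
    then have ev: "\<forall>\<^sub>F n in sequentially. l / real (Suc n) < \<delta> \<and> C\<^sup>2 * (l / real (Suc n)) < r / 2"
      by (rule eventually_conj[OF order_tendstoD(2)[OF lim \<delta>(1)]])
    show "\<forall>\<^sub>F n in sequentially. (\<integral>\<^sup>+ s\<in>{0..l}. ennreal ((norm (
      step_process (Suc n) (\<lambda>i. real i * (l / real (Suc n))) (\<lambda>i _. H (real i * (l / real (Suc n)))) s \<omega> - H s))\<^sup>2) \<partial>lborel) < ennreal r"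
      using ev
    proof eventually_elim
      case (elim n)
      define \<Delta> where "\<Delta> = l / real (Suc n)"
      have \<Delta>: "0 < \<Delta>" "\<Delta> < \<delta>" "C\<^sup>2 * \<Delta> < r / 2" "real (Suc n) * \<Delta> = l"
        using elim l by (simp_all add: \<Delta>_def)
      let ?S = "\<lambda>s. step_process (Suc n) (\<lambda>i. real i * \<Delta>) (\<lambda>i _. H (real i * \<Delta>)) s \<omega>"
      \<comment> \<open>\<open>?A\<close> covers times before \<open>\<theta>\<close>, where uniform
        continuity of \<open>p\<close> applies. \<open>?B\<close> covers the cell in which the
        sample was taken before \<open>\<theta>\<close> but the time lies after it.
        \<open>?C\<close> covers time 0, which belongs to no left-open cell and is a null
        set.\<close>
      let ?A = "\<lambda>s. ennreal (e\<^sup>2) * indicator {0..l} s :: ennreal"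
      let ?B = "\<lambda>s. ennreal (C\<^sup>2) * indicator {\<theta>..\<theta> + \<Delta>} s :: ennreal"
      let ?C = "\<lambda>s. ennreal (C\<^sup>2) * indicator {0 :: real} s :: ennreal"
      have "(\<integral>\<^sup>+ s\<in>{0..l}. ennreal ((norm (?S s - H s))\<^sup>2) \<partial>lborel) \<le> (\<integral>\<^sup>+ s. (?A s + ?B s) + ?C s \<partial>lborel)"
      proof (rule nn_integral_mono)
        fix s :: real
        consider "s \<notin> {0..l}" | "s = 0" | "0 < s" "s \<le> l" by fastforce
        then show "ennreal ((norm (?S s - H s))\<^sup>2) * indicator {0..l} s \<le> (?A s + ?B s) + ?C s"
        proof cases
          case 1
          then show ?thesis by simp
        next
          case 2
          have "?S 0 = 0"
            unfolding step_process_def using \<Delta>(1) by (intro sum.neutral) (auto simp: indicator_def mult_less_0_iff)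
          then have "norm (?S s - H s) \<le> C" using 2 HC[of 0] by simp
          then have "ennreal ((norm (?S s - H s))\<^sup>2) \<le> ennreal (C\<^sup>2)"
            by (intro ennreal_leI power_mono) auto
          also have "\<dots> \<le> (?A s + ?B s) + ?C s" using 2 by simp
          finally show ?thesis using 2 l by simp
        next
          case 3
          then obtain m where m: "m < Suc n" "real m * \<Delta> < s" "s \<le> real (Suc m) * \<Delta>"
            using uniform_grid_cell[of s "Suc n" \<Delta>] \<Delta> by metis
          have S: "?S s = H (real m * \<Delta>)"
            using m \<Delta>(1) by (intro step_process_eq) auto
          have tm: "0 \<le> real m * \<Delta>" "s - real m * \<Delta> \<le> \<Delta>" using \<Delta>(1) m by (auto simp: algebra_simps)
          have s0: "0 \<le> s" using 3 by simp
          note Hs = H[of s] and Ht = H[OF tm(1)]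
          consider "s < \<theta>" | "\<theta> \<le> real m * \<Delta>" | "real m * \<Delta> < \<theta>" "\<theta> \<le> s" by linarith
          then show ?thesis
          proof cases
            case 1
            have "dist (p (real m * \<Delta>)) (p s) < e"
            proof (rule \<delta>(2))
              show "s \<in> {0..\<theta>}" using s0 1 by simp
              show "real m * \<Delta> \<in> {0..\<theta>}" unfolding atLeastAtMost_iff using tm(1) m(2) 1 by linarith
              show "dist (real m * \<Delta>) s < \<delta>" unfolding dist_real_def using m(2) tm(2) \<Delta>(2) by linarith
            qed
            moreover have "H s = p s" using Hs[OF s0] 1 by simp
            moreover have "?S s = p (real m * \<Delta>)" unfolding S using Ht 1 m(2) by simp
            ultimately have "norm (?S s - H s) \<le> e" by (simp only: dist_norm less_imp_le)
            then have "ennreal ((norm (?S s - H s))\<^sup>2) \<le> ennreal (e\<^sup>2)"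
              by (intro ennreal_leI power_mono) auto
            also have "\<dots> = ?A s" using 3 by simp
            also have "\<dots> \<le> (?A s + ?B s) + ?C s" by (simp add: add.assoc)
            finally show ?thesis using 3 by simp
          next
            case 2
            have "H s = 0" using Hs[OF s0] 2 m(2) by simp
            moreover have "?S s = 0" unfolding S using Ht 2 by simp
            ultimately have "?S s - H s = 0" by (simp only: diff_self)
            then show ?thesis by (simp only: norm_zero) simp
          next
            case 3
            have "H s = 0" using Hs[OF s0] 3 by simp
            then have "norm (?S s - H s) \<le> C" unfolding S using HC[OF tm(1)] by (simp only: diff_zero)
            then have "ennreal ((norm (?S s - H s))\<^sup>2) \<le> ennreal (C\<^sup>2)"
              by (intro ennreal_leI power_mono) auto
            also have "\<dots> = ?B s"
            proof -
              have "s \<in> {\<theta>..\<theta> + \<Delta>}" unfolding atLeastAtMost_iff using 3 tm(2) by linarith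
              then show ?thesis by simp
            qed
            also have "\<dots> \<le> (?A s + ?B s) + ?C s" by (simp add: add.assoc add_increasing)
            finally show ?thesis using \<open>0 < s\<close> \<open>s \<le> l\<close> by simp
          qed
        qed
      qed
      also have "\<dots> = ((\<integral>\<^sup>+ s. ?A s \<partial>lborel) + (\<integral>\<^sup>+ s. ?B s \<partial>lborel)) + (\<integral>\<^sup>+ s. ?C s \<partial>lborel)"
        by (simp add: nn_integral_add)
      also have "\<dots> = ennreal (e\<^sup>2) * ennreal l + ennreal (C\<^sup>2) * ennreal \<Delta>"
        using l \<Delta>(1) \<theta> by (simp add: nn_integral_cmult_indicator)
      also have "\<dots> = ennreal (e\<^sup>2 * l + C\<^sup>2 * \<Delta>)"
        using l \<Delta>(1) by (simp add: ennreal_mult ennreal_plus)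
      also have "\<dots> < ennreal r"
        using \<Delta>(3) e(2) r by (intro ennreal_lessI) auto
      finally show ?case unfolding \<Delta>_def .
    qed
  qed
qed

lemma discrete_gronwall:
  fixes u :: "nat \<Rightarrow> real"
  assumes "\<And>i. i < N \<Longrightarrow> u (Suc i) \<le> (1 + a) * u i + r" "0 \<le> a" "0 \<le> r" "0 \<le> u 0"
  shows "u N \<le> exp (a * real N) * (u 0 + real N * r)"
proof -
  have "i \<le> N \<Longrightarrow> u i \<le> (1 + a) ^ i * (u 0 + real i * r)" for i
  proof (induction i)
    case (Suc i)
    have "u (Suc i) \<le> (1 + a) * ((1 + a) ^ i * (u 0 + real i * r)) + r"
    proof -
      have "u (Suc i) \<le> (1 + a) * u i + r" using Suc.prems by (intro assms(1)) simp
      moreover have "(1 + a) * u i \<le> (1 + a) * ((1 + a) ^ i * (u 0 + real i * r))"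
        using Suc.prems assms(2) by (intro mult_left_mono Suc.IH) auto
      ultimately show ?thesis by linarith
    qed
    moreover have "r \<le> (1 + a) ^ Suc i * r"
      using assms(2,3) one_le_power[of "1 + a" "Suc i"] mult_right_mono[of 1 "(1 + a) ^ Suc i" r] by simp
    moreover have "(1 + a) * ((1 + a) ^ i * (u 0 + real i * r)) + (1 + a) ^ Suc i * r = (1 + a) ^ Suc i * (u 0 + real (Suc i) * r)"
      by (simp add: algebra_simps)
    ultimately show ?case by linarith
  qed simp
  then have "u N \<le> (1 + a) ^ N * (u 0 + real N * r)" by simp
  also have "\<dots> \<le> exp (a * real N) * (u 0 + real N * r)"
  proof (intro mult_right_mono)
    have "(1 + a) ^ N \<le> exp a ^ N" using assms(2) by (intro power_mono exp_ge_add_one_self) simp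
    then show "(1 + a) ^ N \<le> exp (a * real N)" by (simp add: exp_of_nat2_mult)
  qed (use assms in auto)
  finally show ?thesis .
qed

context wiener_space
begin

text \<open>Fatou's lemma for events: paths in \<open>E\<close> eventually belong to
  \<open>A n\<close>, so \<open>prob (E - A n)\<close> tends to zero and a bound on
  \<open>prob (A n)\<close> passes to \<open>E\<close>.\<close>

lemma prob_le_of_eventually:
  assumes E: "E \<in> events" and A: "\<And>n. A n \<in> events"
    and sub: "AE \<omega> in P. \<omega> \<in> E \<longrightarrow> (\<forall>\<^sub>F n in sequentially. \<omega> \<in> A n)"
    and le: "\<forall>\<^sub>F n in sequentially. prob (A n) \<le> b n" and b: "b \<longlonglongrightarrow> B"
  shows "prob E \<le> B"
proof -
  have "(\<lambda>n. prob (E - A n)) \<longlonglongrightarrow> 0"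
  proof (rule prob_tendsto_zero)
    show "E - A n \<in> events" for n using E A by blast
    show "AE \<omega> in P. \<forall>\<^sub>F n in sequentially. \<omega> \<notin> E - A n"
      using sub
    proof eventually_elim
      case (elim \<omega>)
      then show ?case by (cases "\<omega> \<in> E") (auto elim: eventually_mono)
    qed
  qed
  from tendsto_add[OF b this] have lim: "(\<lambda>n. b n + prob (E - A n)) \<longlonglongrightarrow> B" by simp
  show ?thesis
  proof (rule tendsto_lowerbound[OF lim])
    show "\<forall>\<^sub>F n in sequentially. prob E \<le> b n + prob (E - A n)"
      using le
    proof eventually_elim
      case (elim n)
      have "prob E \<le> prob (A n \<union> (E - A n))"
        using E A by (intro finite_measure_mono) auto
      also have "\<dots> \<le> prob (A n) + prob (E - A n)"
        using E A by (intro measure_Un_le) auto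
      finally show ?case using elim by linarith
    qed
  qed simp
qed

end

context wiener_C2
begin

text \<open>\<open>A\<close> is the exceptional event on which the Euler scheme \<open>Z\<close> strays from \<open>Y\<close>; it only costs a
  multiple of its probability.\<close>

lemma grid_supermartingale:
  fixes \<beta> Y :: "nat \<Rightarrow> 'w \<Rightarrow> real ^ 'n" and \<eta> :: "nat \<Rightarrow> 'w \<Rightarrow> real ^ 'd ^ 'n" and g :: "nat \<Rightarrow> 'w \<Rightarrow> bool"
    and x0 :: "real ^ 'n" and C d e \<gamma> \<Delta> :: real
  assumes \<Delta>: "0 < \<Delta>"
    and meas: "\<And>i. i < N \<Longrightarrow> \<beta> i \<in> borel_measurable (F (ennreal (real i * \<Delta>)))"
      "\<And>i. i < N \<Longrightarrow> \<eta> i \<in> borel_measurable (F (ennreal (real i * \<Delta>)))"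
    and C: "\<And>i \<omega>. i < N \<Longrightarrow> \<omega> \<in> space P \<Longrightarrow> norm (\<beta> i \<omega>) \<le> C" "\<And>i \<omega>. i < N \<Longrightarrow> \<omega> \<in> space P \<Longrightarrow> norm (\<eta> i \<omega>) \<le> C"
      "0 \<le> C"
    and d: "0 < d" "\<And>x y. norm (x - y) < d \<Longrightarrow> \<bar>G x - G y\<bar> \<le> e"
      "\<And>x y. norm (x - y) < d \<Longrightarrow> norm (DG x - DG y) \<le> e"
      "\<And>x y. norm (x - y) < d \<Longrightarrow> norm (D2 x - D2 y) \<le> e" and e: "0 \<le> e"
    and small: "\<Delta> * C < d" and \<gamma>: "0 \<le> \<gamma>" and G0: "\<And>x. 0 \<le> G x"
    and A: "A \<in> events"
    and frozen: "\<And>i \<omega>. i < N \<Longrightarrow> \<omega> \<in> space P \<Longrightarrow> \<not> g i \<omega> \<Longrightarrow> \<beta> i \<omega> = 0 \<and> \<eta> i \<omega> = 0"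
    and gen: "\<And>i \<omega>. i < N \<Longrightarrow> \<omega> \<in> space P \<Longrightarrow> g i \<omega> \<Longrightarrow> generator (Y i \<omega>) (\<beta> i \<omega>) (\<eta> i \<omega>) \<le> \<gamma> * G (Y i \<omega>)"
  defines "Z \<equiv> \<lambda>i \<omega>. x0 + (\<Sum>m<i. \<Delta> *\<^sub>R \<beta> m \<omega> + \<eta> m \<omega> *v (W (real (Suc m) * \<Delta>) \<omega> - W (real m * \<Delta>) \<omega>))"
  assumes close: "\<And>i \<omega>. i < N \<Longrightarrow> \<omega> \<in> space P - A \<Longrightarrow> g i \<omega> \<Longrightarrow> norm (Z i \<omega> - Y i \<omega>) < d"
  defines "\<kappa> \<equiv> C + CARD('n) * C\<^sup>2 + \<gamma>"
  shows "Z N \<in> borel_measurable P"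
    and "expectation (\<lambda>\<omega>. G (Z N \<omega>)) \<le> exp (\<gamma> * (real N * \<Delta>)) * (G x0 + real N * \<Delta> * (
      e * \<kappa> + \<kappa> * B * prob A +
      (e * (C + real CARD('d) * C\<^sup>2 + real CARD('n) * C\<^sup>2) + 3 * B * C ^ 4 * (real CARD('d))\<^sup>2 / d\<^sup>2 * \<Delta>)))"
proof -
  have Z_meas: "Z i \<in> borel_measurable (F (ennreal (real i * \<Delta>)))" if "i \<le> N" for i
    unfolding Z_def
  proof (intro borel_measurable_add borel_measurable_const borel_measurable_sum)
    fix m assume m: "m \<in> {..<i}"
    then have le: "real m * \<Delta> \<le> real i * \<Delta>" "real (Suc m) * \<Delta> \<le> real i * \<Delta>" "m < N"
      using \<Delta> that by (auto intro!: mult_right_mono)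
    have [measurable]: "\<beta> m \<in> borel_measurable (F (ennreal (real i * \<Delta>)))" "\<eta> m \<in> borel_measurable (F (ennreal (real i * \<Delta>)))"
      by (intro F_mono[OF meas(1)] F_mono[OF meas(2)] ennreal_leI le)+
    have [measurable]: "W (real m * \<Delta>) \<in> borel_measurable (F (ennreal (real i * \<Delta>)))"
      "W (real (Suc m) * \<Delta>) \<in> borel_measurable (F (ennreal (real i * \<Delta>)))"
      using le \<Delta> by (auto intro!: W_measurable_F)
    show "(\<lambda>\<omega>. \<Delta> *\<^sub>R \<beta> m \<omega>) \<in> borel_measurable (F (ennreal (real i * \<Delta>)))" by measurable
    show "(\<lambda>\<omega>. \<eta> m \<omega> *v (W (real (Suc m) * \<Delta>) \<omega> - W (real m * \<Delta>) \<omega>)) \<in> borel_measurable (F (ennreal (real i * \<Delta>)))"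
      by measurable
  qed
  show "Z N \<in> borel_measurable P" using Z_meas[of N] by (auto intro: F_measurable)
  define \<rho> where "\<rho> = e * \<kappa> + \<kappa> * B * prob A +
      (e * (C + real CARD('d) * C\<^sup>2 + real CARD('n) * C\<^sup>2) + 3 * B * C ^ 4 * (real CARD('d))\<^sup>2 / d\<^sup>2 * \<Delta>)"
  \<comment> \<open>Moving from \<open>Y\<close> to a point \<open>Z\<close> within distance
    \<open>d\<close> changes the first-order term by at most \<open>e * C\<close>, the trace term by
    at most \<open>e\<close> times half of \<open>CARD('n) * C\<^sup>2\<close>, and
    \<open>\<gamma> * G\<close> by at most \<open>\<gamma> * e\<close>. The constant
    \<open>\<kappa>\<close> dominates the sum of the three factors of \<open>e\<close>.\<close>
  have \<kappa>: "0 \<le> \<kappa>" "C + 1/2 * (CARD('n) * C\<^sup>2) + \<gamma> \<le> \<kappa>" using C(3) \<gamma> by (auto simp: \<kappa>_def)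
  have \<rho>0: "0 \<le> \<rho>"
    unfolding \<rho>_def using \<kappa>(1) e B_nonneg C(3) \<Delta> by (intro add_nonneg_nonneg mult_nonneg_nonneg) auto
  have step: "expectation (\<lambda>\<omega>. G (Z (Suc i) \<omega>)) \<le> (1 + \<gamma> * \<Delta>) * expectation (\<lambda>\<omega>. G (Z i \<omega>)) + \<Delta> * \<rho>"
    if i: "i < N" for i
  proof -
    have s: "0 \<le> real i * \<Delta>" using \<Delta> by simp
    note Zi = Z_meas[OF less_imp_le[OF i]]
    have [measurable]: "Z i \<in> borel_measurable P" using Zi by (rule F_measurable)
    have [measurable]: "A \<in> events" by (rule A)
    have Suc_eq: "G (Z (Suc i) \<omega>) = G (Z i \<omega> + \<Delta> *\<^sub>R \<beta> i \<omega> + \<eta> i \<omega> *v (W (real i * \<Delta> + \<Delta>) \<omega> - W (real i * \<Delta>) \<omega>))" for \<omega>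
      by (simp add: Z_def algebra_simps)
    have one: "expectation (\<lambda>\<omega>. G (Z (Suc i) \<omega>)) \<le>
        expectation (\<lambda>\<omega>. G (Z i \<omega>) + \<Delta> * generator (Z i \<omega>) (\<beta> i \<omega>) (\<eta> i \<omega>)) +
        \<Delta> * (e * (C + real CARD('d) * C\<^sup>2 + real CARD('n) * C\<^sup>2) + 3 * B * C ^ 4 * (real CARD('d))\<^sup>2 / d\<^sup>2 * \<Delta>)"
      unfolding Suc_eq
      by (rule one_step[OF s \<Delta> Zi meas(1)[OF i] meas(2)[OF i] C(1)[OF i] C(2)[OF i] d(1,3,4) e small])
    \<comment> \<open>Where \<open>g\<close> fails, the coefficients vanish and so does the left
      side. Where \<open>g\<close> holds outside \<open>A\<close>, the inequality at
      \<open>Y\<close> is transferred to \<open>Z\<close> at the cost \<open>e * \<kappa>\<close>.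
      On \<open>A\<close> nothing is known about the distance, and the bound \<open>B\<close> on the
      derivatives gives \<open>\<kappa> * B\<close>.\<close>
    have pt: "generator (Z i \<omega>) (\<beta> i \<omega>) (\<eta> i \<omega>) \<le> \<gamma> * G (Z i \<omega>) + (e * \<kappa> + \<kappa> * B * indicator A \<omega>)"
      if \<omega>: "\<omega> \<in> space P" for \<omega>
    proof -
      let ?b = "\<beta> i \<omega>" and ?n = "\<eta> i \<omega>"
      have gen_diff_le: "generator z ?b ?n - (DG y \<bullet> ?b + 1/2 * trace (?n ** transpose ?n ** M)) \<le> k * (C + 1/2 * (CARD('n) * C\<^sup>2))"
        if "norm (DG z - DG y) \<le> k" "norm (D2 z - M) \<le> k" for z y M k
      proof -
        have "(DG z - DG y) \<bullet> ?b \<le> norm (DG z - DG y) * norm ?b" by (rule norm_cauchy_schwarz)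
        also have "\<dots> \<le> k * C" using that C(1)[OF i \<omega>] by (intro mult_mono) (auto intro: order_trans[OF norm_ge_zero])
        finally have 1: "(DG z - DG y) \<bullet> ?b \<le> k * C" .
        have "trace (?n ** transpose ?n ** (D2 z - M)) \<le> CARD('n) * norm (?n ** transpose ?n ** (D2 z - M))"
          using abs_trace_le[of "?n ** transpose ?n ** (D2 z - M)"] by linarith
        also have "\<dots> \<le> CARD('n) * (C\<^sup>2 * k)"
          using C(2)[OF i \<omega>] that by (intro mult_left_mono norm_mult_transpose_le) auto
        finally have 2: "trace (?n ** transpose ?n ** (D2 z - M)) \<le> CARD('n) * (C\<^sup>2 * k)" .
        show ?thesis
          using 1 2 by (simp add: generator_def inner_diff_left matrix_mult_diff_distrib trace_diff algebra_simps)
      qed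
      show ?thesis
      proof (cases "g i \<omega>")
        case False
        then have "?b = 0" "?n = 0" using frozen[OF i \<omega>] by auto
        then have "generator (Z i \<omega>) ?b ?n = 0"
          by (simp add: generator_def trace_def matrix_matrix_mult_def)
        moreover have "0 \<le> \<gamma> * G (Z i \<omega>) + (e * \<kappa> + \<kappa> * B * indicator A \<omega>)"
          using \<gamma> G0 e \<kappa>(1) B_nonneg by (intro add_nonneg_nonneg mult_nonneg_nonneg) auto
        ultimately show ?thesis by simp
      next
        case True
        show ?thesis
        proof (cases "\<omega> \<in> A")
          case False
          have cl: "norm (Z i \<omega> - Y i \<omega>) < d" using close[OF i _ True] \<omega> False by blast
          have "generator (Z i \<omega>) ?b ?n - generator (Y i \<omega>) ?b ?n \<le> e * (C + 1/2 * (CARD('n) * C\<^sup>2))"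
            unfolding generator_def[of "Y i \<omega>"] by (rule gen_diff_le[OF d(3)[OF cl] d(4)[OF cl]])
          moreover have "generator (Y i \<omega>) ?b ?n \<le> \<gamma> * G (Y i \<omega>)" by (rule gen[OF i \<omega> True])
          moreover have "\<gamma> * G (Y i \<omega>) \<le> \<gamma> * (G (Z i \<omega>) + e)"
            using d(2)[OF cl] \<gamma> by (intro mult_left_mono) auto
          moreover have "e * (C + 1/2 * (CARD('n) * C\<^sup>2)) + \<gamma> * e \<le> e * \<kappa>"
            using mult_left_mono[OF \<kappa>(2) e] by (simp add: algebra_simps)
          ultimately show ?thesis using False by (simp add: algebra_simps)
        next
          case inA: True
          have "DG z \<bullet> ?b \<le> B * C" for z
          proof -
            have "DG z \<bullet> ?b \<le> norm (DG z) * norm ?b" by (rule norm_cauchy_schwarz)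
            also have "\<dots> \<le> B * C" using bound(2) C(1)[OF i \<omega>] B_nonneg by (intro mult_mono) auto
            finally show ?thesis .
          qed
          moreover have "trace (?n ** transpose ?n ** D2 (Z i \<omega>)) \<le> CARD('n) * (C\<^sup>2 * B)"
          proof -
            have "trace (?n ** transpose ?n ** D2 (Z i \<omega>)) \<le> CARD('n) * norm (?n ** transpose ?n ** D2 (Z i \<omega>))"
              using abs_trace_le[of "?n ** transpose ?n ** D2 (Z i \<omega>)"] by linarith
            also have "\<dots> \<le> CARD('n) * (C\<^sup>2 * B)"
              using C(2)[OF i \<omega>] bound(3) by (intro mult_left_mono norm_mult_transpose_le) auto
            finally show ?thesis .
          qed
          ultimately have "generator (Z i \<omega>) ?b ?n \<le> B * C + 1/2 * (CARD('n) * (C\<^sup>2 * B))"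
            unfolding generator_def by (intro add_mono mult_left_mono) auto
          also have "\<dots> = B * (C + 1/2 * (CARD('n) * C\<^sup>2))" by (simp add: algebra_simps)
          also have "\<dots> \<le> B * \<kappa>" using \<kappa>(2) \<gamma> B_nonneg by (intro mult_left_mono) auto
          finally have "generator (Z i \<omega>) ?b ?n \<le> \<kappa> * B" by (simp add: mult.commute)
          moreover have "0 \<le> \<gamma> * G (Z i \<omega>)" "0 \<le> e * \<kappa>" using \<gamma> G0 e \<kappa>(1) by simp_all
          ultimately show ?thesis using inA by simp
        qed
      qed
    qed
    have G_int: "integrable P (\<lambda>\<omega>. G (Z i \<omega>))"
      using bound(1) by (intro integrable_const_bound[of _ B] AE_I2) auto
    have ind_int: "integrable P (indicator A :: 'w \<Rightarrow> real)"
      by (intro integrable_const_bound[of _ 1] AE_I2) (auto simp: indicator_def)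
    have R_int: "integrable P (\<lambda>\<omega>. (1 + \<gamma> * \<Delta>) * G (Z i \<omega>) + (\<Delta> * (e * \<kappa>) + \<Delta> * (\<kappa> * B) * indicator A \<omega>))"
      using G_int ind_int by (intro Bochner_Integration.integrable_add integrable_mult_right integrable_const)
    have "expectation (\<lambda>\<omega>. G (Z i \<omega>) + \<Delta> * generator (Z i \<omega>) (\<beta> i \<omega>) (\<eta> i \<omega>)) \<le>
        expectation (\<lambda>\<omega>. (1 + \<gamma> * \<Delta>) * G (Z i \<omega>) + (\<Delta> * (e * \<kappa>) + \<Delta> * (\<kappa> * B) * indicator A \<omega>))"
    \<comment> \<open>This rule asks for integrability of the larger function only, in exchange for
      its nonnegativity.\<close>
    proof (rule integral_mono_AE')
      show "integrable P (\<lambda>\<omega>. (1 + \<gamma> * \<Delta>) * G (Z i \<omega>) + (\<Delta> * (e * \<kappa>) + \<Delta> * (\<kappa> * B) * indicator A \<omega>))"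
        by (rule R_int)
      show "AE \<omega> in P. G (Z i \<omega>) + \<Delta> * generator (Z i \<omega>) (\<beta> i \<omega>) (\<eta> i \<omega>) \<le>
          (1 + \<gamma> * \<Delta>) * G (Z i \<omega>) + (\<Delta> * (e * \<kappa>) + \<Delta> * (\<kappa> * B) * indicator A \<omega>)"
      proof (rule AE_I2)
        fix \<omega> assume "\<omega> \<in> space P"
        from mult_left_mono[OF pt[OF this] less_imp_le[OF \<Delta>]]
        show "G (Z i \<omega>) + \<Delta> * generator (Z i \<omega>) (\<beta> i \<omega>) (\<eta> i \<omega>) \<le>
          (1 + \<gamma> * \<Delta>) * G (Z i \<omega>) + (\<Delta> * (e * \<kappa>) + \<Delta> * (\<kappa> * B) * indicator A \<omega>)"
          by (simp add: algebra_simps)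
      qed
      show "AE \<omega> in P. 0 \<le> (1 + \<gamma> * \<Delta>) * G (Z i \<omega>) + (\<Delta> * (e * \<kappa>) + \<Delta> * (\<kappa> * B) * indicator A \<omega>)"
        using \<gamma> \<Delta> G0 e \<kappa>(1) B_nonneg
        by (intro AE_I2 add_nonneg_nonneg mult_nonneg_nonneg) auto
    qed
    also have "\<dots> = (1 + \<gamma> * \<Delta>) * expectation (\<lambda>\<omega>. G (Z i \<omega>)) + (\<Delta> * (e * \<kappa>) + \<Delta> * (\<kappa> * B) * prob A)"
      using G_int ind_int
      by (simp add: prob_space)
    finally show ?thesis using one by (simp add: \<rho>_def algebra_simps)
  qed
  have "expectation (\<lambda>\<omega>. G (Z N \<omega>)) \<le> exp (\<gamma> * \<Delta> * real N) * (expectation (\<lambda>\<omega>. G (Z 0 \<omega>)) + real N * (\<Delta> * \<rho>))"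
    using discrete_gronwall[of N "\<lambda>i. expectation (\<lambda>\<omega>. G (Z i \<omega>))" "\<gamma> * \<Delta>" "\<Delta> * \<rho>"] step \<rho>0 \<gamma> \<Delta> G0
    by (simp add: integral_nonneg_AE)
  then show "expectation (\<lambda>\<omega>. G (Z N \<omega>)) \<le> exp (\<gamma> * (real N * \<Delta>)) * (G x0 + real N * \<Delta> * (
      e * \<kappa> + \<kappa> * B * prob A +
      (e * (C + real CARD('d) * C\<^sup>2 + real CARD('n) * C\<^sup>2) + 3 * B * C ^ 4 * (real CARD('d))\<^sup>2 / d\<^sup>2 * \<Delta>)))"
    unfolding \<rho>_def[symmetric] by (simp add: Z_def prob_space mult_ac)
qed

end

section \<open>Convergence of the Euler scheme\<close>

lemma borel_measurable_continuous_on_compose: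
  fixes \<psi> :: "'a :: topological_space \<Rightarrow> 'b :: topological_space"
  assumes "S \<in> sets borel" "continuous_on S \<psi>" "f \<in> borel_measurable M" "\<And>\<omega>. \<omega> \<in> space M \<Longrightarrow> f \<omega> \<in> S"
  shows "(\<lambda>\<omega>. \<psi> (f \<omega>)) \<in> borel_measurable M"
proof -
  have "f \<in> M \<rightarrow>\<^sub>M restrict_space borel S"
    using assms(3,4) by (intro measurable_restrict_space2) auto
  from measurable_compose[OF this borel_measurable_continuous_on_restrict[OF assms(2)]]
  show ?thesis .
qed

text \<open>The clauses of \<open>sde_solution\<close> for a single member \<open>\<tau>\<close> of
  the announcing sequence, with its Ito integral \<open>I\<close>. Only continuity of the
  coefficients on \<open>S\<close> is kept.\<close>

locale stopped_solution = wiener_space P F W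
  for P :: "'w measure" and F and W :: "real \<Rightarrow> 'w \<Rightarrow> real ^ 'd" +
  fixes S :: "(real ^ 'n) set" and b :: "real ^ 'n \<Rightarrow> real ^ 'n" and \<sigma> :: "real ^ 'n \<Rightarrow> real ^ 'd ^ 'n"
    and x0 :: "real ^ 'n" and X :: "real \<Rightarrow> 'w \<Rightarrow> real ^ 'n" and T \<tau> :: "'w \<Rightarrow> ennreal"
    and I :: "real \<Rightarrow> 'w \<Rightarrow> real ^ 'n"
  assumes open_S: "open S" and x0_S: "x0 \<in> S"
    and cont_b: "continuous_on S b" and cont_\<sigma>: "continuous_on S \<sigma>"
    and T_stopping: "stopping_time F T" and \<tau>_stopping: "stopping_time F \<tau>"
    and X_measurable: "0 \<le> t \<Longrightarrow> X t \<in> borel_measurable (restrict_space (F (ennreal t)) {\<omega> \<in> space P. ennreal t < T \<omega>})"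
    and X_continuous: "\<omega> \<in> space P \<Longrightarrow> continuous_on {t. 0 \<le> t \<and> ennreal t < T \<omega>} (\<lambda>t. X t \<omega>)"
    and X_in_S: "\<omega> \<in> space P \<Longrightarrow> 0 \<le> t \<Longrightarrow> ennreal t < T \<omega> \<Longrightarrow> X t \<omega> \<in> S"
    and \<tau>_less: "AE \<omega> in P. \<tau> \<omega> < T \<omega>"
    and ito: "ito_integral P F W (\<lambda>s \<omega>. if ennreal s < \<tau> \<omega> then \<sigma> (X s \<omega>) else 0) I"
    and equation: "AE \<omega> in P. \<forall>t\<ge>0. let r = enn2real (min (ennreal t) (\<tau> \<omega>)) in
        X r \<omega> = x0 + (LINT s:{0..r}|lborel. b (X s \<omega>)) + I t \<omega>"
begin

text \<open>The solution is continued by \<open>x0\<close> after \<open>T\<close>, which makes it adapted and \<open>S\<close>-valued.\<close>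

definition Xs :: "real \<Rightarrow> 'w \<Rightarrow> real ^ 'n" where
  "Xs t \<omega> = (if ennreal t < T \<omega> then X t \<omega> else x0)"

text \<open>The comparison with \<open>T\<close> is included because \<open>\<tau> < T\<close> holds
  only almost surely, whereas \<open>Xs\<close> and \<open>X\<close> are to agree at live times on
  every path.\<close>

definition alive :: "real \<Rightarrow> 'w \<Rightarrow> bool" where
  "alive t \<omega> \<longleftrightarrow> ennreal t < \<tau> \<omega> \<and> ennreal t < T \<omega>"

definition euler :: "real \<Rightarrow> nat \<Rightarrow> 'w \<Rightarrow> real ^ 'n" where
  "euler \<Delta> i \<omega> = x0 + (\<Sum>m<i. \<Delta> *\<^sub>R b (Xs (real m * \<Delta>) \<omega>) +
     \<sigma> (Xs (real m * \<Delta>) \<omega>) *v (W (real (Suc m) * \<Delta>) \<omega> - W (real m * \<Delta>) \<omega>))"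

lemma Xs_in_S: "\<omega> \<in> space P \<Longrightarrow> 0 \<le> t \<Longrightarrow> Xs t \<omega> \<in> S"
  using X_in_S x0_S by (simp add: Xs_def)

lemma alive_Xs: "alive t \<omega> \<Longrightarrow> Xs t \<omega> = X t \<omega>"
  by (simp add: alive_def Xs_def)

lemma alive_mono: "alive t \<omega> \<Longrightarrow> s \<le> t \<Longrightarrow> alive s \<omega>"
  unfolding alive_def by (meson ennreal_leI le_less_trans)

lemma alive_pred [measurable]: "Measurable.pred (F (ennreal t)) (alive t)"
  unfolding alive_def[abs_def]
  using stopping_timeD2[OF T_stopping, of "ennreal t"] stopping_timeD2[OF \<tau>_stopping, of "ennreal t"]
  by (intro pred_intros_logic)

lemma Xs_measurable:
  assumes "0 \<le> t"
  shows "Xs t \<in> borel_measurable (F (ennreal t))"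
proof -
  have eq: "sets (restrict_space (F (ennreal t)) {\<omega> \<in> space P. ennreal t < T \<omega>}) =
      sets (restrict_space (F (ennreal t)) {\<omega>. ennreal t < T \<omega>})"
    unfolding sets_restrict_space
  proof (rule image_cong[OF refl])
    fix A assume "A \<in> sets (F (ennreal t))"
    then have "A \<subseteq> space P" using sets.sets_into_space space_F by blast
    then show "{\<omega> \<in> space P. ennreal t < T \<omega>} \<inter> A = {\<omega>. ennreal t < T \<omega>} \<inter> A" by blast
  qed
  have T: "{\<omega> \<in> space (F (ennreal t)). ennreal t < T \<omega>} \<in> sets (F (ennreal t))"
    using stopping_timeD2[OF T_stopping, of "ennreal t"] by (simp add: Measurable.pred_def)
  show ?thesis
    unfolding Xs_def[abs_def] measurable_If_restrict_space_iff[OF T]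
    using X_measurable[OF assms] unfolding measurable_cong_sets[OF eq refl] by simp
qed

lemma Xs_compose_measurable:
  fixes \<psi> :: "real ^ 'n \<Rightarrow> 'b :: topological_space"
  assumes "0 \<le> t" "continuous_on S \<psi>"
  shows "(\<lambda>\<omega>. \<psi> (Xs t \<omega>)) \<in> borel_measurable (F (ennreal t))"
proof (rule borel_measurable_continuous_on_compose[OF _ assms(2) Xs_measurable[OF assms(1)]])
  show "S \<in> sets borel" using open_S by (rule borel_open)
  show "\<And>\<omega>. \<omega> \<in> space (F (ennreal t)) \<Longrightarrow> Xs t \<omega> \<in> S"
    using Xs_in_S assms(1) unfolding space_F by blast
qed

lemma euler_measurable:
  assumes "0 \<le> \<Delta>"
  shows "euler \<Delta> i \<in> borel_measurable P"
proof -
  have t: "0 \<le> real m * \<Delta>" for m using assms by simp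
  note [measurable] = F_measurable[OF Xs_compose_measurable[OF t cont_b]]
    F_measurable[OF Xs_compose_measurable[OF t cont_\<sigma>]] W_measurable[OF t]
  show ?thesis unfolding euler_def by measurable
qed

text \<open>At a live grid point the integral equation holds without stopping, so the distance
  splits into the Riemann-sum error of the drift, event \<open>C n\<close>, and the error of the
  sampled Ito integral, event \<open>B n\<close>. The former vanishes pathwise by continuity up to
  \<open>\<tau>\<close>, the latter in probability by
  \<open>ito_integral_grid_approximation\<close>.\<close>

lemma euler_close:
  assumes l: "0 < l" and d: "0 < d"
  defines "t \<equiv> \<lambda>n i. real i * (l / real (Suc n))"
  shows "{\<omega> \<in> space P. \<exists>i\<le>Suc n. alive (t n i) \<omega> \<and> d \<le> norm (euler (l / real (Suc n)) i \<omega> - Xs (t n i) \<omega>)} \<in> events"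
    and "(\<lambda>n. prob {\<omega> \<in> space P. \<exists>i\<le>Suc n. alive (t n i) \<omega> \<and> d \<le> norm (euler (l / real (Suc n)) i \<omega> - Xs (t n i) \<omega>)}) \<longlonglongrightarrow> 0"
proof -
  have t: "0 \<le> t n i" for n i using l by (simp add: t_def)
  have grid_ev: "{\<omega> \<in> space P. \<exists>i\<le>Suc n. Q i \<omega>} \<in> events" if "\<And>i. {\<omega> \<in> space P. Q i \<omega>} \<in> events" for n and Q :: "nat \<Rightarrow> 'w \<Rightarrow> bool"
  proof -
    have "{\<omega> \<in> space P. \<exists>i\<le>Suc n. Q i \<omega>} = (\<Union>i\<in>{..Suc n}. {\<omega> \<in> space P. Q i \<omega>})" by auto
    also have "\<dots> \<in> events" using that by (intro sets.finite_UN) auto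
    finally show ?thesis .
  qed
  define H where "H s \<omega> = (if ennreal s < \<tau> \<omega> then \<sigma> (X s \<omega>) else 0)" for s \<omega>
  have itoH: "ito_integral P F W H I" using ito unfolding H_def[abs_def] .
  have I: "I s \<in> borel_measurable P" if "0 \<le> s" for s
    using ito that by (auto simp: ito_integral_def)
  let ?R = "\<lambda>n i \<omega>. \<Sum>m<i. (l / real (Suc n)) *\<^sub>R b (Xs (t n m) \<omega>)"
  let ?S = "\<lambda>n i. step_integral W (Suc n) (t n) (\<lambda>i. H (t n i)) (t n i)"
  define A where "A n = {\<omega> \<in> space P. \<exists>i\<le>Suc n. alive (t n i) \<omega> \<and> d \<le> norm (euler (l / real (Suc n)) i \<omega> - Xs (t n i) \<omega>)}" for n
  define B where "B n = {\<omega> \<in> space P. \<exists>i\<le>Suc n. d / 3 < norm (?S n i \<omega> - I (t n i) \<omega>)}" for n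
  define C where "C n = {\<omega> \<in> space P. \<exists>i\<le>Suc n. alive (t n i) \<omega> \<and> d / 3 \<le> norm (?R n i \<omega> - (Xs (t n i) \<omega> - x0 - I (t n i) \<omega>))}" for n
  have alive_P [measurable]: "Measurable.pred P (alive (t n i))" for n i
    using F_measurable[OF alive_pred] by simp
  have Xs_P [measurable]: "Xs (t n i) \<in> borel_measurable P" for n i
    by (rule F_measurable[OF Xs_measurable[OF t]])
  have A_ev: "A n \<in> events" for n
    unfolding A_def
  proof (rule grid_ev)
    fix i
    have [measurable]: "euler (l / real (Suc n)) i \<in> borel_measurable P" using l by (intro euler_measurable) simp
    show "{\<omega> \<in> space P. alive (t n i) \<omega> \<and> d \<le> norm (euler (l / real (Suc n)) i \<omega> - Xs (t n i) \<omega>)} \<in> events"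
      by measurable
  qed
  then show "{\<omega> \<in> space P. \<exists>i\<le>Suc n. alive (t n i) \<omega> \<and> d \<le> norm (euler (l / real (Suc n)) i \<omega> - Xs (t n i) \<omega>)} \<in> events"
    unfolding A_def .
  have B_ev: "B n \<in> events" for n
    unfolding B_def
  proof (rule grid_ev)
    fix i
    have [measurable]: "?S n i \<in> borel_measurable P"
      using itoH t by (intro step_integral_measurable F_measurable[of _ "ennreal (t n _)"]) (auto simp: ito_integral_def)
    note [measurable] = I[OF t[of n i]]
    show "{\<omega> \<in> space P. d / 3 < norm (?S n i \<omega> - I (t n i) \<omega>)} \<in> events" by measurable
  qed
  have C_ev: "C n \<in> events" for n
    unfolding C_def
  proof (rule grid_ev)
    fix i
    have [measurable]: "?R n i \<in> borel_measurable P"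
    proof -
      note [measurable] = F_measurable[OF Xs_compose_measurable[OF t cont_b]]
      show ?thesis by measurable
    qed
    note [measurable] = I[OF t[of n i]]
    show "{\<omega> \<in> space P. alive (t n i) \<omega> \<and> d / 3 \<le> norm (?R n i \<omega> - (Xs (t n i) \<omega> - x0 - I (t n i) \<omega>))} \<in> events"
      by measurable
  qed
  have path: "0 \<le> enn2real (\<tau> \<omega>)" "ennreal (enn2real (\<tau> \<omega>)) = \<tau> \<omega>"
    "continuous_on {0..enn2real (\<tau> \<omega>)} (\<lambda>s. b (X s \<omega>))" "continuous_on {0..enn2real (\<tau> \<omega>)} (\<lambda>s. \<sigma> (X s \<omega>))"
    if \<omega>: "\<omega> \<in> space P" and less: "\<tau> \<omega> < T \<omega>" for \<omega>
  proof -
    show "0 \<le> enn2real (\<tau> \<omega>)" by simp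
    have "\<tau> \<omega> < top" using less by (rule less_le_trans) simp
    then show e: "ennreal (enn2real (\<tau> \<omega>)) = \<tau> \<omega>" by simp
    have sub: "{0..enn2real (\<tau> \<omega>)} \<subseteq> {t. 0 \<le> t \<and> ennreal t < T \<omega>}"
    proof safe
      fix s assume s: "s \<in> {0..enn2real (\<tau> \<omega>)}"
      then show "0 \<le> s" by simp
      have "ennreal s \<le> ennreal (enn2real (\<tau> \<omega>))" using s by (intro ennreal_leI) simp
      then show "ennreal s < T \<omega>" unfolding e using less by (rule le_less_trans)
    qed
    have cX: "continuous_on {0..enn2real (\<tau> \<omega>)} (\<lambda>s. X s \<omega>)"
      using X_continuous[OF \<omega>] sub by (rule continuous_on_subset)
    have im: "(\<lambda>s. X s \<omega>) ` {0..enn2real (\<tau> \<omega>)} \<subseteq> S"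
      using sub X_in_S[OF \<omega>] by auto
    show "continuous_on {0..enn2real (\<tau> \<omega>)} (\<lambda>s. b (X s \<omega>))" by (rule continuous_on_compose2[OF cont_b cX im])
    show "continuous_on {0..enn2real (\<tau> \<omega>)} (\<lambda>s. \<sigma> (X s \<omega>))" by (rule continuous_on_compose2[OF cont_\<sigma> cX im])
  qed
  have B_lim: "(\<lambda>n. prob (B n)) \<longlonglongrightarrow> 0"
    unfolding B_def t_def
  proof (rule ito_integral_grid_approximation[OF itoH l])
    show "0 < d / 3" using d by simp
    show "AE \<omega> in P. (\<lambda>n. \<integral>\<^sup>+ s\<in>{0..l}. ennreal ((norm (step_process (Suc n) (\<lambda>i. real i * (l / real (Suc n)))
      (\<lambda>i. H (real i * (l / real (Suc n)))) s \<omega> - H s \<omega>))\<^sup>2) \<partial>lborel) \<longlonglongrightarrow> 0"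
      using \<tau>_less AE_space
    proof eventually_elim
      case (elim \<omega>)
      note p = path[OF elim(2,1)]
      have "H s \<omega> = (if s < enn2real (\<tau> \<omega>) then \<sigma> (X s \<omega>) else 0)" if "0 \<le> s" for s
        using that ennreal_less_iff[OF that, of "enn2real (\<tau> \<omega>)"] unfolding p(2) H_def by simp
      from step_process_stopped_path_tendsto[OF p(4,1) l this, of \<omega>]
      show ?case unfolding step_process_def .
    qed
  qed
  have C_lim: "(\<lambda>n. prob (C n)) \<longlonglongrightarrow> 0"
  proof (rule prob_tendsto_zero[OF C_ev])
    show "AE \<omega> in P. \<forall>\<^sub>F n in sequentially. \<omega> \<notin> C n"
      using \<tau>_less equation AE_space
    proof eventually_elim
      case (elim \<omega>)
      note p = path[OF elim(3,1)]
      let ?\<theta> = "enn2real (\<tau> \<omega>)"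
      obtain \<delta> where \<delta>: "0 < \<delta>" "\<And>\<Delta> i. 0 < \<Delta> \<Longrightarrow> \<Delta> < \<delta> \<Longrightarrow> real i * \<Delta> \<le> ?\<theta> \<Longrightarrow>
          norm ((\<Sum>m<i. \<Delta> *\<^sub>R b (X (real m * \<Delta>) \<omega>)) - (LINT s:{0..real i * \<Delta>}|lborel. b (X s \<omega>))) < d / 3"
        using riemann_sum_uniform[OF p(3,1), of "d / 3"] d by auto
      have "(\<lambda>n. l / real (Suc n)) \<longlonglongrightarrow> 0"
        using tendsto_mult[OF tendsto_const[of l] LIMSEQ_inverse_real_of_nat] by (simp add: divide_inverse)
      then have "\<forall>\<^sub>F n in sequentially. l / real (Suc n) < \<delta>" by (rule order_tendstoD(2)) (rule \<delta>(1))
      then show ?case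
      proof eventually_elim
        case (elim n)
        show ?case
        proof
          assume "\<omega> \<in> C n"
          then obtain i where i: "alive (t n i) \<omega>" "d / 3 \<le> norm (?R n i \<omega> - (Xs (t n i) \<omega> - x0 - I (t n i) \<omega>))"
            unfolding C_def by blast
          have lt: "ennreal (t n i) < \<tau> \<omega>" using i(1) by (simp add: alive_def)
          then have le: "t n i \<le> ?\<theta>"
            using ennreal_less_iff[OF t[of n i], of ?\<theta>] unfolding p(2) by simp
          have r: "enn2real (min (ennreal (t n i)) (\<tau> \<omega>)) = t n i"
            using lt t[of n i] by (simp add: min_absorb1 less_imp_le)
          have "X (t n i) \<omega> = x0 + (LINT s:{0..t n i}|lborel. b (X s \<omega>)) + I (t n i) \<omega>"
            using \<open>\<forall>t\<ge>0. let r = enn2real (min (ennreal t) (\<tau> \<omega>)) in X r \<omega> = x0 + (LINT s:{0..r}|lborel. b (X s \<omega>)) + I t \<omega>\<close> t[of n i]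
            unfolding Let_def by (metis r)
          then have eq1: "Xs (t n i) \<omega> - x0 - I (t n i) \<omega> = (LINT s:{0..t n i}|lborel. b (X s \<omega>))"
            unfolding alive_Xs[OF i(1)] by simp
          have eq2: "?R n i \<omega> = (\<Sum>m<i. (l / real (Suc n)) *\<^sub>R b (X (t n m) \<omega>))"
          proof (rule sum.cong[OF refl])
            fix m assume "m \<in> {..<i}"
            then have "t n m \<le> t n i" using l by (simp add: t_def divide_right_mono)
            then have "alive (t n m) \<omega>" by (rule alive_mono[OF i(1)])
            then show "(l / real (Suc n)) *\<^sub>R b (Xs (t n m) \<omega>) = (l / real (Suc n)) *\<^sub>R b (X (t n m) \<omega>)"
              by (simp only: alive_Xs)
          qed
          have "norm ((\<Sum>m<i. (l / real (Suc n)) *\<^sub>R b (X (t n m) \<omega>)) - (LINT s:{0..t n i}|lborel. b (X s \<omega>))) < d / 3"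
            unfolding t_def by (rule \<delta>(2)[OF _ elim le[unfolded t_def]]) (use l in simp)
          then show False using i(2) unfolding eq1 eq2 by linarith
        qed
      qed
    qed
  qed
  have sub: "A n \<subseteq> B n \<union> C n" for n
  proof
    fix \<omega> assume "\<omega> \<in> A n"
    then obtain i where i: "\<omega> \<in> space P" "i \<le> Suc n" "alive (t n i) \<omega>" "d \<le> norm (euler (l / real (Suc n)) i \<omega> - Xs (t n i) \<omega>)"
      unfolding A_def by blast
    have tm: "t n m \<le> t n i" if "m \<le> i" for m i
      unfolding t_def using that l by (intro mult_right_mono) auto
    \<comment> \<open>All grid times before a live one are live, so the sampled integrand there is
      \<open>\<sigma>\<close> along \<open>Xs\<close>. Cells starting at or after
      \<open>t n i\<close> contribute nothing, since both minima equal \<open>t n i\<close>. What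
      remains is the noise part of \<open>euler\<close>.\<close>
    have "?S n i \<omega> = (\<Sum>m<Suc n. if m < i then \<sigma> (Xs (t n m) \<omega>) *v (W (t n (Suc m)) \<omega> - W (t n m) \<omega>) else 0)"
      unfolding step_integral_def
    proof (rule sum.cong[OF refl])
      fix m assume "m \<in> {..<Suc n}"
      show "H (t n m) \<omega> *v (W (min (t n i) (t n (Suc m))) \<omega> - W (min (t n i) (t n m)) \<omega>) =
          (if m < i then \<sigma> (Xs (t n m) \<omega>) *v (W (t n (Suc m)) \<omega> - W (t n m) \<omega>) else 0)"
      proof (cases "m < i")
        case True
        then have "alive (t n m) \<omega>" using tm[of m i] by (intro alive_mono[OF i(3)]) simp
        then have "H (t n m) \<omega> = \<sigma> (Xs (t n m) \<omega>)" by (simp add: H_def alive_def Xs_def)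
        then show ?thesis using True tm[of m i] tm[of "Suc m" i] by (simp add: min_absorb2)
      next
        case False
        then show ?thesis using tm[of i m] tm[of i "Suc m"] by (simp add: min_absorb1)
      qed
    qed
    also have "\<dots> = (\<Sum>m<i. \<sigma> (Xs (t n m) \<omega>) *v (W (t n (Suc m)) \<omega> - W (t n m) \<omega>))"
      using i(2) by (intro sum.mono_neutral_cong_right) auto
    finally have euler_eq: "euler (l / real (Suc n)) i \<omega> - Xs (t n i) \<omega> =
        (?R n i \<omega> - (Xs (t n i) \<omega> - x0 - I (t n i) \<omega>)) + (?S n i \<omega> - I (t n i) \<omega>)"
      by (simp add: euler_def t_def sum.distrib)
    have "d \<le> norm (?R n i \<omega> - (Xs (t n i) \<omega> - x0 - I (t n i) \<omega>)) + norm (?S n i \<omega> - I (t n i) \<omega>)"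
      using i(4) unfolding euler_eq by (rule order_trans[OF _ norm_triangle_ineq])
    then have "d / 3 \<le> norm (?R n i \<omega> - (Xs (t n i) \<omega> - x0 - I (t n i) \<omega>)) \<or> d / 3 < norm (?S n i \<omega> - I (t n i) \<omega>)"
      using d by linarith
    then show "\<omega> \<in> B n \<union> C n" using i(1-3) unfolding B_def C_def by blast
  qed
  have "(\<lambda>n. prob (A n)) \<longlonglongrightarrow> 0"
  proof (rule tendsto_sandwich[OF _ _ tendsto_const])
    show "(\<lambda>n. prob (B n) + prob (C n)) \<longlonglongrightarrow> 0" using tendsto_add[OF B_lim C_lim] by simp
    show "\<forall>\<^sub>F n in sequentially. prob (A n) \<le> prob (B n) + prob (C n)"
    proof (rule always_eventually, rule allI)
      fix n
      have "prob (A n) \<le> prob (B n \<union> C n)" using B_ev C_ev by (intro finite_measure_mono sub) auto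
      also have "\<dots> \<le> prob (B n) + prob (C n)" using B_ev C_ev by (intro measure_Un_le) auto
      finally show "prob (A n) \<le> prob (B n) + prob (C n)" .
    qed
  qed simp
  then show "(\<lambda>n. prob {\<omega> \<in> space P. \<exists>i\<le>Suc n. alive (t n i) \<omega> \<and> d \<le> norm (euler (l / real (Suc n)) i \<omega> - Xs (t n i) \<omega>)}) \<longlonglongrightarrow> 0"
    unfolding A_def .
qed

end

section \<open>Exit probabilities\<close>

context stopped_solution
begin

text \<open>Being alive is inherited by earlier times and the path is continuous, so an exceedance
  at \<open>t\<close> persists at all times slightly to the left of \<open>t\<close>. Hence rational
  times suffice for measurability, and fine grids will detect the exceedance too.\<close>

lemma exit_event_measurable:
  assumes V: "continuous_on S (V :: real ^ 'n \<Rightarrow> real)"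
  shows "{\<omega> \<in> space P. \<exists>t\<in>{0..l}. alive t \<omega> \<and> c < V (Xs t \<omega>)} \<in> events"
    and "\<omega> \<in> space P \<Longrightarrow> 0 \<le> t \<Longrightarrow> alive t \<omega> \<Longrightarrow> c < V (Xs t \<omega>) \<Longrightarrow>
      \<exists>\<delta>>0. \<forall>s. 0 \<le> s \<longrightarrow> s \<le> t \<longrightarrow> t - s < \<delta> \<longrightarrow> alive s \<omega> \<and> c < V (Xs s \<omega>)"
proof -
  have left: "\<exists>\<delta>>0. \<forall>s. 0 \<le> s \<longrightarrow> s \<le> t \<longrightarrow> t - s < \<delta> \<longrightarrow> alive s \<omega> \<and> c < V (Xs s \<omega>)"
    if \<omega>: "\<omega> \<in> space P" and t: "0 \<le> t" "alive t \<omega>" "c < V (Xs t \<omega>)" for \<omega> t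
  proof -
    let ?D = "{s. 0 \<le> s \<and> ennreal s < T \<omega>}"
    have "continuous_on ?D (\<lambda>s. V (X s \<omega>))"
      by (rule continuous_on_compose2[OF V X_continuous[OF \<omega>]]) (use X_in_S[OF \<omega>] in auto)
    moreover have "t \<in> ?D" using t by (simp add: alive_def)
    moreover have "0 < V (X t \<omega>) - c" using t alive_Xs[OF t(2)] by simp
    ultimately obtain \<delta> where \<delta>: "0 < \<delta>" "\<forall>s\<in>?D. dist s t < \<delta> \<longrightarrow> dist (V (X s \<omega>)) (V (X t \<omega>)) < V (X t \<omega>) - c"
      unfolding continuous_on_iff by blast
    show ?thesis
    proof (intro exI[of _ \<delta>] conjI \<delta>(1) allI impI)
      fix s assume s: "0 \<le> s" "s \<le> t" "t - s < \<delta>"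
      show a: "alive s \<omega>" using t(2) s(2) by (rule alive_mono)
      have "s \<in> ?D" using a s(1) by (simp add: alive_def)
      moreover have "dist s t < \<delta>" using s by (simp add: dist_real_def)
      ultimately have "dist (V (X s \<omega>)) (V (X t \<omega>)) < V (X t \<omega>) - c" using \<delta>(2) by blast
      then show "c < V (Xs s \<omega>)" unfolding alive_Xs[OF a] dist_real_def by linarith
    qed
  qed
  then show "\<omega> \<in> space P \<Longrightarrow> 0 \<le> t \<Longrightarrow> alive t \<omega> \<Longrightarrow> c < V (Xs t \<omega>) \<Longrightarrow>
      \<exists>\<delta>>0. \<forall>s. 0 \<le> s \<longrightarrow> s \<le> t \<longrightarrow> t - s < \<delta> \<longrightarrow> alive s \<omega> \<and> c < V (Xs s \<omega>)" .
  have "{\<omega> \<in> space P. \<exists>t\<in>{0..l}. alive t \<omega> \<and> c < V (Xs t \<omega>)} =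
      (\<Union>q\<in>\<rat> \<inter> {0..l}. {\<omega> \<in> space P. alive q \<omega> \<and> c < V (Xs q \<omega>)})"
  proof (intro equalityI subsetI)
    fix \<omega> assume "\<omega> \<in> {\<omega> \<in> space P. \<exists>t\<in>{0..l}. alive t \<omega> \<and> c < V (Xs t \<omega>)}"
    then obtain t where t: "\<omega> \<in> space P" "0 \<le> t" "t \<le> l" "alive t \<omega>" "c < V (Xs t \<omega>)" by auto
    obtain \<delta> where \<delta>: "0 < \<delta>" "\<And>s. 0 \<le> s \<Longrightarrow> s \<le> t \<Longrightarrow> t - s < \<delta> \<Longrightarrow> alive s \<omega> \<and> c < V (Xs s \<omega>)"
      using left[OF t(1,2,4,5)] by blast
    obtain q where q: "q \<in> \<rat>" "0 \<le> q" "q \<le> t" "t - q < \<delta>"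
    proof (cases "t = 0")
      case True
      show thesis using \<delta>(1) True by (intro that[of 0]) auto
    next
      case False
      then have "max 0 (t - \<delta>) < t" using t(2) \<delta>(1) by simp
      then obtain q where "q \<in> \<rat>" "max 0 (t - \<delta>) < q" "q < t" using Rats_dense_in_real by blast
      then show thesis by (intro that[of q]) auto
    qed
    have "q \<in> \<rat> \<inter> {0..l}" using q t(3) by simp
    moreover have "alive q \<omega> \<and> c < V (Xs q \<omega>)" using q by (intro \<delta>(2))
    ultimately show "\<omega> \<in> (\<Union>q\<in>\<rat> \<inter> {0..l}. {\<omega> \<in> space P. alive q \<omega> \<and> c < V (Xs q \<omega>)})"
      using t(1) by blast
  qed blast
  also have "\<dots> \<in> events"
  proof (rule sets.countable_UN'')
    show "countable (\<rat> \<inter> {0..l})" using countable_rat by blast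
    fix q assume "q \<in> \<rat> \<inter> {0..l}"
    then have [measurable]: "(\<lambda>\<omega>. V (Xs q \<omega>)) \<in> borel_measurable P"
      by (intro F_measurable[OF Xs_compose_measurable] V) auto
    have [measurable]: "Measurable.pred P (alive q)" using F_measurable[OF alive_pred] by simp
    show "{\<omega> \<in> space P. alive q \<omega> \<and> c < V (Xs q \<omega>)} \<in> events" by measurable
  qed
  finally show "{\<omega> \<in> space P. \<exists>t\<in>{0..l}. alive t \<omega> \<and> c < V (Xs t \<omega>)} \<in> events" .
qed

lemma exit_probability:
  fixes V :: "real ^ 'n \<Rightarrow> real"
  assumes V: "has_C2 S V DV D2V" and V_nonneg: "\<And>x. x \<in> S \<Longrightarrow> 0 \<le> V x"
    and K: "compact {x \<in> S. V x \<le> c}" and c: "0 < c" and l: "0 < l" and \<gamma>: "0 \<le> \<gamma>"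
    and gen: "\<And>x. x \<in> S \<Longrightarrow> DV x \<bullet> b x + 1/2 * trace (\<sigma> x ** transpose (\<sigma> x) ** D2V x) \<le> \<gamma> * V x"
  shows "prob {\<omega> \<in> space P. \<exists>t\<in>{0..l}. alive t \<omega> \<and> c < V (Xs t \<omega>)} \<le> exp (\<gamma> * l) * trunc c (V x0) / c ^ 3"
proof -
  define G where "G x = (if x \<in> S then trunc c (V x) else c ^ 3)" for x
  define DG where "DG x = (if x \<in> S then trunc' c (V x) *\<^sub>R DV x else 0)" for x
  define D2 where "D2 x = (if x \<in> S then trunc' c (V x) *\<^sub>R D2V x + trunc'' c (V x) *\<^sub>R outer (DV x) else 0)" for x
  obtain B where "C2_uniform G DG D2 B"
    using C2_uniform_trunc[OF open_S V K] unfolding G_def[abs_def] DG_def[abs_def] D2_def[abs_def] by blast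
  then interpret C2_uniform G DG D2 B .
  interpret wiener_C2 P F W G DG D2 B by unfold_locales
  have cV: "continuous_on S V"
    using V has_derivative_continuous_on[of S V "\<lambda>x v. DV x \<bullet> v"]
    unfolding has_C2_def by (blast intro: has_derivative_at_withinI)
  have G_nonneg: "0 \<le> G x" for x
    using trunc_bounds(1)[of c "V x"] V_nonneg[of x] c by (auto simp: G_def)
  have G_gen: "generator x (b x) (\<sigma> x) \<le> \<gamma> * G x" if "x \<in> S" for x
    unfolding generator_def G_def DG_def D2_def
    using that trunc_generator_le[OF less_imp_le[OF c] V_nonneg[OF that] \<gamma> gen[OF that]] by simp
  have G_out: "G x = c ^ 3" if "x \<in> S" "c < V x" for x
    using that by (simp add: G_def trunc_def)
  let ?K = "{x \<in> S. V x \<le> c}"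
  have "bounded (b ` ?K)" "bounded (\<sigma> ` ?K)"
    by (intro compact_imp_bounded compact_continuous_image K continuous_on_subset[OF cont_b] continuous_on_subset[OF cont_\<sigma>]; blast)+
  then obtain C1 C2 where C1: "\<forall>y\<in>b ` ?K. norm y \<le> C1" and C2: "\<forall>y\<in>\<sigma> ` ?K. norm y \<le> C2"
    unfolding bounded_iff by blast
  have C12: "norm (b x) \<le> C1" "norm (\<sigma> x) \<le> C2" if "x \<in> ?K" for x
    using C1 C2 that by blast+
  \<comment> \<open>The compact set may be empty, in which case \<open>C1\<close> and
    \<open>C2\<close> are arbitrary; the maximum with 0 guarantees a nonnegative bound.\<close>
  define C where "C = max 0 (max C1 C2)"
  have C: "0 \<le> C" "norm (b x) \<le> C" "norm (\<sigma> x) \<le> C" if "x \<in> S" "V x \<le> c" for x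
    using C12[of x] that by (auto simp: C_def le_max_iff_disj)
  have C0: "0 \<le> C" by (simp add: C_def)
  define E where "E = {\<omega> \<in> space P. \<exists>t\<in>{0..l}. alive t \<omega> \<and> c < V (Xs t \<omega>)}"
  have E_ev: "E \<in> events" unfolding E_def by (rule exit_event_measurable(1)[OF cV])
  define \<kappa> where "\<kappa> = C + CARD('n) * C\<^sup>2 + \<gamma>"
  define k1 where "k1 = C + real CARD('d) * C\<^sup>2 + real CARD('n) * C\<^sup>2"
  have bound_e: "prob E \<le> exp (\<gamma> * l) * (G x0 + l * (e * \<kappa> + e * k1)) / (c ^ 3 - e)"
    if e: "0 < e" "e < c ^ 3" for e
  proof -
    obtain d where d: "0 < d" "\<And>x y. norm (x - y) < d \<Longrightarrow> \<bar>G x - G y\<bar> \<le> e"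
      "\<And>x y. norm (x - y) < d \<Longrightarrow> norm (DG x - DG y) \<le> e" "\<And>x y. norm (x - y) < d \<Longrightarrow> norm (D2 x - D2 y) \<le> e"
      using modulus[OF e(1)] by blast
    define t where "t n i = real i * (l / real (Suc n))" for n i
    have t0: "0 \<le> t n i" for n i using l by (simp add: t_def)
    have t_mono: "t n m \<le> t n i" if "m \<le> i" for m i n
      unfolding t_def using that l by (intro mult_right_mono) auto
    define A where "A n = {\<omega> \<in> space P. \<exists>i\<le>Suc n. alive (t n i) \<omega> \<and> d \<le> norm (euler (l / real (Suc n)) i \<omega> - Xs (t n i) \<omega>)}" for n
    define En where "En n = {\<omega> \<in> space P. \<exists>i\<le>Suc n. alive (t n i) \<omega> \<and> c < V (Xs (t n i) \<omega>)}" for n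
    have A_ev: "A n \<in> events" for n unfolding A_def t_def by (rule euler_close(1)[OF l d(1)])
    have A_lim: "(\<lambda>n. prob (A n)) \<longlonglongrightarrow> 0" unfolding A_def t_def by (rule euler_close(2)[OF l d(1)])
    have VX [measurable]: "(\<lambda>\<omega>. V (Xs (t n i) \<omega>)) \<in> borel_measurable (F (ennreal (t n i)))" for n i
      by (rule Xs_compose_measurable[OF t0 cV])
    have En_ev: "En n \<in> events" for n
    proof -
      have "En n = (\<Union>i\<in>{..Suc n}. {\<omega> \<in> space P. alive (t n i) \<omega> \<and> c < V (Xs (t n i) \<omega>)})"
        by (auto simp: En_def)
      also have "\<dots> \<in> events"
      proof (rule sets.finite_UN)
        fix i
        have [measurable]: "Measurable.pred P (alive (t n i))" "(\<lambda>\<omega>. V (Xs (t n i) \<omega>)) \<in> borel_measurable P"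
          using F_measurable[OF alive_pred] F_measurable[OF VX] by auto
        show "{\<omega> \<in> space P. alive (t n i) \<omega> \<and> c < V (Xs (t n i) \<omega>)} \<in> events" by measurable
      qed simp
      finally show ?thesis .
    qed
    \<comment> \<open>Requiring the condition at all grid points up to \<open>i\<close> makes
      freezing permanent: once a level has been exceeded, a later return below \<open>c\<close> does
      not restart the scheme.\<close>
    define g where "g n i \<omega> \<longleftrightarrow> (\<forall>m\<in>{..i}. alive (t n m) \<omega> \<and> V (Xs (t n m) \<omega>) \<le> c)" for n i \<omega>
    have g_pred: "Measurable.pred (F (ennreal (t n i))) (g n i)" for n i
      unfolding g_def[abs_def]
    proof (intro pred_intros_finite pred_intros_logic finite_atMost)
      fix m assume m: "m \<in> {..i}"
      then have le: "ennreal (t n m) \<le> ennreal (t n i)" by (intro ennreal_leI t_mono) simp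
      show "Measurable.pred (F (ennreal (t n i))) (alive (t n m))" by (rule F_mono[OF alive_pred le])
      have [measurable]: "(\<lambda>\<omega>. V (Xs (t n m) \<omega>)) \<in> borel_measurable (F (ennreal (t n i)))" by (rule F_mono[OF VX le])
      show "Measurable.pred (F (ennreal (t n i))) (\<lambda>\<omega>. V (Xs (t n m) \<omega>) \<le> c)" by measurable
    qed
    define \<beta> where "\<beta> n i \<omega> = (if g n i \<omega> then b (Xs (t n i) \<omega>) else 0)" for n i \<omega>
    define \<eta> where "\<eta> n i \<omega> = (if g n i \<omega> then \<sigma> (Xs (t n i) \<omega>) else 0)" for n i \<omega>
    define Z where "Z n i \<omega> = x0 + (\<Sum>m<i. (l / real (Suc n)) *\<^sub>R \<beta> n m \<omega> +
        \<eta> n m \<omega> *v (W (real (Suc m) * (l / real (Suc n))) \<omega> - W (real m * (l / real (Suc n))) \<omega>))" for n i \<omega>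
    have \<beta>_meas: "\<beta> n i \<in> borel_measurable (F (ennreal (t n i)))" and \<eta>_meas: "\<eta> n i \<in> borel_measurable (F (ennreal (t n i)))" for n i
    proof -
      note [measurable] = g_pred[of n i] Xs_compose_measurable[OF t0[of n i] cont_b] Xs_compose_measurable[OF t0[of n i] cont_\<sigma>]
      show "\<beta> n i \<in> borel_measurable (F (ennreal (t n i)))" "\<eta> n i \<in> borel_measurable (F (ennreal (t n i)))"
        unfolding \<beta>_def \<eta>_def by measurable
    qed
    have g_C: "norm (\<beta> n i \<omega>) \<le> C" "norm (\<eta> n i \<omega>) \<le> C" if "\<omega> \<in> space P" for n i \<omega>
      using C[OF Xs_in_S[OF that t0[of n i]]] C0 by (auto simp: \<beta>_def \<eta>_def g_def)
    have Z_euler: "Z n i \<omega> = euler (l / real (Suc n)) i \<omega>" if "\<And>m. m < i \<Longrightarrow> g n m \<omega>" for n i \<omega>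
      unfolding Z_def euler_def \<beta>_def \<eta>_def using that by (simp add: t_def)
    define \<rho> where "\<rho> n = e * \<kappa> + \<kappa> * B * prob (A n) + (e * k1 + 3 * B * C ^ 4 * (real CARD('d))\<^sup>2 / d\<^sup>2 * (l / real (Suc n)))" for n
    have g_mono: "g n m \<omega>" if "g n i \<omega>" "m \<le> i" for n m i \<omega>
      using that unfolding g_def by auto
    have not_A: "norm (euler (l / real (Suc n)) i \<omega> - Xs (t n i) \<omega>) < d"
      if "\<omega> \<in> space P - A n" "i \<le> Suc n" "alive (t n i) \<omega>" for n i \<omega>
      using that unfolding A_def by (auto simp: not_le)
    have expect: "Z n (Suc n) \<in> borel_measurable P"
        "expectation (\<lambda>\<omega>. G (Z n (Suc n) \<omega>)) \<le> exp (\<gamma> * l) * (G x0 + l * \<rho> n)"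
      if small: "l / real (Suc n) * C < d" for n
    proof -
      let ?\<Delta> = "l / real (Suc n)"
      have dl: "0 < ?\<Delta>" and Nl: "real (Suc n) * ?\<Delta> = l" using l by simp_all
      have frozen: "\<not> g n i \<omega> \<Longrightarrow> \<beta> n i \<omega> = 0 \<and> \<eta> n i \<omega> = 0" for i \<omega>
        by (simp add: \<beta>_def \<eta>_def)
      have gen': "generator (Xs (t n i) \<omega>) (\<beta> n i \<omega>) (\<eta> n i \<omega>) \<le> \<gamma> * G (Xs (t n i) \<omega>)"
        if "\<omega> \<in> space P" "g n i \<omega>" for i \<omega>
        using G_gen[OF Xs_in_S[OF that(1) t0]] that(2) by (simp add: \<beta>_def \<eta>_def)
      have close: "norm (Z n i \<omega> - Xs (t n i) \<omega>) < d" if "i < Suc n" "\<omega> \<in> space P - A n" "g n i \<omega>" for i \<omega>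
      proof -
        have "Z n i \<omega> = euler ?\<Delta> i \<omega>" by (rule Z_euler, rule g_mono[OF that(3)]) simp
        moreover have "alive (t n i) \<omega>" using that(3) by (simp add: g_def)
        ultimately show ?thesis using not_A[of \<omega> n i] that by simp
      qed
      note gs = grid_supermartingale[where N = "Suc n" and \<beta> = "\<beta> n" and \<eta> = "\<eta> n" and g = "g n" and Y = "\<lambda>i. Xs (t n i)"
          and A = "A n" and ?x0.0 = x0,
          OF dl \<beta>_meas[unfolded t_def] \<eta>_meas[unfolded t_def] g_C(1) g_C(2) C0 d less_imp_le[OF e(1)] small \<gamma> G_nonneg A_ev
          frozen gen' close[unfolded Z_def], folded \<kappa>_def k1_def, folded \<rho>_def, folded Z_def, unfolded Nl]
      show "Z n (Suc n) \<in> borel_measurable P" by (rule gs(1))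
      show "expectation (\<lambda>\<omega>. G (Z n (Suc n) \<omega>)) \<le> exp (\<gamma> * l) * (G x0 + l * \<rho> n)" by (rule gs(2))
    qed
    \<comment> \<open>Let \<open>i\<close> be the first grid index above level \<open>c\<close>. The
      Euler sum at \<open>i\<close> uses coefficients with indices below \<open>i\<close> only, all
      of them still active, so the step that leads to the exit is included. All later coefficients
      are zero, so the terminal value is the Euler sum at \<open>i\<close>.\<close>
    have large: "c ^ 3 - e \<le> G (Z n (Suc n) \<omega>)" if \<omega>: "\<omega> \<in> En n - A n" for n \<omega>
    proof -
      let ?P = "\<lambda>i. i \<le> Suc n \<and> alive (t n i) \<omega> \<and> c < V (Xs (t n i) \<omega>)"
      have \<omega>P: "\<omega> \<in> space P - A n" and ex: "\<exists>i. ?P i" using \<omega> by (auto simp: En_def)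
      define i where "i = (LEAST i. ?P i)"
      have i: "i \<le> Suc n" "alive (t n i) \<omega>" "c < V (Xs (t n i) \<omega>)"
        using LeastI_ex[OF ex] unfolding i_def by blast+
      have least: "V (Xs (t n m) \<omega>) \<le> c" if "m < i" for m
      proof -
        have "\<not> ?P m" using not_less_Least[of m ?P] that unfolding i_def by blast
        moreover have "alive (t n m) \<omega>" using that by (intro alive_mono[OF i(2) t_mono]) simp
        ultimately show ?thesis using that i(1) by auto
      qed
      have gm: "g n m \<omega>" if "m < i" for m
        unfolding g_def using that least alive_mono[OF i(2) t_mono] by auto
      have "\<not> g n m \<omega>" if "i \<le> m" for m
      proof
        assume "g n m \<omega>"
        then have "V (Xs (t n i) \<omega>) \<le> c" using that by (simp add: g_def)
        then show False using i(3) by simp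
      qed
      then have "Z n (Suc n) \<omega> = Z n i \<omega>"
        unfolding Z_def using i(1) by (intro arg_cong2[where f = "(+)"] refl sum.mono_neutral_right) (auto simp: \<beta>_def \<eta>_def)
      also have "\<dots> = euler (l / real (Suc n)) i \<omega>" by (rule Z_euler) (rule gm)
      finally have "norm (Z n (Suc n) \<omega> - Xs (t n i) \<omega>) < d" using not_A[OF \<omega>P i(1,2)] by simp
      then have "\<bar>G (Z n (Suc n) \<omega>) - G (Xs (t n i) \<omega>)\<bar> \<le> e" by (rule d(2))
      moreover have "G (Xs (t n i) \<omega>) = c ^ 3"
        using \<omega>P by (intro G_out Xs_in_S t0 i) auto
      ultimately show ?thesis by linarith
    qed
    have step: "prob (En n) \<le> prob (A n) + exp (\<gamma> * l) * (G x0 + l * \<rho> n) / (c ^ 3 - e)"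
      if small: "l / real (Suc n) * C < d" for n
    proof -
      have [measurable]: "Z n (Suc n) \<in> borel_measurable P" by (rule expect(1)[OF small])
      have D: "En n - A n \<in> events" using En_ev A_ev by blast
      have "(c ^ 3 - e) * prob (En n - A n) = expectation (\<lambda>\<omega>. (c ^ 3 - e) * indicator (En n - A n) \<omega>)"
        using D by simp
      also have "\<dots> \<le> expectation (\<lambda>\<omega>. G (Z n (Suc n) \<omega>))"
      proof (rule integral_mono)
        show "integrable P (\<lambda>\<omega>. (c ^ 3 - e) * indicator (En n - A n) \<omega>)"
          using D by (intro integrable_mult_right integrable_real_indicator) (auto simp: emeasure_eq_measure)
        show "integrable P (\<lambda>\<omega>. G (Z n (Suc n) \<omega>))"
          using bound(1) by (intro integrable_const_bound[of _ B] AE_I2) auto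
        show "(c ^ 3 - e) * indicator (En n - A n) \<omega> \<le> G (Z n (Suc n) \<omega>)" for \<omega>
          using large[of \<omega> n] G_nonneg[of "Z n (Suc n) \<omega>"] by (cases "\<omega> \<in> En n - A n") simp_all
      qed
      also have "\<dots> \<le> exp (\<gamma> * l) * (G x0 + l * \<rho> n)" by (rule expect(2)[OF small])
      finally have "prob (En n - A n) \<le> exp (\<gamma> * l) * (G x0 + l * \<rho> n) / (c ^ 3 - e)"
        using e by (simp add: pos_le_divide_eq mult.commute)
      moreover have "prob (En n) \<le> prob (A n \<union> (En n - A n))"
        using En_ev A_ev by (intro finite_measure_mono) auto
      moreover have "prob (A n \<union> (En n - A n)) \<le> prob (A n) + prob (En n - A n)"
        using A_ev D by (intro measure_Un_le)
      ultimately show ?thesis by linarith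
    qed
    have lim0: "(\<lambda>n. l / real (Suc n)) \<longlonglongrightarrow> 0"
      using tendsto_mult[OF tendsto_const[of l] LIMSEQ_inverse_real_of_nat] by (simp add: divide_inverse)
    show ?thesis
    proof (rule prob_le_of_eventually[OF E_ev En_ev])
      show "AE \<omega> in P. \<omega> \<in> E \<longrightarrow> (\<forall>\<^sub>F n in sequentially. \<omega> \<in> En n)"
      proof (intro AE_I2 impI)
        fix \<omega> assume "\<omega> \<in> E"
        then obtain s where s: "\<omega> \<in> space P" "0 \<le> s" "s \<le> l" "alive s \<omega>" "c < V (Xs s \<omega>)" by (auto simp: E_def)
        obtain \<delta> where \<delta>: "0 < \<delta>" "\<And>r. 0 \<le> r \<Longrightarrow> r \<le> s \<Longrightarrow> s - r < \<delta> \<Longrightarrow> alive r \<omega> \<and> c < V (Xs r \<omega>)"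
          using exit_event_measurable(2)[OF cV s(1,2,4,5)] by blast
        show "\<forall>\<^sub>F n in sequentially. \<omega> \<in> En n"
          using order_tendstoD(2)[OF lim0 \<delta>(1)]
        proof eventually_elim
          case (elim n)
          \<comment> \<open>The left endpoint of the cell containing \<open>s\<close> is less than
            \<open>\<delta>\<close> before \<open>s\<close>, where the exceedance still persists.
            Time 0 lies in no left-open cell and is itself a grid point.\<close>
          have "\<exists>i\<le>Suc n. t n i \<le> s \<and> s - t n i < \<delta>"
          proof (cases "s = 0")
            case True
            then show ?thesis using \<delta>(1) by (intro exI[of _ 0]) (simp add: t_def)
          next
            case False
            obtain m where m: "m < Suc n" "real m * (l / real (Suc n)) < s" "s \<le> real (Suc m) * (l / real (Suc n))"
              by (rule uniform_grid_cell[of s "Suc n" "l / real (Suc n)"]) (use False s l in auto)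
            have "real (Suc m) * (l / real (Suc n)) = real m * (l / real (Suc n)) + l / real (Suc n)"
              unfolding of_nat_Suc[of m] distrib_right by simp
            then have "s - t n m < \<delta>" unfolding t_def using m(3) elim by linarith
            then show ?thesis using m(1,2) by (intro exI[of _ m]) (auto simp: t_def)
          qed
          then obtain i where i: "i \<le> Suc n" "t n i \<le> s" "s - t n i < \<delta>" by blast
          then show ?case using \<delta>(2)[OF t0 i(2,3)] s(1) unfolding En_def by blast
        qed
      qed
      have "(\<lambda>n. l / real (Suc n) * C) \<longlonglongrightarrow> 0"
        using tendsto_mult[OF lim0 tendsto_const[of C]] by simp
      then have "\<forall>\<^sub>F n in sequentially. l / real (Suc n) * C < d" by (rule order_tendstoD(2)) (rule d(1))
      then show "\<forall>\<^sub>F n in sequentially. prob (En n) \<le> prob (A n) + exp (\<gamma> * l) * (G x0 + l * \<rho> n) / (c ^ 3 - e)"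
        by eventually_elim (rule step)
      have "\<rho> \<longlonglongrightarrow> e * \<kappa> + \<kappa> * B * 0 + (e * k1 + 3 * B * C ^ 4 * (real CARD('d))\<^sup>2 / d\<^sup>2 * 0)"
        unfolding \<rho>_def[abs_def] by (intro tendsto_add tendsto_mult tendsto_const A_lim lim0)
      then have "(\<lambda>n. prob (A n) + exp (\<gamma> * l) * (G x0 + l * \<rho> n) / (c ^ 3 - e)) \<longlonglongrightarrow>
          0 + exp (\<gamma> * l) * (G x0 + l * (e * \<kappa> + \<kappa> * B * 0 + (e * k1 + 3 * B * C ^ 4 * (real CARD('d))\<^sup>2 / d\<^sup>2 * 0))) / (c ^ 3 - e)"
        using e by (intro tendsto_add tendsto_divide tendsto_mult tendsto_const A_lim) auto
      then show "(\<lambda>n. prob (A n) + exp (\<gamma> * l) * (G x0 + l * \<rho> n) / (c ^ 3 - e)) \<longlonglongrightarrow>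
          exp (\<gamma> * l) * (G x0 + l * (e * \<kappa> + e * k1)) / (c ^ 3 - e)"
        by (simp only: mult_zero_right add_0_left add_0_right)
    qed
  qed
  \<comment> \<open>Both error terms are multiples of \<open>e\<close>, and the denominator tends to
    \<open>c ^ 3\<close>, which is positive.\<close>
  have "((\<lambda>e. exp (\<gamma> * l) * (G x0 + l * (e * \<kappa> + e * k1)) / (c ^ 3 - e)) \<longlongrightarrow>
      exp (\<gamma> * l) * (G x0 + l * (0 * \<kappa> + 0 * k1)) / (c ^ 3 - 0)) (at_right 0)"
    using c by (intro tendsto_divide tendsto_mult tendsto_add tendsto_diff tendsto_const tendsto_ident_at) auto
  then have "prob E \<le> exp (\<gamma> * l) * (G x0 + l * (0 * \<kappa> + 0 * k1)) / (c ^ 3 - 0)"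
  proof (rule tendsto_lowerbound)
    have "\<forall>\<^sub>F e in at_right 0. e \<in> {0<..<c ^ 3}" using c by (intro eventually_at_right_real) simp
    then show "\<forall>\<^sub>F e in at_right 0. prob E \<le> exp (\<gamma> * l) * (G x0 + l * (e * \<kappa> + e * k1)) / (c ^ 3 - e)"
      by eventually_elim (rule bound_e; simp)
  qed simp
  then show ?thesis using x0_S by (simp add: E_def G_def)
qed

end

section \<open>Forward invariance\<close>

lemma locally_Lipschitz_continuous:
  assumes "locally_Lipschitz f"
  shows "continuous_on UNIV f"
proof (rule continuous_at_imp_continuous_on, rule ballI)
  fix x
  obtain r L where r: "0 < r" and L: "L-lipschitz_on (cball x r) f"
    using assms unfolding locally_Lipschitz_def by blast
  have "continuous_on (ball x r) f"
    using lipschitz_on_continuous_on[OF L] by (rule continuous_on_subset) auto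
  then show "isCont f x" using r by (simp add: continuous_on_eq_continuous_at)
qed

lemma continuous_on_closed_loop_drift:
  assumes "continuous_on S f" "continuous_on S g" "continuous_on S uo" "continuous_on S \<phi>"
  shows "continuous_on S (closed_loop_drift f g uo \<phi>)"
  unfolding closed_loop_drift_def[abs_def] matrix_vector_mult_def
  using assms by (intro continuous_intros)

text \<open>The points \<open>q * l\<close> with rational \<open>q\<close> in \<open>[0, 1]\<close>
  are dense in \<open>{0..l}\<close> and include both endpoints, also for \<open>l = 0\<close>. This
  countable family makes the invariance event measurable.\<close>

lemma continuous_le_of_rational_points:
  fixes V :: "real \<Rightarrow> real"
  assumes V: "continuous_on {0..l} V" and l: "0 \<le> l" and le: "\<And>q. q \<in> \<rat> \<Longrightarrow> 0 \<le> q \<Longrightarrow> q \<le> 1 \<Longrightarrow> V (q * l) \<le> c"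
    and t: "t \<in> {0..l}"
  shows "V t \<le> c"
proof (rule ccontr)
  assume "\<not> V t \<le> c"
  then have gt: "0 < V t - c" by simp
  obtain \<delta> where \<delta>: "0 < \<delta>" "\<And>s. s \<in> {0..l} \<Longrightarrow> dist s t < \<delta> \<Longrightarrow> dist (V s) (V t) < V t - c"
    using V t gt unfolding continuous_on_iff by blast
  show False
  proof (cases "t = 0")
    case True
    then show False using le[of 0] gt by simp
  next
    case False
    then have pos: "0 < t" "0 < l" using t by auto
    have "max 0 ((t - \<delta>) / l) < t / l" using pos \<delta>(1) by (simp add: divide_strict_right_mono)
    then obtain q where q: "q \<in> \<rat>" "max 0 ((t - \<delta>) / l) < q" "q < t / l" using Rats_dense_in_real by blast
    have q1: "0 < q" "(t - \<delta>) / l < q" using q(2) by simp_all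
    have ql: "t - \<delta> < q * l" "q * l < t" using q1(2) q(3) pos by (simp_all add: pos_divide_less_eq pos_less_divide_eq)
    have "t / l \<le> 1" using t pos by simp
    then have "V (q * l) \<le> c" using q q1 by (intro le) auto
    moreover have "dist (V (q * l)) (V t) < V t - c"
    proof (rule \<delta>(2))
      have "0 \<le> q * l" using q1 pos by simp
      then show "q * l \<in> {0..l}" using ql t unfolding atLeastAtMost_iff by linarith
      show "dist (q * l) t < \<delta>" unfolding dist_real_def using ql by linarith
    qed
    ultimately show False unfolding dist_real_def using gt by linarith
  qed
qed

context wiener_space
begin

text \<open>Almost surely, a path outside the invariance event has a time \<open>t \<le> l\<close>
  before \<open>T\<close> with \<open>V (X t) > c\<close>; if \<open>T \<le> l\<close>, maximality
  supplies it. As \<open>\<tau> k\<close> tends to \<open>T\<close>, this time is eventually below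
  \<open>\<tau> k\<close>, so the exit bound, which is the same for all \<open>k\<close>, carries
  over to the whole lifetime.\<close>

lemma invariance_estimate:
  fixes V :: "real ^ 'n \<Rightarrow> real" and \<sigma> :: "real ^ 'n \<Rightarrow> real ^ 'd ^ 'n"
  assumes S: "open S" and x0: "x0 \<in> S" and b: "continuous_on S b" and \<sigma>: "continuous_on S \<sigma>"
    and V: "has_C2 S V DV D2V" and V_nonneg: "\<And>x. x \<in> S \<Longrightarrow> 0 \<le> V x" and K: "compact {x \<in> S. V x \<le> c}"
    and \<gamma>: "0 \<le> \<gamma>"
    and gen: "\<And>x. x \<in> S \<Longrightarrow> DV x \<bullet> b x + 1/2 * trace (\<sigma> x ** transpose (\<sigma> x) ** D2V x) \<le> \<gamma> * V x"
    and sol: "maximal_sde_solution P F W S b \<sigma> x0 X T"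
    and l: "0 \<le> l" and c: "0 < c" "V x0 \<le> c"
  shows "1 - exp (\<gamma> * l) * trunc c (V x0) / c ^ 3 \<le>
    prob {\<omega> \<in> space P. \<forall>t\<in>{0..l}. ennreal t < T \<omega> \<and> X t \<omega> \<in> S \<and> V (X t \<omega>) \<le> c}"
proof -
  define D where "D = {\<omega> \<in> space P. \<forall>t\<in>{0..l}. ennreal t < T \<omega> \<and> X t \<omega> \<in> S \<and> V (X t \<omega>) \<le> c}"
  have T: "stopping_time F T"
    and Xm: "\<And>t. 0 \<le> t \<Longrightarrow> X t \<in> borel_measurable (restrict_space (F (ennreal t)) {\<omega>\<in>space P. ennreal t < T \<omega>})"
    and Xc: "\<And>\<omega>. \<omega> \<in> space P \<Longrightarrow> continuous_on {t. 0 \<le> t \<and> ennreal t < T \<omega>} (\<lambda>t. X t \<omega>)"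
    and XS: "\<And>\<omega> t. \<omega> \<in> space P \<Longrightarrow> 0 \<le> t \<Longrightarrow> ennreal t < T \<omega> \<Longrightarrow> X t \<omega> \<in> S"
    and X0: "AE \<omega> in P. X 0 \<omega> = x0"
    and max: "AE \<omega> in P. T \<omega> < \<infinity> \<longrightarrow> (\<forall>K. compact K \<and> K \<subseteq> S \<longrightarrow>
           (\<forall>s\<ge>0. ennreal s < T \<omega> \<longrightarrow> (\<exists>t\<ge>s. ennreal t < T \<omega> \<and> X t \<omega> \<notin> K)))"
    using sol unfolding maximal_sde_solution_def sde_solution_def by blast+
  have "\<exists>\<tau> :: nat \<Rightarrow> 'w \<Rightarrow> ennreal.
        (\<forall>k. stopping_time F (\<tau> k)) \<and>
        (AE \<omega> in P. incseq (\<lambda>k. \<tau> k \<omega>) \<and> (\<forall>k. \<tau> k \<omega> < T \<omega>) \<and> (\<lambda>k. \<tau> k \<omega>) \<longlonglongrightarrow> T \<omega>) \<and>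
        (\<forall>k. \<exists>I. ito_integral P F W (\<lambda>s \<omega>. if ennreal s < \<tau> k \<omega> then \<sigma> (X s \<omega>) else 0) I \<and>
           (AE \<omega> in P. \<forall>t\<ge>0.
              let r = enn2real (min (ennreal t) (\<tau> k \<omega>)) in
              X r \<omega> = x0 + (LINT s:{0..r}|lborel. b (X s \<omega>)) + I t \<omega>))"
    using sol unfolding maximal_sde_solution_def sde_solution_def by (elim conjE)
  then obtain \<tau> :: "nat \<Rightarrow> 'w \<Rightarrow> ennreal" where \<tau>: "\<forall>k. stopping_time F (\<tau> k)"
    and \<tau>_lim: "AE \<omega> in P. incseq (\<lambda>k. \<tau> k \<omega>) \<and> (\<forall>k. \<tau> k \<omega> < T \<omega>) \<and> (\<lambda>k. \<tau> k \<omega>) \<longlonglongrightarrow> T \<omega>"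
    and \<tau>_I: "\<forall>k. \<exists>I. ito_integral P F W (\<lambda>s \<omega>. if ennreal s < \<tau> k \<omega> then \<sigma> (X s \<omega>) else 0) I \<and>
           (AE \<omega> in P. \<forall>t\<ge>0.
              let r = enn2real (min (ennreal t) (\<tau> k \<omega>)) in
              X r \<omega> = x0 + (LINT s:{0..r}|lborel. b (X s \<omega>)) + I t \<omega>)"
    by (elim exE conjE)
  have "\<forall>k. \<exists>I. stopped_solution P F W S b \<sigma> x0 X T (\<tau> k) I"
  proof
    fix k
    obtain I where I: "ito_integral P F W (\<lambda>s \<omega>. if ennreal s < \<tau> k \<omega> then \<sigma> (X s \<omega>) else 0) I"
      "AE \<omega> in P. \<forall>t\<ge>0.
              let r = enn2real (min (ennreal t) (\<tau> k \<omega>)) in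
              X r \<omega> = x0 + (LINT s:{0..r}|lborel. b (X s \<omega>)) + I t \<omega>"
      using \<tau>_I by blast
    have "AE \<omega> in P. \<tau> k \<omega> < T \<omega>" using \<tau>_lim by eventually_elim blast
    then have "stopped_solution P F W S b \<sigma> x0 X T (\<tau> k) I"
      by (intro stopped_solution.intro stopped_solution_axioms.intro wiener_space_axioms S x0 b \<sigma> T \<tau>[rule_format] Xm Xc XS I)
    then show "\<exists>I. stopped_solution P F W S b \<sigma> x0 X T (\<tau> k) I" by blast
  qed
  then obtain I where sol_k: "stopped_solution P F W S b \<sigma> x0 X T (\<tau> k) (I k)" for k by metis
  define E where "E k = {\<omega> \<in> space P. \<exists>t\<in>{0..l}. stopped_solution.alive T (\<tau> k) t \<omega> \<and> c < V (stopped_solution.Xs x0 X T t \<omega>)}" for k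
  have cV: "continuous_on S V"
    using V has_derivative_continuous_on[of S V "\<lambda>x v. DV x \<bullet> v"]
    unfolding has_C2_def by (blast intro: has_derivative_at_withinI)
  have E_ev: "E k \<in> events" for k
    unfolding E_def by (rule stopped_solution.exit_event_measurable(1)[OF sol_k cV])
  have E_iff: "\<omega> \<in> E k \<longleftrightarrow> \<omega> \<in> space P \<and> (\<exists>t\<in>{0..l}. ennreal t < \<tau> k \<omega> \<and> ennreal t < T \<omega> \<and> c < V (X t \<omega>))" for k \<omega>
    unfolding E_def by (auto simp: stopped_solution.alive_def[OF sol_k] stopped_solution.Xs_def[OF sol_k])
  let ?B = "exp (\<gamma> * l) * trunc c (V x0) / c ^ 3"
  have B: "0 \<le> ?B" using trunc_bounds(1)[of c "V x0"] V_nonneg[OF x0] c by simp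
  have E_prob: "prob (E k) \<le> ?B" for k
  \<comment> \<open>A grid needs positive length. For \<open>l = 0\<close> the only time is 0, and
    there \<open>V (X 0) = V x0 \<le> c\<close> almost surely.\<close>
  proof (cases "l = 0")
    case True
    have "prob (E k) = 0"
    proof (rule prob_eq_0[THEN iffD2, OF E_ev])
      show "AE \<omega> in P. \<omega> \<notin> E k"
        using X0 by eventually_elim (use c True in \<open>auto simp: E_iff\<close>)
    qed
    then show ?thesis using B by simp
  next
    case False
    then show ?thesis
      unfolding E_def
      using stopped_solution.exit_probability[OF sol_k V V_nonneg K c(1) _ \<gamma> gen] l by simp
  qed
  have lT_ev: "{\<omega> \<in> space P. ennreal l < T \<omega>} \<in> events"
    using F_measurable[OF stopping_timeD2[OF T, of "ennreal l"]] by (simp add: Measurable.pred_def)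
  have path: "continuous_on {0..l} (\<lambda>t. V (X t \<omega>))" "\<And>t. t \<in> {0..l} \<Longrightarrow> ennreal t < T \<omega> \<and> X t \<omega> \<in> S"
    if "\<omega> \<in> space P" "ennreal l < T \<omega>" for \<omega>
  proof -
    have lt: "ennreal t < T \<omega>" if "t \<in> {0..l}" for t
    proof -
      have "ennreal t \<le> ennreal l" using that by (intro ennreal_leI) simp
      then show ?thesis using \<open>ennreal l < T \<omega>\<close> by (rule le_less_trans)
    qed
    show S: "ennreal t < T \<omega> \<and> X t \<omega> \<in> S" if "t \<in> {0..l}" for t
      using XS[OF \<open>\<omega> \<in> space P\<close> _ lt[OF that]] lt[OF that] that by simp
    have "continuous_on {0..l} (\<lambda>t. X t \<omega>)"
      using Xc[OF \<open>\<omega> \<in> space P\<close>] by (rule continuous_on_subset) (use lt in auto)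
    then show "continuous_on {0..l} (\<lambda>t. V (X t \<omega>))"
      by (rule continuous_on_compose2[OF cV]) (use S in blast)
  qed
  have ql: "q * l \<in> {0..l}" if "q \<in> {0..1}" for q
    using that l mult_left_le_one_le[of l q] by simp
  \<comment> \<open>If the path lives at time \<open>l\<close>, it lives and is continuous on all of
    \<open>{0..l}\<close>, so countably many comparisons decide the event. They are stated with
    \<open>Xs\<close>, which is measurable on the whole probability space.\<close>
  have D_eq: "D = {\<omega> \<in> space P. ennreal l < T \<omega>} \<inter>
      (\<Inter>q\<in>\<rat> \<inter> {0..1}. {\<omega> \<in> space P. ennreal (q * l) < T \<omega> \<longrightarrow> V (stopped_solution.Xs x0 X T (q * l) \<omega>) \<le> c})"
  proof (intro equalityI subsetI)
    fix \<omega> assume "\<omega> \<in> D"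
    then have \<omega>: "\<omega> \<in> space P" "\<And>t. t \<in> {0..l} \<Longrightarrow> ennreal t < T \<omega> \<and> V (X t \<omega>) \<le> c" by (auto simp: D_def)
    have "V (stopped_solution.Xs x0 X T (q * l) \<omega>) \<le> c" if "q \<in> {0..1}" for q
      using \<omega>(2)[OF ql[OF that]] by (simp add: stopped_solution.Xs_def[OF sol_k])
    moreover have "ennreal l < T \<omega>" using \<omega>(2)[of l] l by simp
    ultimately show "\<omega> \<in> {\<omega> \<in> space P. ennreal l < T \<omega>} \<inter>
      (\<Inter>q\<in>\<rat> \<inter> {0..1}. {\<omega> \<in> space P. ennreal (q * l) < T \<omega> \<longrightarrow> V (stopped_solution.Xs x0 X T (q * l) \<omega>) \<le> c})"
      using \<omega>(1) by blast
  next
    fix \<omega> assume a: "\<omega> \<in> {\<omega> \<in> space P. ennreal l < T \<omega>} \<inter>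
      (\<Inter>q\<in>\<rat> \<inter> {0..1}. {\<omega> \<in> space P. ennreal (q * l) < T \<omega> \<longrightarrow> V (stopped_solution.Xs x0 X T (q * l) \<omega>) \<le> c})"
    then have \<omega>: "\<omega> \<in> space P" "ennreal l < T \<omega>" by auto
    note p = path[OF \<omega>]
    have "V (X t \<omega>) \<le> c" if "t \<in> {0..l}" for t
    proof (rule continuous_le_of_rational_points[OF p(1) l _ that])
      fix q :: real assume q: "q \<in> \<rat>" "0 \<le> q" "q \<le> 1"
      then have lt: "ennreal (q * l) < T \<omega>" using p(2)[OF ql[of q]] by simp
      have "ennreal (q * l) < T \<omega> \<longrightarrow> V (stopped_solution.Xs x0 X T (q * l) \<omega>) \<le> c"
        using a q by simp
      then show "V (X (q * l) \<omega>) \<le> c"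
        using lt by (simp add: stopped_solution.Xs_def[OF sol_k])
    qed
    then show "\<omega> \<in> D" using \<omega>(1) p(2) by (auto simp: D_def)
  qed
  have D_ev: "D \<in> events"
    unfolding D_eq
  proof (intro sets.Int lT_ev sets.countable_INT' image_subsetI)
    show "countable (\<rat> \<inter> {0..1 :: real})" using countable_rat by blast
    have "0 \<in> \<rat> \<inter> {0..1 :: real}" by simp
    then show "\<rat> \<inter> {0..1 :: real} \<noteq> {}" by blast
    show "{\<omega> \<in> space P. ennreal (q * l) < T \<omega> \<longrightarrow> V (stopped_solution.Xs x0 X T (q * l) \<omega>) \<le> c} \<in> events" if "q \<in> \<rat> \<inter> {0..1}" for q
    proof -
      have q: "0 \<le> q * l" using that l by simp
      have [measurable]: "(\<lambda>\<omega>. V (stopped_solution.Xs x0 X T (q * l) \<omega>)) \<in> borel_measurable P"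
        by (rule F_measurable[OF stopped_solution.Xs_compose_measurable[OF sol_k q cV]])
      have [measurable]: "Measurable.pred P (\<lambda>\<omega>. ennreal (q * l) < T \<omega>)"
        by (rule F_measurable[OF stopping_timeD2[OF T]])
      show ?thesis by measurable
    qed
  qed
  have "prob (space P - D) \<le> ?B"
  proof (rule prob_le_of_eventually[OF _ E_ev])
    show "space P - D \<in> events" using D_ev by auto
    show "\<forall>\<^sub>F n in sequentially. prob (E n) \<le> ?B" using E_prob by simp
    show "AE \<omega> in P. \<omega> \<in> space P - D \<longrightarrow> (\<forall>\<^sub>F n in sequentially. \<omega> \<in> E n)"
      using \<tau>_lim max AE_space
    proof eventually_elim
      case (elim \<omega>)
      have Tpos: "0 < T \<omega>" 
        using elim(1) by (auto intro: le_less_trans[OF zero_le])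
      show ?case
      proof
        assume nD: "\<omega> \<in> space P - D"
        have "\<exists>t\<in>{0..l}. ennreal t < T \<omega> \<and> c < V (X t \<omega>)"
        proof (rule ccontr)
          assume no: "\<not> (\<exists>t\<in>{0..l}. ennreal t < T \<omega> \<and> c < V (X t \<omega>))"
          show False
          proof (cases "ennreal l < T \<omega>")
            case True
            have "V (X t \<omega>) \<le> c" if "t \<in> {0..l}" for t
              using no path(2)[OF elim(3) True that] that by (meson not_less)
            then have "\<omega> \<in> D" unfolding D_def using path(2)[OF elim(3) True] elim(3) by blast
            then show False using nD by simp
          next
            case False
            then have Tl: "T \<omega> \<le> ennreal l" by simp
            then have "T \<omega> < \<infinity>" using le_less_trans[OF Tl ennreal_less_top] by simp
            with elim(2) have "\<forall>K. compact K \<and> K \<subseteq> S \<longrightarrow>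
                (\<forall>s\<ge>0. ennreal s < T \<omega> \<longrightarrow> (\<exists>t\<ge>s. ennreal t < T \<omega> \<and> X t \<omega> \<notin> K))" by (rule mp)
            \<comment> \<open>Maximality is used with the compact sublevel set and starting time 0.
              Leaving that set before \<open>T\<close> can only mean \<open>V > c\<close>, as the
              path stays in \<open>S\<close> until then.\<close>
            then have "\<exists>t\<ge>0. ennreal t < T \<omega> \<and> X t \<omega> \<notin> {x \<in> S. V x \<le> c}"
              using K Tpos by (elim allE[of _ "{x \<in> S. V x \<le> c}"] impE) (auto simp: ennreal_0)
            then obtain t where t: "0 \<le> t" "ennreal t < T \<omega>" "X t \<omega> \<notin> {x \<in> S. V x \<le> c}" by blast
            have "ennreal t \<le> ennreal l" using t(2) Tl by (meson less_imp_le order_trans)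
            then have "t \<in> {0..l}" using t(1) l by (simp add: ennreal_le_iff)
            moreover have "c < V (X t \<omega>)" using t XS[OF elim(3) t(1,2)] by auto
            ultimately show False using no t(2) by blast
          qed
        qed
        then obtain t where t: "t \<in> {0..l}" "ennreal t < T \<omega>" "c < V (X t \<omega>)" by blast
        have "\<forall>\<^sub>F n in sequentially. ennreal t < \<tau> n \<omega>"
          by (rule order_tendstoD(1)[OF elim(1)[THEN conjunct2, THEN conjunct2] t(2)])
        then show "\<forall>\<^sub>F n in sequentially. \<omega> \<in> E n"
          by eventually_elim (use t elim(3) in \<open>auto simp: E_iff\<close>)
      qed
    qed
  qed simp
  then show ?thesis
    using prob_compl[OF D_ev] unfolding D_def[symmetric] by linarith
qed

end

theorem theorem3:
  fixes P :: "'w measure" and F :: "ennreal \<Rightarrow> 'w measure"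
    and W :: "real \<Rightarrow> 'w \<Rightarrow> real ^ 'd"
    and f :: "real ^ 'n \<Rightarrow> real ^ 'n"
    and g :: "real ^ 'n \<Rightarrow> real ^ 'm ^ 'n"
    and \<sigma> :: "real ^ 'n \<Rightarrow> real ^ 'd ^ 'n"
    and uo \<phi> :: "real ^ 'n \<Rightarrow> real ^ 'm"
    and S :: "(real ^ 'n) set" and h :: "real ^ 'n \<Rightarrow> real" and \<gamma> :: real
  assumes space: "filtered_prob_space P F"
    and wiener: "wiener_process P F W"
    and Lipschitz: "locally_Lipschitz f" "locally_Lipschitz g" "locally_Lipschitz \<sigma>"
    and uo: "continuous_on UNIV uo"
    and "open S"
    and Z1: "C2_on S h"
    and Z2: "\<forall>L>0. compact {x\<in>S. h x \<ge> L}"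
    and Z3: "S = {x. h x > 0}" "frontier S = {x. h x = 0}"
    and zcbf: "AS_ZCBF f g \<sigma> uo S h \<phi> \<gamma>"
  shows "FIiP P F W f g \<sigma> uo \<phi> S"
proof -
  interpret wiener_space P F W
    using space wiener by (intro wiener_space.intro wiener_space_axioms.intro)
  let ?V = "\<lambda>x. 1 / h x"
  have h: "0 < h x" if "x \<in> S" for x using that Z3(1) by auto
  have \<gamma>: "0 \<le> \<gamma>" and \<phi>: "continuous_on S \<phi>" using zcbf by (auto simp: AS_ZCBF_def)
  obtain DV D2V where V: "has_C2 S ?V DV D2V"
    and gen: "\<And>x. x \<in> S \<Longrightarrow> DV x \<bullet> closed_loop_drift f g uo \<phi> x + 1/2 * trace (\<sigma> x ** transpose (\<sigma> x) ** D2V x) \<le> \<gamma> * ?V x"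
    using reciprocal_barrier[OF \<open>open S\<close> Z1 h zcbf] by blast
  have V_pos: "0 < ?V x" if "x \<in> S" for x using h[OF that] by simp
  have K: "compact {x \<in> S. ?V x \<le> L}" if "0 < L" for L
  proof -
    have "{x \<in> S. ?V x \<le> L} = {x \<in> S. h x \<ge> 1 / L}"
      using h that by (auto simp: field_simps)
    then show ?thesis using Z2 that by simp
  qed
  \<comment> \<open>Properness must include level 0, which (Z2) does not reach by inversion; there
    the sublevel set is empty because \<open>1 / h\<close> is positive.\<close>
  have K': "compact {x \<in> S. ?V x \<le> L}" if "0 \<le> L" for L
  proof (cases "L = 0")
    case True
    then have "{x \<in> S. ?V x \<le> L} = {}" using V_pos by (auto simp: not_le)
    then show ?thesis by (simp only: compact_empty)
  next
    case False
    then show ?thesis using that by (intro K) simp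
  qed
  note continuous_on_S = continuous_on_subset[OF _ subset_UNIV[of S]]
  note Lipschitz_S = continuous_on_S[OF locally_Lipschitz_continuous]
  have b: "continuous_on S (closed_loop_drift f g uo \<phi>)"
    by (rule continuous_on_closed_loop_drift[OF Lipschitz_S[OF Lipschitz(1)] Lipschitz_S[OF Lipschitz(2)]
        continuous_on_S[OF uo] \<phi>])
  have \<sigma>: "continuous_on S \<sigma>" by (rule Lipschitz_S[OF Lipschitz(3)])
  show ?thesis
    unfolding FIiP_def
  proof (intro exI[of _ ?V] conjI ballI allI impI)
    show "C2_on S ?V" by (rule has_C2_imp_C2_on[OF \<open>open S\<close> V])
    show "0 \<le> ?V x" if "x \<in> S" for x using V_pos[OF that] by simp
    show "compact {x \<in> S. ?V x \<le> L}" if "0 \<le> L" for L by (rule K'[OF that])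
    fix x0 assume x0: "x0 \<in> S"
    define \<psi> where "\<psi> l \<epsilon> = 3 * exp (\<gamma> * l) * ?V x0 / \<epsilon>" for l \<epsilon>
    show "\<exists>\<psi> :: real \<Rightarrow> real \<Rightarrow> real.
           continuous_on ({0..} \<times> {0<..<1}) (\<lambda>(l, \<epsilon>). \<psi> l \<epsilon>) \<and>
           (\<forall>l\<ge>0. \<forall>\<epsilon>\<in>{0<..<1}. 0 \<le> \<psi> l \<epsilon>) \<and>
           (\<forall>X T. maximal_sde_solution P F W S (closed_loop_drift f g uo \<phi>) \<sigma> x0 X T \<longrightarrow>
              (\<forall>l\<ge>0. \<forall>\<epsilon>\<in>{0<..<1}.
                 prob {\<omega>\<in>space P. \<forall>t\<in>{0..l}.
                   ennreal t < T \<omega> \<and> X t \<omega> \<in> S \<and> ?V (X t \<omega>) \<le> \<psi> l \<epsilon>} \<ge> 1 - \<epsilon>))"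
    proof (intro exI[of _ \<psi>] conjI allI impI ballI)
      show "continuous_on ({0..} \<times> {0<..<1}) (\<lambda>(l, \<epsilon>). \<psi> l \<epsilon>)"
        unfolding \<psi>_def split_def by (intro continuous_intros) auto
      show "0 \<le> \<psi> l \<epsilon>" if "\<epsilon> \<in> {0<..<1}" for l \<epsilon>
        using that V_pos[OF x0] by (simp add: \<psi>_def)
      fix X T and l \<epsilon> :: real
      assume sol: "maximal_sde_solution P F W S (closed_loop_drift f g uo \<phi>) \<sigma> x0 X T"
        and l: "0 \<le> l" and \<epsilon>: "\<epsilon> \<in> {0<..<1}"
      let ?c = "\<psi> l \<epsilon>"
      have c: "0 < ?c" using V_pos[OF x0] \<epsilon> by (simp add: \<psi>_def)
      have e1: "1 \<le> exp (\<gamma> * l)" using \<gamma> l by simp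
      \<comment> \<open>This shows that the level \<open>\<psi> l \<epsilon>\<close> is at least
        \<open>1 / h x0\<close>, as \<open>invariance_estimate\<close> demands of the starting
        point.\<close>
      have "\<epsilon> \<le> 3 * exp (\<gamma> * l)" using e1 \<epsilon> unfolding greaterThanLessThan_iff by linarith
      then have "1 \<le> 3 * exp (\<gamma> * l) / \<epsilon>" using \<epsilon> by (simp add: le_divide_eq_1_pos)
      then have "1 * ?V x0 \<le> (3 * exp (\<gamma> * l) / \<epsilon>) * ?V x0"
        using less_imp_le[OF V_pos[OF x0]] by (rule mult_right_mono)
      then have V_le: "?V x0 \<le> ?c" by (simp add: \<psi>_def mult.commute)
      have "trunc ?c (?V x0) \<le> 3 * ?c\<^sup>2 * ?V x0"
        using c V_pos[OF x0] by (intro trunc_bounds) auto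
      then have "exp (\<gamma> * l) * trunc ?c (?V x0) / ?c ^ 3 \<le> exp (\<gamma> * l) * (3 * ?c\<^sup>2 * ?V x0) / ?c ^ 3"
        using c by (intro divide_right_mono mult_left_mono) auto
      also have "\<dots> = 3 * exp (\<gamma> * l) * ?V x0 / ?c"
        using c by (simp add: power2_eq_square power3_eq_cube)
      also have "\<dots> = \<epsilon>"
      proof -
        have "a / (a / \<epsilon>) = \<epsilon>" if "a \<noteq> 0" for a using that \<epsilon> by simp
        from this[of "3 * exp (\<gamma> * l) * ?V x0"] show ?thesis
          using V_pos[OF x0] unfolding \<psi>_def by simp
      qed
      finally have "1 - \<epsilon> \<le> 1 - exp (\<gamma> * l) * trunc ?c (?V x0) / ?c ^ 3" by simp
      also have "\<dots> \<le> prob {\<omega>\<in>space P. \<forall>t\<in>{0..l}. ennreal t < T \<omega> \<and> X t \<omega> \<in> S \<and> ?V (X t \<omega>) \<le> ?c}"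
        by (rule invariance_estimate[OF \<open>open S\<close> x0 b \<sigma> V less_imp_le[OF V_pos] K[OF c] \<gamma> gen sol l c V_le])
      finally show "1 - \<epsilon> \<le> prob {\<omega>\<in>space P. \<forall>t\<in>{0..l}. ennreal t < T \<omega> \<and> X t \<omega> \<in> S \<and> ?V (X t \<omega>) \<le> ?c}" .
    qed
  qed
qed

end
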